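(* Consider $m$ users, where user $j\in\{1,\ldots,m\}$ has a quantum memory described by a sequence of quantum channels $(\mathcal{N}^i_j)_{i\in\mathbb{N}}$, and for $S\subseteq\{1,\ldots,m\}$ define $\mathcal{N}^i_S=\bigotimes_{j\in S}\mathcal{N}^i_j$. Let $d=|A|\in\mathbb{N}$ be the dimension of the secret system $A$, let $\delta\in(0,\frac{d-1}{2d})$, and let $\varepsilon\in(0,\frac{d-1}{2d}-\delta)$. Then, for all $n\in\mathbb{N}$ larger than $$\min\left\{n\in\mathbb{N}:\ \exists S\in\mathcal{S}_t:\ \prod_{i=1}^n\eta_{\mathrm{MI}}(\mathcal{N}^i_S)\leq\frac{\delta^2}{2\ln(2)\,\log\left(\min\{|B_S|,|A\otimes B_{S^c}|\}\right)}\right\},$$ there does not exist an encoding channel $\mathcal{E}_{A\to B^m}$ that is $\varepsilon$-recoverable for $(t,m)$-sharing under the noise model $\mathcal{N}^{n}=\bigotimes_{j=1}^m\left(\mathcal{N}^n_j\circ\cdots\circ\mathcal{N}^1_j\right)$.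
   Context: All systems are finite-dimensional; logarithms are base 2. $B_1,\ldots,B_m$ are the users' input systems (the domain of $\mathcal{N}^1_j$ is $B_j$, and consecutive channels $\mathcal{N}^i_j,\mathcal{N}^{i+1}_j$ are composable), $B^m=\bigotimes_jB_j$, $B_S=\bigotimes_{j\in S}B_j$, $S^c$ is the complement of $S$ in $\{1,\ldots,m\}$, $\mathcal{S}_t=\{S\subset\{1,\ldots,m\}:|S|=t\}$, and $|\cdot|$ of a system is its dimension. For a channel $\mathcal{T}\colon A\to B$, $\eta_{\mathrm{MI}}(\mathcal{T})=\sup_{C,\rho_{CA}}\frac{I(C:B)_{\mathcal{T}(\rho)}}{I(C:A)_\rho}$ over all finite-dimensional quantum systems $C$ and states with positive denominator, where $I(C:A)=D(\rho_{CA}\|\rho_C\otimes\rho_A)$ is the mutual information ($D$ the Umegaki relative entropy). Fidelity of states: $F(P,Q)=\|\sqrt P\sqrt Q\|_1^2$; of channels: $F(\mathcal{T},\mathcal{T}')=\inf_{R,\rho_{RA}}F((\operatorname{id}_R\otimes\mathcal{T})(\rho_{RA}),(\operatorname{id}_R\otimes\mathcal{T}')(\rho_{RA}))$. An encoding channel $\mathcal{E}_{A\to B^m}$ is $\varepsilon$-recoverable for $(t,m)$-sharing under a noise model $\mathcal{N}_{B^m\to\widetilde B^m}$ if $$1-\varepsilon\leq\min_{S\in\mathcal{S}_t}\ \max_{\mathcal{D}_{\widetilde B_S\to A}}F(\mathcal{D}\circ\operatorname{Tr}_{\widetilde B_{S^c}}\circ\mathcal{N}\circ\mathcal{E},\operatorname{id}_A),$$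 where the maximum is over all channels from $\widetilde B_S=\bigotimes_{j\in S}\widetilde B_j$ to $A$. *)

theory Defs
  imports Complex_Main "HOL-Library.FuncSet" "HOL-Library.Nonpos_Ints"
    "HOL-Library.Extended_Nonnegative_Real"
begin

text \<open>
  A finite-dimensional quantum system is given by a finite nonempty set \<open>X\<close> labelling an
  orthonormal basis; its operators are the matrices that vanish outside of \<open>X \<times> X\<close>.
  Composite systems are labelled by Cartesian products, and the tensor product of a family
  \<open>(X j)\<close> over \<open>j \<in> S\<close> is labelled by the set \<open>PiE S X\<close> of tuples.  In this way dimensions and
  sets of tensor factors can be quantified over.  A system of unspecified finite dimension
  (a reference system) is \<open>{..<r}\<close> with \<open>r > 0\<close>.
\<close>

type_synonym 'a oper = "'a \<Rightarrow> 'a \<Rightarrow> complex"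

definition opers :: "'a set \<Rightarrow> 'a oper set" where
  "opers X = {M. \<forall>x y. M x y \<noteq> 0 \<longrightarrow> x \<in> X \<and> y \<in> X}"

definition op_trace :: "'a set \<Rightarrow> 'a oper \<Rightarrow> complex" where
  "op_trace X M = (\<Sum>x\<in>X. M x x)"

definition op_mult :: "'a set \<Rightarrow> 'a oper \<Rightarrow> 'a oper \<Rightarrow> 'a oper" where
  "op_mult X M N = (\<lambda>x y. \<Sum>z\<in>X. M x z * N z y)"

definition op_adjoint :: "'a oper \<Rightarrow> 'a oper" where
  "op_adjoint M = (\<lambda>x y. cnj (M y x))"

definition op_apply :: "'a set \<Rightarrow> 'a oper \<Rightarrow> ('a \<Rightarrow> complex) \<Rightarrow> 'a \<Rightarrow> complex" where
  "op_apply X M v = (\<lambda>x. \<Sum>y\<in>X. M x y * v y)"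

definition op_unit :: "'a \<Rightarrow> 'a \<Rightarrow> 'a oper" where
  "op_unit a b = (\<lambda>x y. if x = a \<and> y = b then 1 else 0)"

definition op_tensor :: "'a oper \<Rightarrow> 'b oper \<Rightarrow> ('a \<times> 'b) oper" where
  "op_tensor M N = (\<lambda>(x, y) (x', y'). M x x' * N y y')"

definition op_pos :: "'a set \<Rightarrow> 'a oper \<Rightarrow> bool" where
  "op_pos X M \<longleftrightarrow> (\<forall>v. (\<Sum>x\<in>X. cnj (v x) * op_apply X M v x) \<in> \<real>\<^sub>\<ge>\<^sub>0)"

definition states :: "'a set \<Rightarrow> 'a oper set" where
  "states X = {M \<in> opers X. op_pos X M \<and> op_trace X M = 1}"

text \<open>
  Functional calculus for Hermitian operators.  The operator \<open>f(H)\<close> does not depend on the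
  chosen orthonormal eigenbasis \<open>u\<close> with eigenvalues \<open>l\<close>.
\<close>

definition eigendecomposition ::
  "'a set \<Rightarrow> 'a oper \<Rightarrow> ('a \<Rightarrow> 'a \<Rightarrow> complex) \<Rightarrow> ('a \<Rightarrow> real) \<Rightarrow> bool" where
  "eigendecomposition X H u l \<longleftrightarrow>
     (\<forall>j\<in>X. \<forall>k\<in>X. (\<Sum>x\<in>X. cnj (u j x) * u k x) = (if j = k then 1 else 0)) \<and>
     (\<forall>x\<in>X. \<forall>y\<in>X. H x y = (\<Sum>k\<in>X. complex_of_real (l k) * u k x * cnj (u k y)))"

definition op_fun :: "'a set \<Rightarrow> (real \<Rightarrow> real) \<Rightarrow> 'a oper \<Rightarrow> 'a oper" where
  "op_fun X f H = (THE K. \<exists>u l. eigendecomposition X H u l \<and>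
     K = (\<lambda>x y. if x \<in> X \<and> y \<in> X
                then \<Sum>k\<in>X. complex_of_real (f (l k)) * u k x * cnj (u k y) else 0))"

definition op_sqrt :: "'a set \<Rightarrow> 'a oper \<Rightarrow> 'a oper" where
  "op_sqrt X = op_fun X sqrt"

text \<open>The logarithm is taken on the support, which implements \<open>0 log 0 = 0\<close>.\<close>

definition op_log :: "'a set \<Rightarrow> 'a oper \<Rightarrow> 'a oper" where
  "op_log X = op_fun X (\<lambda>x. if x > 0 then log 2 x else 0)"

definition trace_norm :: "'a set \<Rightarrow> 'a oper \<Rightarrow> real" where
  "trace_norm X M = Re (op_trace X (op_sqrt X (op_mult X (op_adjoint M) M)))"

definition fidelity :: "'a set \<Rightarrow> 'a oper \<Rightarrow> 'a oper \<Rightarrow> real" where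
  "fidelity X P Q = (trace_norm X (op_mult X (op_sqrt X P) (op_sqrt X Q)))\<^sup>2"

text \<open>
  Umegaki relative entropy; the condition says that the kernel of the second argument is
  contained in the kernel of the first one, that is, the opposite inclusion of the supports.
\<close>

definition rel_entropy :: "'a set \<Rightarrow> 'a oper \<Rightarrow> 'a oper \<Rightarrow> ereal" where
  "rel_entropy X P Q =
     (if \<forall>v. (\<forall>x\<in>X. op_apply X Q v x = 0) \<longrightarrow> (\<forall>x\<in>X. op_apply X P v x = 0)
      then ereal (Re (op_trace X (op_mult X P (\<lambda>x y. op_log X P x y - op_log X Q x y))))
      else \<infinity>)"

definition marginal_fst :: "'b set \<Rightarrow> ('a \<times> 'b) oper \<Rightarrow> 'a oper" where
  "marginal_fst Y M = (\<lambda>x x'. \<Sum>y\<in>Y. M (x, y) (x', y))"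

definition marginal_snd :: "'a set \<Rightarrow> ('a \<times> 'b) oper \<Rightarrow> 'b oper" where
  "marginal_snd X M = (\<lambda>y y'. \<Sum>x\<in>X. M (x, y) (x, y'))"

definition mutual_info :: "'a set \<Rightarrow> 'b set \<Rightarrow> ('a \<times> 'b) oper \<Rightarrow> ereal" where
  "mutual_info X Y M =
     rel_entropy (X \<times> Y) M (op_tensor (marginal_fst Y M) (marginal_snd X M))"

text \<open>The channel \<open>id \<otimes> T\<close>, given by letting \<open>T\<close> act on the blocks of a matrix.\<close>

definition id_tensor :: "('a oper \<Rightarrow> 'b oper) \<Rightarrow> ('r \<times> 'a) oper \<Rightarrow> ('r \<times> 'b) oper" where
  "id_tensor T M = (\<lambda>(r, y) (r', y'). T (\<lambda>x x'. M (r, x) (r', x')) y y')"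

text \<open>
  Channels are completely positive trace-preserving linear maps.  The values of such a
  function outside of \<open>opers X\<close> are irrelevant.
\<close>

definition channels :: "'a set \<Rightarrow> 'b set \<Rightarrow> ('a oper \<Rightarrow> 'b oper) set" where
  "channels X Y = {T.
     (\<forall>M\<in>opers X. T M \<in> opers Y) \<and>
     (\<forall>M\<in>opers X. \<forall>N\<in>opers X. \<forall>a b.
        T (\<lambda>x y. a * M x y + b * N x y) = (\<lambda>x y. a * T M x y + b * T N x y)) \<and>
     (\<forall>r::nat. \<forall>M\<in>opers ({..<r} \<times> X).
        op_pos ({..<r} \<times> X) M \<longrightarrow> op_pos ({..<r} \<times> Y) (id_tensor T M)) \<and>
     (\<forall>M\<in>opers X. op_trace Y (T M) = op_trace X M)}"

text \<open>
  The tensor product of the channels \<open>T j\<close> from \<open>X j\<close> to \<open>Y j\<close> over \<open>j \<in> S\<close>, given by its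
  action on the matrix units, which are tensor products of matrix units.
\<close>

definition tensor_channel ::
  "'j set \<Rightarrow> ('j \<Rightarrow> 'a set) \<Rightarrow> ('j \<Rightarrow> 'b set) \<Rightarrow> ('j \<Rightarrow> 'a oper \<Rightarrow> 'b oper) \<Rightarrow>
   ('j \<Rightarrow> 'a) oper \<Rightarrow> ('j \<Rightarrow> 'b) oper" where
  "tensor_channel S X Y T M = (\<lambda>y y'.
     if y \<in> PiE S Y \<and> y' \<in> PiE S Y
     then \<Sum>x\<in>PiE S X. \<Sum>x'\<in>PiE S X.
            M x x' * (\<Prod>j\<in>S. T j (op_unit (x j) (x' j)) (y j) (y' j))
     else 0)"

text \<open>The partial trace from \<open>PiE J Y\<close> to \<open>PiE S Y\<close>, tracing out the factors in \<open>J - S\<close>.\<close>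

definition trace_out ::
  "'j set \<Rightarrow> 'j set \<Rightarrow> ('j \<Rightarrow> 'a set) \<Rightarrow> ('j \<Rightarrow> 'a) oper \<Rightarrow> ('j \<Rightarrow> 'a) oper" where
  "trace_out J S Y M = (\<lambda>y y'.
     if y \<in> PiE S Y \<and> y' \<in> PiE S Y
     then \<Sum>z\<in>PiE (J - S) Y. M (override_on z y S) (override_on z y' S)
     else 0)"

text \<open>
  The quotients below are nonnegative, so nothing is lost by taking the supremum in
  \<^typ>\<open>ennreal\<close>; there the supremum is \<open>0\<close> if no admissible state exists, which happens only for
  a one-dimensional \<open>X\<close>.
\<close>

definition eta_MI :: "'a set \<Rightarrow> 'b set \<Rightarrow> ('a oper \<Rightarrow> 'b oper) \<Rightarrow> ennreal" where
  "eta_MI X Y T = Sup {e2ennreal (mutual_info {..<c} Y (id_tensor T M) / mutual_info {..<c} X M)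
     | (c::nat) M. c > 0 \<and> M \<in> states ({..<c} \<times> X) \<and> mutual_info {..<c} X M > 0}"

definition channel_fidelity ::
  "'a set \<Rightarrow> 'b set \<Rightarrow> ('a oper \<Rightarrow> 'b oper) \<Rightarrow> ('a oper \<Rightarrow> 'b oper) \<Rightarrow> real" where
  "channel_fidelity X Y T T' = Inf {fidelity ({..<r} \<times> Y) (id_tensor T M) (id_tensor T' M)
     | (r::nat) M. r > 0 \<and> M \<in> states ({..<r} \<times> X)}"

definition user_sets :: "nat \<Rightarrow> nat \<Rightarrow> nat set set" where
  "user_sets t m = {S. S \<subseteq> {1..m} \<and> card S = t}"

text \<open>
  Here \<open>A\<close> is the secret system and \<open>Y j\<close> the output system of user \<open>j\<close> under the noise \<open>N\<close>.
  The maximum over the decoders is written as a supremum; it is attained by compactness.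
\<close>

definition recoverable ::
  "nat \<Rightarrow> nat \<Rightarrow> 'a set \<Rightarrow> (nat \<Rightarrow> 'c set) \<Rightarrow> ((nat \<Rightarrow> 'b) oper \<Rightarrow> (nat \<Rightarrow> 'c) oper) \<Rightarrow>
   real \<Rightarrow> ('a oper \<Rightarrow> (nat \<Rightarrow> 'b) oper) \<Rightarrow> bool" where
  "recoverable t m A Y N \<epsilon> E \<longleftrightarrow>
     1 - \<epsilon> \<le> (MIN S\<in>user_sets t m. SUP D\<in>channels (PiE S Y) A.
       channel_fidelity A A (D \<circ> trace_out {1..m} S Y \<circ> N \<circ> E) id)"

text \<open>\<open>iterate T n\<close> is the composition of \<open>T 1, \<dots>, T n\<close>, with \<open>T 1\<close> applied first.\<close>

primrec iterate :: "(nat \<Rightarrow> 'a \<Rightarrow> 'a) \<Rightarrow> nat \<Rightarrow> 'a \<Rightarrow> 'a" where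
  "iterate T 0 = id"
| "iterate T (Suc n) = T (Suc n) \<circ> iterate T n"

end

theory Submission
  imports Defs "Jordan_Normal_Form.Spectral_Radius" "HOL-Analysis.Convex"
begin

text \<open>
  Let half of a maximally entangled state on \<open>R \<otimes> A\<close> be encoded and sent to the users in \<open>S\<close>.  All
  states that arise have a maximally mixed marginal on \<open>R\<close>, so their mutual information is finite
  and at most \<open>2 log min (|R|, |B\<^sub>S|)\<close>; each step of the noise multiplies it by at most \<open>eta_MI\<close>.  After
  \<open>k\<close> steps it is at most \<open>\<delta>\<^sup>2 / ln 2\<close>, and the remaining steps are counted as part of the decoder.

  For states \<open>P\<close>, \<open>Q\<close> put \<open>C = (\<surd>P - \<surd>Q)\<^sup>2\<close>.  Then \<open>tr C \<le> D(P\<parallel>Q) ln 2\<close> and \<open>P \<le> (1 + s) Q + (1 + 1/s) C\<close> for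
  \<open>s > 0\<close>.  Applying this with \<open>s = \<delta>\<close> to the state after \<open>k\<close> steps and the product of its marginals
  shows, without data processing or Pinsker's inequality, that every decoder reaches at most the
  fidelity \<open>1/d\<^sup>2 + 2 \<delta>\<close> with the maximally entangled state, which is less than \<open>1 - \<epsilon>\<close>.
\<close>

subsection \<open>The spectral theorem\<close>

text \<open>The fidelity with a pure state is linear in the other state, so it is bounded by any
  operator inequality that the decoder preserves. On a product state whose first factor is maximally
  mixed this linear functional equals 1/d^2, whatever the second factor is; on the error operator it
  is at most the trace, which every channel preserves. The inequality itself rests on sqrt P = sqrt
  Q + (sqrt P - sqrt Q) and |b + c|^2 <= (1 + s) |b|^2 + (1 + 1/s) |c|^2. The mixed marginal matters
  because \<open>eta_MI\<close> lives in \<open>ennreal\<close> and \<open>e2ennreal\<close> sends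
  negative numbers to 0: a product of contraction factors can be read back as a real inequality only
  if every mutual information is known to be finite and nonnegative. The dimension of A \<otimes>
  B_{S^c} enters through its lower bound d, the dimension of the reference.\<close>

definition inner_on :: "'a set \<Rightarrow> ('a \<Rightarrow> complex) \<Rightarrow> ('a \<Rightarrow> complex) \<Rightarrow> complex" where
  "inner_on X u v = (\<Sum>x\<in>X. cnj (u x) * v x)"

definition form :: "'a set \<Rightarrow> 'a oper \<Rightarrow> ('a \<Rightarrow> complex) \<Rightarrow> complex" where
  "form X M v = (\<Sum>x\<in>X. \<Sum>y\<in>X. cnj (v x) * M x y * v y)"

definition hermitian_on :: "'a set \<Rightarrow> 'a oper \<Rightarrow> bool" where
  "hermitian_on X M \<longleftrightarrow> (\<forall>x\<in>X. \<forall>y\<in>X. M x y = cnj (M y x))"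

definition orthonormal :: "'a set \<Rightarrow> ('a \<Rightarrow> 'a \<Rightarrow> complex) \<Rightarrow> bool" where
  "orthonormal X u \<longleftrightarrow> (\<forall>j\<in>X. \<forall>k\<in>X. inner_on X (u j) (u k) = (if j = k then 1 else 0))"

lemma sum_mult_delta [simp]:
  fixes f :: "'a \<Rightarrow> 'b::semiring_1"
  assumes "finite X" "k \<in> X"
  shows "(\<Sum>j\<in>X. f j * (if j = k then 1 else 0)) = f k"
    and "(\<Sum>j\<in>X. f j * (if k = j then 1 else 0)) = f k"
    and "(\<Sum>j\<in>X. (if j = k then 1 else 0) * f j) = f k"
    and "(\<Sum>j\<in>X. (if k = j then 1 else 0) * f j) = f k"
proof -
  have *: "(\<Sum>j\<in>X. if j = k then f j else 0) = f k"
    using assms by simp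
  show "(\<Sum>j\<in>X. f j * (if j = k then 1 else 0)) = f k"
    unfolding *[symmetric] by (intro sum.cong) auto
  show "(\<Sum>j\<in>X. f j * (if k = j then 1 else 0)) = f k"
    unfolding *[symmetric] by (intro sum.cong) auto
  show "(\<Sum>j\<in>X. (if j = k then 1 else 0) * f j) = f k"
    unfolding *[symmetric] by (intro sum.cong) auto
  show "(\<Sum>j\<in>X. (if k = j then 1 else 0) * f j) = f k"
    unfolding *[symmetric] by (intro sum.cong) auto
qed

lemma orthonormalD:
  "orthonormal X u \<Longrightarrow> j \<in> X \<Longrightarrow> k \<in> X \<Longrightarrow> inner_on X (u j) (u k) = (if j = k then 1 else 0)"
  by (simp add: orthonormal_def)

lemma hermitian_on_cnj: "hermitian_on X M \<Longrightarrow> x \<in> X \<Longrightarrow> y \<in> X \<Longrightarrow> cnj (M x y) = M y x"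
  unfolding hermitian_on_def by (metis complex_cnj_cnj)

lemma form_eq_inner: "form X M v = inner_on X v (op_apply X M v)"
  by (simp add: form_def inner_on_def op_apply_def sum_distrib_left mult.assoc)

lemma op_pos_iff: "op_pos X M \<longleftrightarrow> (\<forall>v. form X M v \<in> \<real>\<^sub>\<ge>\<^sub>0)"
  by (simp add: op_pos_def form_eq_inner inner_on_def)

lemma op_pos_Re: "op_pos X M \<Longrightarrow> 0 \<le> Re (form X M v)"
  and op_pos_Im: "op_pos X M \<Longrightarrow> Im (form X M v) = 0"
  by (auto simp: op_pos_iff complex_nonneg_Reals_iff)

lemma cnj_inner_on: "cnj (inner_on X u v) = inner_on X v u"
  by (simp add: inner_on_def mult.commute)

lemma inner_on_self: "inner_on X v v = of_real (\<Sum>x\<in>X. (cmod (v x))\<^sup>2)"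
  by (simp add: inner_on_def complex_norm_square mult.commute del: of_real_power)

lemma inner_on_cong:
  "(\<And>x. x \<in> X \<Longrightarrow> u x = u' x) \<Longrightarrow> (\<And>x. x \<in> X \<Longrightarrow> v x = v' x) \<Longrightarrow> inner_on X u v = inner_on X u' v'"
  by (simp add: inner_on_def)

lemma inner_on_scale_right: "inner_on X u (\<lambda>x. c * v x) = c * inner_on X u v"
  by (simp add: inner_on_def sum_distrib_left mult.left_commute)

lemma inner_on_scale_left: "inner_on X (\<lambda>x. c * u x) v = cnj c * inner_on X u v"
  by (simp add: inner_on_def sum_distrib_left mult.assoc)

lemma inner_on_diff:
  "inner_on X (\<lambda>x. u x - c * w x) (\<lambda>x. v x - d * w x) =
     inner_on X u v - cnj c * inner_on X w v - d * inner_on X u w + cnj c * d * inner_on X w w"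
  by (simp add: inner_on_def algebra_simps sum.distrib sum_subtractf sum_distrib_left)

lemma inner_on_sum_right:
  "inner_on X u (\<lambda>x. \<Sum>k\<in>K. c k * w k x) = (\<Sum>k\<in>K. c k * inner_on X u (w k))"
proof -
  have "inner_on X u (\<lambda>x. \<Sum>k\<in>K. c k * w k x) = (\<Sum>x\<in>X. \<Sum>k\<in>K. c k * (cnj (u x) * w k x))"
    by (simp add: inner_on_def sum_distrib_left mult.left_commute)
  also have "\<dots> = (\<Sum>k\<in>K. c k * inner_on X u (w k))"
    by (subst sum.swap) (simp add: inner_on_def sum_distrib_left)
  finally show ?thesis .
qed

lemma inner_on_sum_left:
  "inner_on X (\<lambda>x. \<Sum>k\<in>K. c k * w k x) v = (\<Sum>k\<in>K. cnj (c k) * inner_on X (w k) v)"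
proof -
  have "inner_on X (\<lambda>x. \<Sum>k\<in>K. c k * w k x) v = cnj (inner_on X v (\<lambda>x. \<Sum>k\<in>K. c k * w k x))"
    by (simp add: cnj_inner_on)
  then show ?thesis
    by (simp add: inner_on_sum_right cnj_inner_on)
qed

lemma op_apply_sum:
  "op_apply X M (\<lambda>x. \<Sum>k\<in>K. c k * w k x) = (\<lambda>x. \<Sum>k\<in>K. c k * op_apply X M (w k) x)"
proof
  fix x
  have "op_apply X M (\<lambda>x. \<Sum>k\<in>K. c k * w k x) x = (\<Sum>y\<in>X. \<Sum>k\<in>K. c k * (M x y * w k y))"
    by (simp add: op_apply_def sum_distrib_left mult.left_commute)
  also have "\<dots> = (\<Sum>k\<in>K. c k * op_apply X M (w k) x)"
    by (subst sum.swap) (simp add: op_apply_def sum_distrib_left)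
  finally show "op_apply X M (\<lambda>x. \<Sum>k\<in>K. c k * w k x) x = \<dots>" .
qed

lemma op_apply_scale: "op_apply X M (\<lambda>x. c * v x) x = c * op_apply X M v x"
  by (simp add: op_apply_def sum_distrib_left mult.left_commute)

lemma hermitian_on_adjoint:
  assumes "hermitian_on X H"
  shows "inner_on X (op_apply X H u) v = inner_on X u (op_apply X H v)"
proof -
  have "inner_on X (op_apply X H u) v = (\<Sum>x\<in>X. \<Sum>y\<in>X. cnj (H x y) * cnj (u y) * v x)"
    by (simp add: inner_on_def op_apply_def sum_distrib_right)
  also have "\<dots> = (\<Sum>x\<in>X. \<Sum>y\<in>X. H y x * cnj (u y) * v x)"
    by (intro sum.cong refl) (simp add: hermitian_on_cnj[OF assms])
  also have "\<dots> = (\<Sum>y\<in>X. \<Sum>x\<in>X. H y x * cnj (u y) * v x)"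
    by (rule sum.swap)
  also have "\<dots> = inner_on X u (op_apply X H v)"
    by (simp add: inner_on_def op_apply_def sum_distrib_left mult_ac)
  finally show ?thesis .
qed

lemma form_support:
  assumes fin: "finite X" and sub: "A \<subseteq> X" and v: "\<And>x. x \<in> X - A \<Longrightarrow> v x = 0"
  shows "form X M v = form A M v"
proof -
  have "(\<Sum>w\<in>X. cnj (v z) * M z w * v w) = (\<Sum>w\<in>A. cnj (v z) * M z w * v w)" for z
    using v by (intro sum.mono_neutral_right fin sub) auto
  then have "form X M v = (\<Sum>z\<in>X. \<Sum>w\<in>A. cnj (v z) * M z w * v w)"
    by (simp only: form_def)
  also have "\<dots> = form A M v"
    unfolding form_def using v by (intro sum.mono_neutral_right fin sub) simp_all
  finally show ?thesis .
qed

text \<open>Positivity only asks the values of the form to be real and nonnegative. Basis vectors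
  give a real diagonal; the vectors e_x + \<alpha> e_y with \<alpha> = 1 and \<alpha> = i then
  compare the imaginary and the real parts of the two off-diagonal entries.\<close>

lemma op_pos_hermitian:
  assumes fin: "finite X" and pos: "op_pos X M"
  shows "hermitian_on X M"
  unfolding hermitian_on_def
proof (intro ballI)
  fix x y assume xy: "x \<in> X" "y \<in> X"
  have diag: "Im (M z z) = 0" if "z \<in> X" for z
  proof -
    define v where "v = (\<lambda>w. if w = z then 1 else 0 :: complex)"
    have "form X M v = form {z} M v"
      using that by (intro form_support[OF fin]) (auto simp: v_def)
    then have "form X M v = M z z"
      by (simp add: form_def v_def)
    then show ?thesis
      using op_pos_Im[OF pos, of v] by simp
  qed
  show "M x y = cnj (M y x)"
  proof (cases "x = y")
    case True
    then show ?thesis using diag[OF xy(1)] by (simp add: complex_eq_iff)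
  next
    case False
    have Im0: "Im (\<alpha> * M x y + cnj \<alpha> * M y x) = 0" if "cmod \<alpha> = 1" for \<alpha>
    proof -
      define v where "v = (\<lambda>w. if w = x then 1 else if w = y then \<alpha> else 0)"
      have "form X M v = form {x, y} M v"
        using xy by (intro form_support[OF fin]) (auto simp: v_def)
      also have "\<dots> = M x x + (cnj \<alpha> * \<alpha>) * M y y + (\<alpha> * M x y + cnj \<alpha> * M y x)"
        using False by (simp add: form_def v_def algebra_simps)
      also have "cnj \<alpha> * \<alpha> = 1"
        using that by (metis complex_norm_square mult.commute of_real_1 one_power2)
      finally show ?thesis
        using op_pos_Im[OF pos, of v] diag xy by simp
    qed
    from Im0[of 1] Im0[of \<i>] show ?thesis
      by (simp add: complex_eq_iff)
  qed
qed

text \<open>An enumeration of \<open>X\<close> turns \<open>H\<close> into a complex matrix, whose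
  spectrum is nonempty. The eigenvector is normalised, and moving \<open>H\<close> across the inner
  product shows that the eigenvalue is real.\<close>

lemma hermitian_eigenvector:
  assumes fin: "finite X" and ne: "X \<noteq> {}" and herm: "hermitian_on X H"
  shows "\<exists>(l::real) v. inner_on X v v = 1 \<and> (\<forall>x\<in>X. op_apply X H v x = of_real l * v x)"
proof -
  define n where "n = card X"
  obtain h where h: "bij_betw h {0..<n} X"
    using ex_bij_betw_nat_finite[OF fin] n_def by blast
  define A where "A = mat n n (\<lambda>(i, j). H (h i) (h j))"
  have A: "A \<in> carrier_mat n n" by (simp add: A_def)
  have "n > 0" using fin ne by (simp add: n_def card_gt_0_iff)
  then obtain k w where w: "w \<in> carrier_vec n" "w \<noteq> 0\<^sub>v n" "A *\<^sub>v w = k \<cdot>\<^sub>v w"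
    using spectrum_non_empty[OF A] by (auto simp: spectrum_def eigenvalue_def eigenvector_def A_def)
  define v where "v = (\<lambda>x. w $ (inv_into {0..<n} h x))"
  have vh: "v (h i) = w $ i" if "i < n" for i
    using h that by (simp add: v_def bij_betw_def)
  have eig: "op_apply X H v x = k * v x" if "x \<in> X" for x
  proof -
    obtain i where i: "i < n" "x = h i"
      using h \<open>x \<in> X\<close> unfolding bij_betw_def by force
    have "op_apply X H v x = (\<Sum>j\<in>{0..<n}. H (h i) (h j) * v (h j))"
      unfolding op_apply_def i by (rule sum.reindex_bij_betw[OF h, symmetric])
    also have "\<dots> = (A *\<^sub>v w) $ i"
      using i w(1) by (simp add: A_def scalar_prod_def vh)
    also have "\<dots> = k * v x"
      using i w by (simp add: vh)
    finally show ?thesis .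
  qed
  obtain i where i: "i < n" "w $ i \<noteq> 0"
    using w(1,2) by (metis carrier_vecD eq_vecI index_zero_vec)
  have hi: "h i \<in> X" using h i by (auto simp: bij_betw_def)
  define c where "c = (\<Sum>x\<in>X. (cmod (v x))\<^sup>2)"
  have "c > 0"
    unfolding c_def by (rule sum_pos2[OF fin hi]) (use i vh in auto)
  have cc: "inner_on X v v = of_real c" by (simp add: c_def inner_on_self)
  define u where "u = (\<lambda>x. of_real (1 / sqrt c) * v x)"
  have 1: "inner_on X u u = 1"
  proof -
    have "inner_on X u u = of_real (1 / sqrt c) * (of_real (1 / sqrt c) * inner_on X v v)"
      unfolding u_def inner_on_scale_left inner_on_scale_right by (simp only: complex_cnj_complex_of_real)
    also have "\<dots> = of_real ((1 / sqrt c) * ((1 / sqrt c) * c))"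
      by (simp only: cc of_real_mult)
    also have "(1 / sqrt c) * ((1 / sqrt c) * c) = 1"
      using \<open>c > 0\<close> by (simp add: real_div_sqrt)
    finally show ?thesis by simp
  qed
  have eigu: "op_apply X H u x = k * u x" if "x \<in> X" for x
    unfolding u_def op_apply_scale by (simp only: eig[OF that] mult.left_commute)
  have "cnj k * inner_on X u u = k * inner_on X u u"
  proof -
    have "inner_on X (op_apply X H u) u = inner_on X (\<lambda>x. k * u x) u"
      by (rule inner_on_cong) (auto simp: eigu)
    moreover have "inner_on X u (op_apply X H u) = inner_on X u (\<lambda>x. k * u x)"
      by (rule inner_on_cong) (auto simp: eigu)
    ultimately show ?thesis
      using hermitian_on_adjoint[OF herm, of u u]
      by (simp only: inner_on_scale_left inner_on_scale_right)
  qed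
  then have "k = of_real (Re k)"
    using 1 by (simp add: complex_eq_iff)
  then show ?thesis using 1 eigu by metis
qed

text \<open>The family has as many members as the space has dimensions. The sum P of the |u_k><u_k|
  is a Hermitian projection of trace |X|, so R = 1 - P is a projection of trace 0; this trace is
  also the sum of the squared moduli of the entries of R.\<close>

lemma orthonormal_complete:
  assumes fin: "finite X" and on: "orthonormal X u" and xy: "x \<in> X" "y \<in> X"
  shows "(\<Sum>k\<in>X. u k x * cnj (u k y)) = (if x = y then 1 else 0)"
proof -
  define P where "P = (\<lambda>x y. \<Sum>k\<in>X. u k x * cnj (u k y))"
  define R where "R = (\<lambda>x y. (if x = y then 1 else 0) - P x y)"
  have PP: "(\<Sum>z\<in>X. P x z * P z x) = P x x" for x
  proof -
    have "(\<Sum>z\<in>X. P x z * P z x)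
      = (\<Sum>z\<in>X. \<Sum>j\<in>X. \<Sum>k\<in>X. u j x * cnj (u k x) * (cnj (u j z) * u k z))"
      unfolding P_def sum_product by (intro sum.cong refl) (simp add: mult_ac)
    also have "\<dots> = (\<Sum>j\<in>X. \<Sum>k\<in>X. \<Sum>z\<in>X. u j x * cnj (u k x) * (cnj (u j z) * u k z))"
      by (rule trans[OF sum.swap], rule sum.cong[OF refl], rule sum.swap)
    also have "\<dots> = (\<Sum>j\<in>X. \<Sum>k\<in>X. u j x * cnj (u k x) * inner_on X (u j) (u k))"
      by (simp add: inner_on_def sum_distrib_left)
    also have "\<dots> = P x x"
      using fin by (simp add: orthonormalD[OF on] P_def cong: sum.cong)
    finally show ?thesis .
  qed
  have Pc: "cnj (P x y) = P y x" for x y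
    by (simp add: P_def mult.commute)
  have RR: "(\<Sum>z\<in>X. R x z * cnj (R x z)) = R x x" if "x \<in> X" for x
  proof -
    have "(\<Sum>z\<in>X. R x z * cnj (R x z)) =
      (\<Sum>z\<in>X. (if x = z then 1 - P x z - P z x else 0) + P x z * P z x)"
      by (intro sum.cong refl) (auto simp: R_def Pc algebra_simps)
    also have "\<dots> = R x x"
      using fin that by (simp add: sum.distrib PP R_def)
    finally show ?thesis .
  qed
  have "(\<Sum>x\<in>X. P x x) = (\<Sum>k\<in>X. inner_on X (u k) (u k))"
    unfolding P_def inner_on_def by (subst sum.swap) (simp add: mult.commute)
  also have "\<dots> = of_nat (card X)"
    by (simp add: orthonormalD[OF on])
  finally have "(\<Sum>x\<in>X. R x x) = 0"
    by (simp add: R_def sum_subtractf)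
  then have "(\<Sum>x\<in>X. \<Sum>z\<in>X. R x z * cnj (R x z)) = 0"
    by (simp add: RR)
  then have "complex_of_real (\<Sum>x\<in>X. \<Sum>z\<in>X. (cmod (R x z))\<^sup>2) = 0"
    by (simp add: complex_norm_square del: of_real_power)
  then have "(\<Sum>x\<in>X. \<Sum>z\<in>X. (cmod (R x z))\<^sup>2) = 0"
    using of_real_eq_0_iff by blast
  then have "R x y = 0"
    using fin xy by (simp add: sum_nonneg_eq_0_iff sum_nonneg)
  then show ?thesis by (simp add: R_def P_def)
qed

lemma orthonormal_expand:
  assumes fin: "finite X" and on: "orthonormal X u" and x: "x \<in> X"
  shows "v x = (\<Sum>k\<in>X. inner_on X (u k) v * u k x)"
proof -
  have "(\<Sum>k\<in>X. inner_on X (u k) v * u k x) = (\<Sum>k\<in>X. \<Sum>y\<in>X. v y * (u k x * cnj (u k y)))"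
    unfolding inner_on_def sum_distrib_right by (intro sum.cong refl) (simp add: mult_ac)
  also have "\<dots> = (\<Sum>y\<in>X. v y * (\<Sum>k\<in>X. u k x * cnj (u k y)))"
    by (subst sum.swap) (simp add: sum_distrib_left)
  also have "\<dots> = v x"
    using fin x by (simp add: orthonormal_complete[OF fin on x] cong: sum.cong)
  finally show ?thesis by simp
qed

lemma orthonormal_parseval:
  assumes fin: "finite X" and on: "orthonormal X u"
  shows "inner_on X v w = (\<Sum>k\<in>X. inner_on X v (u k) * inner_on X (u k) w)"
proof -
  have "inner_on X v w = inner_on X v (\<lambda>x. \<Sum>k\<in>X. inner_on X (u k) w * u k x)"
    by (rule inner_on_cong) (auto intro: orthonormal_expand[OF fin on])
  also have "\<dots> = (\<Sum>k\<in>X. inner_on X (u k) w * inner_on X v (u k))"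
    by (rule inner_on_sum_right)
  finally show ?thesis by (simp add: mult.commute)
qed

text \<open>The columns of the Householder reflection exchanging \<open>v\<close> and the basis vector at \<open>a\<close>.\<close>

lemma orthonormal_extend:
  assumes fin: "finite X" and a: "a \<in> X" and v: "inner_on X v v = 1" and real: "Im (v a) = 0"
  shows "\<exists>w. orthonormal X w \<and> (\<forall>x\<in>X. w a x = v x)"
proof -
  define e :: "'a \<Rightarrow> 'a \<Rightarrow> complex" where "e = (\<lambda>j x. if x = j then 1 else 0)"
  define w where "w = (\<lambda>x. v x - e a x)"
  have ev: "inner_on X (e j) f = f j" if "j \<in> X" for j f
    using fin that by (simp add: inner_on_def e_def if_distrib[of cnj] cong: if_cong)
  have ve: "inner_on X f (e j) = cnj (f j)" if "j \<in> X" for j f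
    using ev[OF that, of f] cnj_inner_on by metis
  have ca: "cnj (v a) = v a" using real by (simp add: complex_eq_iff)
  define N where "N = 2 - 2 * v a"
  have "inner_on X w w = inner_on X v v - inner_on X v (e a) - inner_on X (e a) v + inner_on X (e a) (e a)"
    by (simp add: w_def inner_on_def algebra_simps sum.distrib sum_subtractf)
  then have ww: "inner_on X w w = N"
    using a by (simp add: v ve ev ca N_def) (simp add: e_def)
  have cN: "cnj N = N" by (simp add: N_def ca)
  show ?thesis
  proof (cases "N = 0")
    \<comment> \<open>Here \<open>w\<close> vanishes, so \<open>v\<close> is the basis vector at
      \<open>a\<close> and the standard basis serves.\<close>
    case True
    then have "complex_of_real (\<Sum>x\<in>X. (cmod (w x))\<^sup>2) = 0"
      using ww by (simp add: inner_on_self)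
    then have "(\<Sum>x\<in>X. (cmod (w x))\<^sup>2) = 0"
      using of_real_eq_0_iff by blast
    then have "\<forall>x\<in>X. w x = 0"
      using fin by (simp add: sum_nonneg_eq_0_iff)
    then have "orthonormal X e" "\<forall>x\<in>X. e a x = v x"
      by (auto simp: orthonormal_def ev w_def) (auto simp: e_def)
    then show ?thesis by blast
  next
    case False
    \<comment> \<open>\<open>W j\<close> is the image of \<open>e j\<close> under 1 - 2 |w><w| / <w,
      w>, where <w, w> = N. As \<open>v a\<close> is real, 2 cnj (w a) / N equals -1, so
      \<open>e a\<close> goes to \<open>v\<close> itself and not to a multiple of it.\<close>
    define W where "W = (\<lambda>j x. e j x - 2 / N * cnj (w j) * w x)"
    have "inner_on X (W j) (W k) = (if j = k then 1 else 0)" if jk: "j \<in> X" "k \<in> X" for j k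
    proof -
      have "inner_on X (W j) (W k) =
        inner_on X (e j) (e k) - cnj (2 / N * cnj (w j)) * inner_on X w (e k)
        - (2 / N * cnj (w k)) * inner_on X (e j) w
        + cnj (2 / N * cnj (w j)) * (2 / N * cnj (w k)) * inner_on X w w"
        unfolding W_def by (rule inner_on_diff)
      also have "\<dots> = e k j"
        using False jk by (simp add: ev ve ww cN field_simps) (simp add: e_def)
      finally show ?thesis by (simp add: e_def)
    qed
    then have "orthonormal X W" by (simp add: orthonormal_def)
    moreover have "W a x = v x" for x
    proof -
      have "2 / N * cnj (w a) = -1"
        using False by (simp add: w_def e_def ca) (simp add: N_def field_simps)
      then have "W a x = e a x - (-1) * w x" by (simp only: W_def)
      then show ?thesis by (simp add: w_def)
    qed
    ultimately show ?thesis by blast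
  qed
qed

lemma eigendecomposition_iff:
  "eigendecomposition X H u l \<longleftrightarrow> orthonormal X u \<and>
     (\<forall>x\<in>X. \<forall>y\<in>X. H x y = (\<Sum>k\<in>X. complex_of_real (l k) * u k x * cnj (u k y)))"
  by (simp add: eigendecomposition_def orthonormal_def inner_on_def)

lemma eigendecompositionI:
  assumes fin: "finite X" and on: "orthonormal X u"
    and eig: "\<And>k x. k \<in> X \<Longrightarrow> x \<in> X \<Longrightarrow> op_apply X H (u k) x = of_real (l k) * u k x"
  shows "eigendecomposition X H u l"
  unfolding eigendecomposition_iff
proof (intro conjI ballI on)
  fix x y assume xy: "x \<in> X" "y \<in> X"
  have "(\<Sum>k\<in>X. of_real (l k) * u k x * cnj (u k y)) = (\<Sum>k\<in>X. op_apply X H (u k) x * cnj (u k y))"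
    using xy by (simp add: eig)
  also have "\<dots> = (\<Sum>k\<in>X. \<Sum>z\<in>X. H x z * (u k z * cnj (u k y)))"
    by (simp add: op_apply_def sum_distrib_right mult.assoc)
  also have "\<dots> = (\<Sum>z\<in>X. H x z * (\<Sum>k\<in>X. u k z * cnj (u k y)))"
    by (subst sum.swap) (simp add: sum_distrib_left)
  also have "\<dots> = H x y"
    using fin xy by (simp add: orthonormal_complete[OF fin on] cong: sum.cong)
  finally show "H x y = (\<Sum>k\<in>X. of_real (l k) * u k x * cnj (u k y))" by simp
qed

lemma eigendecomposition_eigenvector:
  assumes fin: "finite X" and ed: "eigendecomposition X H u l" and k: "k \<in> X" "x \<in> X"
  shows "op_apply X H (u k) x = of_real (l k) * u k x"
proof -
  have on: "orthonormal X u" using ed by (simp add: eigendecomposition_iff)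
  have "op_apply X H (u k) x = (\<Sum>y\<in>X. \<Sum>j\<in>X. of_real (l j) * u j x * (cnj (u j y) * u k y))"
    using ed k by (simp add: op_apply_def eigendecomposition_iff sum_distrib_right mult.assoc)
  also have "\<dots> = (\<Sum>j\<in>X. of_real (l j) * u j x * inner_on X (u j) (u k))"
    by (subst sum.swap) (simp add: inner_on_def sum_distrib_left)
  also have "\<dots> = of_real (l k) * u k x"
    using fin k by (simp add: orthonormalD[OF on] cong: sum.cong)
  finally show ?thesis .
qed

text \<open>Induction on the index set. An eigenvector is placed at the index \<open>a\<close> of an
  orthonormal basis \<open>w\<close>; then \<open>H\<close> maps the span of the other basis vectors
  to itself, and its matrix there is a Hermitian operator on the smaller set
  \<open>X\<close>.\<close>

theorem spectral_theorem:
  assumes "finite X" "hermitian_on X H"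
  shows "\<exists>u l. eigendecomposition X H u l"
  using assms
proof (induction X arbitrary: H rule: finite_induct)
  case empty
  then show ?case by (simp add: eigendecomposition_def)
next
  case (insert a X H)
  let ?Y = "insert a X"
  have fin: "finite ?Y" using insert by simp
  obtain l0 v0 where v0: "inner_on ?Y v0 v0 = 1"
    "\<And>x. x \<in> ?Y \<Longrightarrow> op_apply ?Y H v0 x = of_real l0 * v0 x"
    using hermitian_eigenvector[OF fin _ insert.prems] by blast
  \<comment> \<open>A phase that makes the component at \<open>a\<close> real, as the extension to a
    basis requires.\<close>
  define c where "c = (if v0 a = 0 then 1 else cnj (v0 a) / of_real (cmod (v0 a)))"
  have "cmod c = 1"
    by (simp add: c_def norm_divide)
  then have "cnj c * c = 1"
    by (metis complex_norm_square mult.commute of_real_1 one_power2)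
  have ca: "c * v0 a = of_real (cmod (v0 a))"
  proof (cases "v0 a = 0")
    case False
    then have "c * v0 a = (v0 a * cnj (v0 a)) / of_real (cmod (v0 a))"
      by (simp add: c_def)
    also have "\<dots> = of_real (cmod (v0 a))"
      using False by (simp add: complex_norm_square[symmetric] power2_eq_square)
    finally show ?thesis .
  qed simp
  define v where "v = (\<lambda>x. c * v0 x)"
  have "inner_on ?Y v v = (cnj c * c) * inner_on ?Y v0 v0"
    by (simp add: v_def inner_on_scale_left inner_on_scale_right)
  then have v: "inner_on ?Y v v = 1" using v0 \<open>cnj c * c = 1\<close> by simp
  have "Im (v a) = 0" by (simp add: v_def ca)
  then obtain w where w: "orthonormal ?Y w" "\<And>x. x \<in> ?Y \<Longrightarrow> w a x = v x"
    using orthonormal_extend[OF fin _ v] by blast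
  have "op_apply ?Y H (w a) x = op_apply ?Y H v x" for x
    unfolding op_apply_def by (intro sum.cong refl) (simp only: w(2))
  moreover have "op_apply ?Y H v x = of_real l0 * v x" if "x \<in> ?Y" for x
    unfolding v_def op_apply_scale by (simp only: v0(2)[OF that] mult.left_commute)
  ultimately have eiga: "op_apply ?Y H (w a) x = of_real l0 * w a x" if "x \<in> ?Y" for x
    using that w(2) by simp
  define G where "G = (\<lambda>j k. inner_on ?Y (w j) (op_apply ?Y H (w k)))"
  have "hermitian_on X G"
    unfolding hermitian_on_def G_def
    by (metis cnj_inner_on hermitian_on_adjoint[OF insert.prems])
  then obtain u' l' where ed': "eigendecomposition X G u' l'"
    using insert.IH by blast
  then have on': "orthonormal X u'" by (simp add: eigendecomposition_iff)
  have G0: "inner_on ?Y (w a) (op_apply ?Y H (w j)) = 0" if "j \<in> X" for j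
  proof -
    have "inner_on ?Y (w a) (op_apply ?Y H (w j)) = inner_on ?Y (op_apply ?Y H (w a)) (w j)"
      by (simp add: hermitian_on_adjoint[OF insert.prems])
    also have "\<dots> = inner_on ?Y (\<lambda>x. of_real l0 * w a x) (w j)"
      by (rule inner_on_cong) (simp_all add: eiga)
    also have "\<dots> = 0"
      using that insert.hyps by (auto simp: inner_on_scale_left orthonormalD[OF w(1)])
    finally show ?thesis .
  qed
  have Hw: "op_apply ?Y H (w j) x = (\<Sum>i\<in>X. G i j * w i x)" if "j \<in> X" "x \<in> ?Y" for j x
  proof -
    have "op_apply ?Y H (w j) x = (\<Sum>i\<in>?Y. inner_on ?Y (w i) (op_apply ?Y H (w j)) * w i x)"
      by (rule orthonormal_expand[OF fin w(1) that(2)])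
    then show ?thesis
      using insert.hyps by (simp add: G0[OF that(1)] G_def)
  qed
  \<comment> \<open>The eigenvectors of \<open>G\<close> are coordinate vectors with respect to
    \<open>w\<close>; here they become vectors on \<open>insert a X\<close> again.\<close>
  define u where "u = (\<lambda>m. if m = a then w a else (\<lambda>x. \<Sum>j\<in>X. u' m j * w j x))"
  define l where "l = (\<lambda>m. if m = a then l0 else l' m)"
  have wX: "inner_on ?Y (w j) (w k) = (if j = k then 1 else 0)" if "j \<in> X" "k \<in> X" for j k
    using that by (auto simp: orthonormalD[OF w(1)])
  have wa: "inner_on ?Y (w a) (w k) = 0" "inner_on ?Y (w k) (w a) = 0" if "k \<in> X" for k
    using that insert.hyps by (auto simp: orthonormalD[OF w(1)])
  have uu: "inner_on ?Y (u m) (u n) = (if m = n then 1 else 0)" if "m \<in> X" "n \<in> X" for m n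
  proof -
    have "inner_on ?Y (u m) (u n) = (\<Sum>k\<in>X. u' n k * (\<Sum>j\<in>X. cnj (u' m j) * inner_on ?Y (w j) (w k)))"
      using that insert.hyps by (auto simp: u_def inner_on_sum_left inner_on_sum_right)
    also have "\<dots> = (\<Sum>k\<in>X. u' n k * (\<Sum>j\<in>X. cnj (u' m j) * (if j = k then 1 else 0)))"
      by (intro sum.cong refl arg_cong2[where f = times] wX)
    also have "\<dots> = inner_on X (u' m) (u' n)"
      using insert.hyps by (simp add: wX inner_on_def mult.commute cong: sum.cong)
    finally show ?thesis using that by (simp add: orthonormalD[OF on'])
  qed
  have ua: "inner_on ?Y (u a) (u n) = 0" "inner_on ?Y (u n) (u a) = 0" if "n \<in> X" for n
    using that insert.hyps by (auto simp: u_def inner_on_sum_left inner_on_sum_right wa)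
  have "orthonormal ?Y u"
    using insert.hyps uu ua orthonormalD[OF w(1), of a a] by (auto simp: orthonormal_def) (auto simp: u_def)
  moreover have "op_apply ?Y H (u m) x = of_real (l m) * u m x" if "m \<in> ?Y" "x \<in> ?Y" for m x
  proof (cases "m = a")
    case True
    then show ?thesis using eiga that by (simp add: u_def l_def)
  next
    case False
    with that have m: "m \<in> X" by simp
    have "op_apply ?Y H (u m) x = (\<Sum>j\<in>X. u' m j * op_apply ?Y H (w j) x)"
      using False by (simp add: u_def op_apply_sum)
    also have "\<dots> = (\<Sum>j\<in>X. \<Sum>i\<in>X. (G i j * u' m j) * w i x)"
      using that by (simp add: Hw sum_distrib_left mult_ac)
    also have "\<dots> = (\<Sum>i\<in>X. op_apply X G (u' m) i * w i x)"
      by (subst sum.swap) (simp add: op_apply_def sum_distrib_right)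
    also have "\<dots> = (\<Sum>i\<in>X. of_real (l' m) * u' m i * w i x)"
      using eigendecomposition_eigenvector[OF insert.hyps(1) ed' m] by simp
    also have "\<dots> = of_real (l m) * u m x"
      using False by (simp add: u_def l_def sum_distrib_left mult.assoc)
    finally show ?thesis .
  qed
  ultimately show ?case
    using eigendecompositionI[OF fin] by blast
qed

subsection \<open>Functional calculus\<close>

text \<open>Cut to zero outside \<open>X\<close>, so that the operator lies in
  \<open>opers X\<close> and equality of functions is equality of operators. Positive operators are
  brought into this form before functions of them are computed.\<close>

definition spec_op :: "'a set \<Rightarrow> ('a \<Rightarrow> 'a \<Rightarrow> complex) \<Rightarrow> ('a \<Rightarrow> real) \<Rightarrow> 'a oper" where
  "spec_op X u c = (\<lambda>x y. if x \<in> X \<and> y \<in> X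
     then \<Sum>k\<in>X. complex_of_real (c k) * u k x * cnj (u k y) else 0)"

text \<open>For two orthonormal bases these numbers form a doubly stochastic matrix; with them, the
  trace of a product of two spectral operators is a real double sum over the eigenvalues.\<close>

definition overlap :: "'a set \<Rightarrow> ('a \<Rightarrow> complex) \<Rightarrow> ('a \<Rightarrow> complex) \<Rightarrow> real" where
  "overlap X u v = (cmod (inner_on X u v))\<^sup>2"

lemma overlap_nonneg: "0 \<le> overlap X u v"
  by (simp add: overlap_def)

lemma of_real_overlap: "complex_of_real (overlap X u v) = inner_on X u v * inner_on X v u"
  by (simp add: overlap_def complex_norm_square cnj_inner_on del: of_real_power)

lemma overlap_commute: "overlap X u v = overlap X v u"
  by (metis cnj_inner_on complex_mod_cnj overlap_def)

lemma sum_overlap: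
  assumes "finite X" "orthonormal X v"
  shows "(\<Sum>k\<in>X. overlap X (v k) u) = (\<Sum>x\<in>X. (cmod (u x))\<^sup>2)"
proof -
  have "complex_of_real (\<Sum>k\<in>X. overlap X (v k) u) = inner_on X u u"
    by (simp add: of_real_overlap orthonormal_parseval[OF assms, of u u] mult.commute)
  then show ?thesis
    unfolding inner_on_self of_real_eq_iff .
qed

lemma orthonormal_normalized:
  assumes "orthonormal X u" "j \<in> X"
  shows "(\<Sum>x\<in>X. (cmod (u j x))\<^sup>2) = 1"
proof -
  have "complex_of_real (\<Sum>x\<in>X. (cmod (u j x))\<^sup>2) = of_real 1"
    using orthonormalD[OF assms(1) assms(2) assms(2)] by (simp add: inner_on_self)
  then show ?thesis unfolding of_real_eq_iff .
qed

lemma spec_op_opers: "spec_op X u c \<in> opers X"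
  by (auto simp: spec_op_def opers_def)

lemma eigendecomposition_spec_op:
  "orthonormal X u \<Longrightarrow> eigendecomposition X (spec_op X u c) u c"
  by (simp add: eigendecomposition_iff spec_op_def)

lemma eigendecomposition_imp_spec_op:
  assumes "H \<in> opers X" "eigendecomposition X H u l"
  shows "H = spec_op X u l"
proof (intro ext)
  fix x y
  show "H x y = spec_op X u l x y"
  proof (cases "x \<in> X \<and> y \<in> X")
    case True
    then show ?thesis using assms(2) by (simp add: eigendecomposition_iff spec_op_def)
  next
    case False
    then have "H x y = 0" using assms(1) unfolding opers_def by blast
    then show ?thesis using False by (auto simp: spec_op_def)
  qed
qed

lemma eigendecomposition_hermitian:
  assumes "eigendecomposition X H u l" shows "hermitian_on X H"
  using assms by (simp add: hermitian_on_def eigendecomposition_iff mult_ac)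

lemma op_apply_spec_op:
  assumes "x \<in> X"
  shows "op_apply X (spec_op X u c) v x = (\<Sum>k\<in>X. of_real (c k) * inner_on X (u k) v * u k x)"
proof -
  have "op_apply X (spec_op X u c) v x
      = (\<Sum>y\<in>X. \<Sum>k\<in>X. of_real (c k) * (cnj (u k y) * v y) * u k x)"
    unfolding op_apply_def spec_op_def using assms
    by (intro sum.cong refl) (simp add: sum_distrib_left sum_distrib_right mult_ac)
  also have "\<dots> = (\<Sum>k\<in>X. of_real (c k) * inner_on X (u k) v * u k x)"
    by (subst sum.swap) (simp add: inner_on_def sum_distrib_left sum_distrib_right)
  finally show ?thesis .
qed

lemma form_spec_op:
  "form X (spec_op X u c) v = of_real (\<Sum>k\<in>X. c k * overlap X (u k) v)"
proof -
  have "form X (spec_op X u c) v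
      = inner_on X v (\<lambda>x. \<Sum>k\<in>X. (of_real (c k) * inner_on X (u k) v) * u k x)"
    unfolding form_eq_inner by (intro inner_on_cong refl op_apply_spec_op)
  also have "\<dots> = (\<Sum>k\<in>X. (of_real (c k) * inner_on X (u k) v) * inner_on X v (u k))"
    by (rule inner_on_sum_right)
  finally show ?thesis by (simp add: of_real_overlap mult.assoc)
qed

lemma op_pos_spec_op: "(\<And>k. k \<in> X \<Longrightarrow> 0 \<le> c k) \<Longrightarrow> op_pos X (spec_op X u c)"
  by (auto simp: op_pos_iff form_spec_op complex_nonneg_Reals_iff overlap_nonneg intro!: sum_nonneg)

lemma spec_op_eigenvector:
  assumes "finite X" "orthonormal X u" "k \<in> X"
  shows "form X (spec_op X u c) (u k) = of_real (c k)"
proof -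
  have "(\<Sum>j\<in>X. c j * overlap X (u j) (u k)) = (\<Sum>j\<in>X. c j * (if j = k then 1 else 0))"
    using assms by (intro sum.cong refl) (auto simp: overlap_def orthonormalD)
  then show ?thesis using assms by (simp add: form_spec_op)
qed

lemma spec_op_cong: "(\<And>k. k \<in> X \<Longrightarrow> c k = d k) \<Longrightarrow> spec_op X u c = spec_op X u d"
  by (auto simp: spec_op_def fun_eq_iff intro!: sum.cong)

text \<open>This makes the \<open>THE\<close> in \<open>op_fun\<close> meaningful. Evaluating <u'_k,
  H u_j> in two ways shows that <u'_k, u_j> vanishes unless l' k = l j, in which case
  \<open>f\<close> has the same value at both; hence the two operators agree on the basis
  \<open>u\<close>.\<close>

lemma spec_op_fun_unique:
  assumes fin: "finite X" and ed: "eigendecomposition X H u l" and ed': "eigendecomposition X H u' l'"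
  shows "spec_op X u' (\<lambda>k. f (l' k)) = spec_op X u (\<lambda>k. f (l k))"
proof -
  have on: "orthonormal X u" and on': "orthonormal X u'"
    using ed ed' by (auto simp: eigendecomposition_iff)
  have herm: "hermitian_on X H" by (rule eigendecomposition_hermitian[OF ed])
  have "of_real (f (l' k)) * inner_on X (u' k) (u j) = of_real (f (l j)) * inner_on X (u' k) (u j)"
    if "j \<in> X" "k \<in> X" for j k
  proof -
    have "of_real (l j) * inner_on X (u' k) (u j) = inner_on X (u' k) (op_apply X H (u j))"
      unfolding inner_on_scale_right[symmetric]
      using eigendecomposition_eigenvector[OF fin ed that(1)] by (intro inner_on_cong) auto
    also have "\<dots> = inner_on X (op_apply X H (u' k)) (u j)"
      by (rule hermitian_on_adjoint[OF herm, symmetric])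
    also have "\<dots> = inner_on X (\<lambda>x. of_real (l' k) * u' k x) (u j)"
      using eigendecomposition_eigenvector[OF fin ed' that(2)] by (intro inner_on_cong) auto
    also have "\<dots> = of_real (l' k) * inner_on X (u' k) (u j)"
      by (simp add: inner_on_scale_left)
    finally show ?thesis by auto
  qed
  note * = this
  have "op_apply X (spec_op X u' (\<lambda>k. f (l' k))) (u j) x = of_real (f (l j)) * u j x"
    if "j \<in> X" "x \<in> X" for j x
  proof -
    have "op_apply X (spec_op X u' (\<lambda>k. f (l' k))) (u j) x
        = (\<Sum>k\<in>X. of_real (f (l j)) * inner_on X (u' k) (u j) * u' k x)"
      using that by (simp add: op_apply_spec_op *)
    also have "\<dots> = of_real (f (l j)) * (\<Sum>k\<in>X. inner_on X (u' k) (u j) * u' k x)"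
      by (simp add: sum_distrib_left mult.assoc)
    also have "\<dots> = of_real (f (l j)) * u j x"
      using orthonormal_expand[OF fin on' that(2), of "u j"] by simp
    finally show ?thesis .
  qed
  then have "eigendecomposition X (spec_op X u' (\<lambda>k. f (l' k))) u (\<lambda>k. f (l k))"
    by (rule eigendecompositionI[OF fin on])
  then show ?thesis by (rule eigendecomposition_imp_spec_op[OF spec_op_opers])
qed

lemma op_fun_eq:
  assumes "finite X" "eigendecomposition X H u l"
  shows "op_fun X f H = spec_op X u (\<lambda>k. f (l k))"
  unfolding op_fun_def
proof (rule the_equality)
  show "\<exists>u' l'. eigendecomposition X H u' l' \<and> spec_op X u (\<lambda>k. f (l k)) =
    (\<lambda>x y. if x \<in> X \<and> y \<in> X then \<Sum>k\<in>X. complex_of_real (f (l' k)) * u' k x * cnj (u' k y) else 0)"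
    using assms(2) by (intro exI[of _ u] exI[of _ l]) (simp add: spec_op_def)
next
  fix K
  assume "\<exists>u l. eigendecomposition X H u l \<and> K =
    (\<lambda>x y. if x \<in> X \<and> y \<in> X then \<Sum>k\<in>X. complex_of_real (f (l k)) * u k x * cnj (u k y) else 0)"
  then obtain u' l' where "eigendecomposition X H u' l'" "K = spec_op X u' (\<lambda>k. f (l' k))"
    by (auto simp: spec_op_def)
  then show "K = spec_op X u (\<lambda>k. f (l k))"
    using spec_op_fun_unique[OF assms] by simp
qed

lemma op_fun_spec_op:
  assumes "finite X" "orthonormal X u"
  shows "op_fun X f (spec_op X u c) = spec_op X u (\<lambda>k. f (c k))"
  by (rule op_fun_eq[OF assms(1) eigendecomposition_spec_op[OF assms(2)]])

lemma op_pos_spec_opE: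
  assumes fin: "finite X" and M: "M \<in> opers X" and pos: "op_pos X M"
  obtains u l where "orthonormal X u" "\<And>k. k \<in> X \<Longrightarrow> 0 \<le> l k" "M = spec_op X u l"
proof -
  obtain u l where ed: "eigendecomposition X M u l"
    using spectral_theorem[OF fin op_pos_hermitian[OF fin pos]] by blast
  then have on: "orthonormal X u" and eq: "M = spec_op X u l"
    using eigendecomposition_imp_spec_op[OF M] by (auto simp: eigendecomposition_iff)
  have "0 \<le> l k" if "k \<in> X" for k
    using op_pos_Re[OF pos, of "u k"] spec_op_eigenvector[OF fin on that, of l] by (simp add: eq)
  then show thesis using that on eq by blast
qed

lemma op_mult_spec_op:
  assumes fin: "finite X" and on: "orthonormal X u"
  shows "op_mult X (spec_op X u c) (spec_op X u d) = spec_op X u (\<lambda>k. c k * d k)"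
proof (intro ext)
  fix x y
  show "op_mult X (spec_op X u c) (spec_op X u d) x y = spec_op X u (\<lambda>k. c k * d k) x y"
  proof (cases "x \<in> X \<and> y \<in> X")
    case False
    then show ?thesis by (auto simp: op_mult_def spec_op_def)
  next
    case True
    have "op_mult X (spec_op X u c) (spec_op X u d) x y
        = op_apply X (spec_op X u c) (\<lambda>z. \<Sum>k\<in>X. (of_real (d k) * cnj (u k y)) * u k z) x"
      unfolding op_mult_def op_apply_def using True
      by (intro sum.cong refl) (simp add: spec_op_def mult_ac)
    also have "\<dots> = (\<Sum>k\<in>X. of_real (d k) * cnj (u k y) * op_apply X (spec_op X u c) (u k) x)"
      by (simp add: op_apply_sum)
    also have "\<dots> = (\<Sum>k\<in>X. of_real (d k) * cnj (u k y) * (of_real (c k) * u k x))"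
      using True eigendecomposition_eigenvector[OF fin eigendecomposition_spec_op[OF on]] by simp
    also have "\<dots> = spec_op X u (\<lambda>k. c k * d k) x y"
      using True by (simp add: spec_op_def mult_ac)
    finally show ?thesis .
  qed
qed

lemma op_trace_spec_op:
  assumes "finite X" "orthonormal X u"
  shows "op_trace X (spec_op X u c) = of_real (\<Sum>k\<in>X. c k)"
proof -
  have "op_trace X (spec_op X u c) = (\<Sum>x\<in>X. \<Sum>k\<in>X. of_real (c k) * (cnj (u k x) * u k x))"
    unfolding op_trace_def by (intro sum.cong refl) (simp add: spec_op_def mult_ac)
  also have "\<dots> = (\<Sum>k\<in>X. of_real (c k) * inner_on X (u k) (u k))"
    by (subst sum.swap) (simp add: inner_on_def sum_distrib_left)
  finally show ?thesis using assms by (simp add: orthonormalD)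
qed

lemma op_trace_mult_spec_op:
  "op_trace X (op_mult X (spec_op X u c) (spec_op X v d))
     = of_real (\<Sum>j\<in>X. \<Sum>k\<in>X. c j * d k * overlap X (u j) (v k))"
proof -
  have "op_trace X (op_mult X (spec_op X u c) (spec_op X v d))
      = (\<Sum>x\<in>X. op_apply X (spec_op X u c) (\<lambda>z. \<Sum>k\<in>X. (of_real (d k) * cnj (v k x)) * v k z) x)"
    unfolding op_trace_def op_mult_def op_apply_def
    by (intro sum.cong refl) (simp add: spec_op_def mult_ac)
  also have "\<dots> = (\<Sum>x\<in>X. \<Sum>k\<in>X. of_real (d k) * (cnj (v k x) * op_apply X (spec_op X u c) (v k) x))"
    unfolding op_apply_sum by (simp only: mult.assoc)
  also have "\<dots> = (\<Sum>k\<in>X. of_real (d k) * form X (spec_op X u c) (v k))"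
    by (subst sum.swap) (simp add: form_eq_inner inner_on_def sum_distrib_left)
  also have "\<dots> = of_real (\<Sum>k\<in>X. \<Sum>j\<in>X. c j * d k * overlap X (u j) (v k))"
    by (simp add: form_spec_op sum_distrib_left mult_ac)
  also have "(\<Sum>k\<in>X. \<Sum>j\<in>X. c j * d k * overlap X (u j) (v k))
      = (\<Sum>j\<in>X. \<Sum>k\<in>X. c j * d k * overlap X (u j) (v k))"
    by (rule sum.swap)
  finally show ?thesis .
qed

text \<open>Lets a square root be guessed: an eigenbasis of \<open>K\<close> also diagonalises its
  square, and the root of l_k^2 is l_k because l_k is nonnegative.\<close>

lemma op_sqrt_unique:
  assumes fin: "finite X" and K: "K \<in> opers X" "op_pos X K" "op_mult X K K = P"
  shows "op_sqrt X P = K"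
proof -
  obtain u l where on: "orthonormal X u" and l: "\<And>k. k \<in> X \<Longrightarrow> 0 \<le> l k" and eq: "K = spec_op X u l"
    using op_pos_spec_opE[OF fin K(1,2)] by metis
  have "P = spec_op X u (\<lambda>k. l k * l k)"
    using K(3) by (simp add: eq op_mult_spec_op[OF fin on])
  then show ?thesis
    using l by (auto simp: op_sqrt_def op_fun_spec_op[OF fin on] eq intro: spec_op_cong)
qed

lemma op_sqrt_props:
  assumes fin: "finite X" and P: "P \<in> opers X" "op_pos X P"
  shows "op_sqrt X P \<in> opers X" "op_pos X (op_sqrt X P)" "op_mult X (op_sqrt X P) (op_sqrt X P) = P"
proof -
  obtain u l where on: "orthonormal X u" and l: "\<And>k. k \<in> X \<Longrightarrow> 0 \<le> l k" and eq: "P = spec_op X u l"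
    using op_pos_spec_opE[OF fin P] by metis
  have s: "op_sqrt X P = spec_op X u (\<lambda>k. sqrt (l k))"
    by (simp add: eq op_sqrt_def op_fun_spec_op[OF fin on])
  show "op_sqrt X P \<in> opers X" "op_pos X (op_sqrt X P)"
    unfolding s using l by (auto intro: spec_op_opers op_pos_spec_op)
  show "op_mult X (op_sqrt X P) (op_sqrt X P) = P"
    unfolding s op_mult_spec_op[OF fin on] unfolding eq using l by (intro spec_op_cong) simp
qed

subsection \<open>Relative entropy\<close>

definition lg :: "real \<Rightarrow> real" where
  "lg x = (if x > 0 then log 2 x else 0)"

text \<open>The sum of the p_j lg p_j is spread over \<open>k\<close> by means of the overlaps,
  which sum to 1 for each \<open>j\<close>. Both logarithms then carry the same weights, and the
  relative entropy can be estimated term by term.\<close>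

lemma rel_entropy_spec_op:
  assumes fin: "finite X" and on: "orthonormal X u" "orthonormal X v"
    and ker: "\<forall>w. (\<forall>x\<in>X. op_apply X (spec_op X v q) w x = 0) \<longrightarrow> (\<forall>x\<in>X. op_apply X (spec_op X u p) w x = 0)"
  shows "rel_entropy X (spec_op X u p) (spec_op X v q)
    = ereal (\<Sum>j\<in>X. \<Sum>k\<in>X. p j * overlap X (u j) (v k) * (lg (p j) - lg (q k)))"
proof -
  let ?P = "spec_op X u p" and ?LP = "spec_op X u (\<lambda>k. lg (p k))" and ?LQ = "spec_op X v (\<lambda>k. lg (q k))"
  have log: "op_log X ?P = ?LP" "op_log X (spec_op X v q) = ?LQ"
    by (simp_all add: op_log_def op_fun_spec_op[OF fin] on lg_def)
  have "op_trace X (op_mult X ?P (\<lambda>x y. ?LP x y - ?LQ x y))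
      = op_trace X (op_mult X ?P ?LP) - op_trace X (op_mult X ?P ?LQ)"
    by (simp add: op_trace_def op_mult_def algebra_simps sum_subtractf)
  also have "op_trace X (op_mult X ?P ?LP) = of_real (\<Sum>j\<in>X. p j * lg (p j))"
    by (simp add: op_mult_spec_op[OF fin] op_trace_spec_op[OF fin] on)
  also have "(\<Sum>j\<in>X. p j * lg (p j)) = (\<Sum>j\<in>X. p j * lg (p j) * (\<Sum>k\<in>X. overlap X (v k) (u j)))"
    by (simp add: sum_overlap[OF fin on(2)] orthonormal_normalized[OF on(1)])
  also have "\<dots> = (\<Sum>j\<in>X. \<Sum>k\<in>X. p j * lg (p j) * overlap X (u j) (v k))"
    by (simp add: sum_distrib_left overlap_commute)
  also have "op_trace X (op_mult X ?P ?LQ) = of_real (\<Sum>j\<in>X. \<Sum>k\<in>X. p j * lg (q k) * overlap X (u j) (v k))"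
    by (rule op_trace_mult_spec_op)
  finally have "op_trace X (op_mult X ?P (\<lambda>x y. ?LP x y - ?LQ x y))
    = of_real (\<Sum>j\<in>X. \<Sum>k\<in>X. p j * overlap X (u j) (v k) * (lg (p j) - lg (q k)))"
    by (simp add: algebra_simps sum_subtractf)
  then show ?thesis
    using ker by (simp add: rel_entropy_def log)
qed

text \<open>The support condition becomes absolute continuity of the weights: if q_k = 0, then v_k
  lies in the kernel of Q, hence of P, and <v_k, P v_k> = 0 is a sum of these nonnegative terms. The
  scalar estimates rely on it because \<open>lg 0\<close> is 0 and not minus infinity.\<close>

lemma spec_op_kernel_overlap:
  assumes fin: "finite X" and on: "orthonormal X u" "orthonormal X v" and p: "\<And>k. k \<in> X \<Longrightarrow> 0 \<le> p k"
    and ker: "\<forall>w. (\<forall>x\<in>X. op_apply X (spec_op X v q) w x = 0) \<longrightarrow> (\<forall>x\<in>X. op_apply X (spec_op X u p) w x = 0)"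
    and jk: "j \<in> X" "k \<in> X" "q k = 0"
  shows "p j * overlap X (u j) (v k) = 0"
proof -
  have "\<forall>x\<in>X. op_apply X (spec_op X v q) (v k) x = 0"
    using eigendecomposition_eigenvector[OF fin eigendecomposition_spec_op[OF on(2)] jk(2)] jk(3) by simp
  then have "\<forall>x\<in>X. op_apply X (spec_op X u p) (v k) x = 0"
    using ker by blast
  then have "form X (spec_op X u p) (v k) = 0"
    by (simp add: form_eq_inner inner_on_def)
  then have "(\<Sum>j\<in>X. p j * overlap X (u j) (v k)) = 0"
    unfolding form_spec_op of_real_eq_0_iff .
  then show ?thesis
    using fin jk p by (simp add: sum_nonneg_eq_0_iff overlap_nonneg)
qed

lemma rel_entropy_finite_imp_kernel:
  "rel_entropy X P Q = ereal D \<Longrightarrow>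
    \<forall>w. (\<forall>x\<in>X. op_apply X Q w x = 0) \<longrightarrow> (\<forall>x\<in>X. op_apply X P w x = 0)"
  by (auto simp: rel_entropy_def split: if_splits)

text \<open>With r = sqrt (q / p) this is ln r <= r - 1: p ln (p / q) = -2 p ln r >= 2 p (1 - r),
  and 2 p - 2 sqrt (p q) = p - q + (sqrt p - sqrt q)^2. The factor ln 2 converts from base
  2.\<close>

lemma mult_lg_diff_ge:
  assumes "0 \<le> p" "0 \<le> q" "0 \<le> w" "q = 0 \<Longrightarrow> p * w = 0"
  shows "w * (p - q + (sqrt p - sqrt q)\<^sup>2) \<le> p * w * (lg p - lg q) * ln 2"
proof (cases "p = 0 \<or> w = 0")
  case True
  then show ?thesis using assms by auto
next
  case False
  then have pos: "0 < p" "0 < q" "0 < w" using assms by fastforce+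
  define r where "r = sqrt q / sqrt p"
  have "r > 0" using pos by (simp add: r_def)
  have rq: "p * (r * r) = q" "p * r = sqrt p * sqrt q"
    using pos by (simp_all add: r_def real_div_sqrt field_simps)
  have "ln q - ln p = ln (r * r)"
    using pos by (simp add: r_def ln_div)
  also have "\<dots> = 2 * ln r"
    using \<open>r > 0\<close> by (simp add: ln_mult)
  also have "\<dots> \<le> 2 * (r - 1)"
    using ln_le_minus_one[OF \<open>r > 0\<close>] by simp
  finally have "p * (2 * (1 - r)) \<le> p * (ln p - ln q)"
    using pos by (intro mult_left_mono) auto
  moreover have "p * (2 * (1 - r)) = p - q + (sqrt p - sqrt q)\<^sup>2"
    using pos rq by (simp add: power2_eq_square algebra_simps)
  ultimately have "p - q + (sqrt p - sqrt q)\<^sup>2 \<le> p * (ln p - ln q)"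
    by linarith
  then have "w * (p - q + (sqrt p - sqrt q)\<^sup>2) \<le> w * (p * (ln p - ln q))"
    using pos by (intro mult_left_mono) auto
  also have "\<dots> = p * w * (lg p - lg q) * ln 2"
    using pos by (simp add: lg_def log_def field_simps)
  finally show ?thesis .
qed

lemma statesD:
  "P \<in> states X \<Longrightarrow> P \<in> opers X" "P \<in> states X \<Longrightarrow> op_pos X P" "P \<in> states X \<Longrightarrow> op_trace X P = 1"
  by (auto simp: states_def)

lemma state_spec_opE:
  assumes fin: "finite X" and P: "P \<in> states X"
  obtains u p where "orthonormal X u" "\<And>k. k \<in> X \<Longrightarrow> 0 \<le> p k" "P = spec_op X u p" "(\<Sum>k\<in>X. p k) = 1"
proof -
  obtain u p where on: "orthonormal X u" and p: "\<And>k. k \<in> X \<Longrightarrow> 0 \<le> p k" and eq: "P = spec_op X u p"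
    using op_pos_spec_opE[OF fin statesD(1)[OF P] statesD(2)[OF P]] by metis
  have "complex_of_real (\<Sum>k\<in>X. p k) = of_real 1"
    using statesD(3)[OF P] by (simp add: eq op_trace_spec_op[OF fin on])
  then have "(\<Sum>k\<in>X. p k) = 1" unfolding of_real_eq_iff .
  with on p eq show thesis using that by blast
qed

text \<open>The weights \<open>p j * overlap (u j) (v k)\<close> and \<open>q k * overlap (u j) (v k)\<close> are the
  Nussbaum-Szkola distributions, which reduce the claim to the scalar inequality
  \<open>ln x \<le> x - 1\<close>.\<close>

lemma rel_entropy_ge_hellinger:
  assumes fin: "finite X" and P: "P \<in> states X" and Q: "Q \<in> states X"
    and D: "rel_entropy X P Q = ereal D"
  defines "C \<equiv> (\<lambda>x y. op_sqrt X P x y - op_sqrt X Q x y)"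
  shows "Re (op_trace X (op_mult X C C)) \<le> D * ln 2"
proof -
  obtain u p where on: "orthonormal X u" and p: "\<And>k. k \<in> X \<Longrightarrow> 0 \<le> p k" and eqP: "P = spec_op X u p"
    and p1: "(\<Sum>k\<in>X. p k) = 1" using state_spec_opE[OF fin P] by metis
  obtain v q where on': "orthonormal X v" and q: "\<And>k. k \<in> X \<Longrightarrow> 0 \<le> q k" and eqQ: "Q = spec_op X v q"
    and q1: "(\<Sum>k\<in>X. q k) = 1" using state_spec_opE[OF fin Q] by metis
  define w where "w = (\<lambda>j k. overlap X (u j) (v k))"
  have w0: "0 \<le> w j k" for j k by (simp add: w_def overlap_nonneg)
  have wk: "(\<Sum>k\<in>X. w j k) = 1" if "j \<in> X" for j
    using sum_overlap[OF fin on', of "u j"] orthonormal_normalized[OF on that]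
    by (simp add: w_def overlap_commute)
  have wj: "(\<Sum>j\<in>X. w j k) = 1" if "k \<in> X" for k
    using sum_overlap[OF fin on, of "v k"] orthonormal_normalized[OF on' that] by (simp add: w_def)
  have pw: "(\<Sum>j\<in>X. \<Sum>k\<in>X. w j k * p j) = 1"
    using p1 by (simp add: sum_distrib_right[symmetric] wk)
  have "(\<Sum>j\<in>X. \<Sum>k\<in>X. w j k * q k) = (\<Sum>k\<in>X. (\<Sum>j\<in>X. w j k) * q k)"
    by (subst sum.swap) (simp add: sum_distrib_right)
  then have qw: "(\<Sum>j\<in>X. \<Sum>k\<in>X. w j k * q k) = 1"
    using q1 by (simp add: wj)
  note ker = rel_entropy_finite_imp_kernel[OF D, unfolded eqP eqQ]
  have Deq: "D = (\<Sum>j\<in>X. \<Sum>k\<in>X. p j * w j k * (lg (p j) - lg (q k)))"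
    using D unfolding eqP eqQ rel_entropy_spec_op[OF fin on on' ker] by (simp add: w_def)
  have A: "op_sqrt X P = spec_op X u (\<lambda>k. sqrt (p k))" "op_sqrt X Q = spec_op X v (\<lambda>k. sqrt (q k))"
    by (simp_all add: eqP eqQ op_sqrt_def op_fun_spec_op[OF fin] on on')
  have "op_trace X (op_mult X C C) =
    op_trace X (op_mult X (op_sqrt X P) (op_sqrt X P)) + op_trace X (op_mult X (op_sqrt X Q) (op_sqrt X Q))
    - op_trace X (op_mult X (op_sqrt X P) (op_sqrt X Q)) - op_trace X (op_mult X (op_sqrt X Q) (op_sqrt X P))"
    by (simp add: C_def op_trace_def op_mult_def algebra_simps sum_subtractf sum.distrib)
  also have "op_trace X (op_mult X (op_sqrt X Q) (op_sqrt X P)) = op_trace X (op_mult X (op_sqrt X P) (op_sqrt X Q))"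
    unfolding op_trace_def op_mult_def by (subst sum.swap) (simp add: mult.commute)
  also have "op_mult X (op_sqrt X P) (op_sqrt X P) = P"
    by (rule op_sqrt_props(3)[OF fin statesD(1,2)[OF P]])
  also have "op_mult X (op_sqrt X Q) (op_sqrt X Q) = Q"
    by (rule op_sqrt_props(3)[OF fin statesD(1,2)[OF Q]])
  also have "op_trace X (op_mult X (op_sqrt X P) (op_sqrt X Q))
      = of_real (\<Sum>j\<in>X. \<Sum>k\<in>X. sqrt (p j) * sqrt (q k) * w j k)"
    unfolding A w_def by (rule op_trace_mult_spec_op)
  finally have "Re (op_trace X (op_mult X C C)) = 2 - 2 * (\<Sum>j\<in>X. \<Sum>k\<in>X. sqrt (p j) * sqrt (q k) * w j k)"
    using statesD(3)[OF P] statesD(3)[OF Q] by simp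
  also have "\<dots> = (\<Sum>j\<in>X. \<Sum>k\<in>X. w j k * p j) + (\<Sum>j\<in>X. \<Sum>k\<in>X. w j k * q k)
      - 2 * (\<Sum>j\<in>X. \<Sum>k\<in>X. sqrt (p j) * sqrt (q k) * w j k)"
    unfolding pw qw by simp
  also have "\<dots> = (\<Sum>j\<in>X. \<Sum>k\<in>X. w j k * p j + w j k * q k - 2 * (sqrt (p j) * sqrt (q k) * w j k))"
    by (simp only: sum.distrib sum_subtractf sum_distrib_left)
  also have "\<dots> = (\<Sum>j\<in>X. \<Sum>k\<in>X. w j k * (sqrt (p j) - sqrt (q k))\<^sup>2)"
    using p q by (intro sum.cong refl) (simp add: power2_eq_square algebra_simps)
  \<comment> \<open>Both inserted sums are 1. Their difference supplies the term p - q of the scalar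
    inequality, which cancels only after summation.\<close>
  also have "\<dots> = (\<Sum>j\<in>X. \<Sum>k\<in>X. w j k * (sqrt (p j) - sqrt (q k))\<^sup>2)
      + (\<Sum>j\<in>X. \<Sum>k\<in>X. w j k * p j) - (\<Sum>j\<in>X. \<Sum>k\<in>X. w j k * q k)"
    unfolding pw qw by simp
  also have "\<dots> = (\<Sum>j\<in>X. \<Sum>k\<in>X. w j k * (p j - q k + (sqrt (p j) - sqrt (q k))\<^sup>2))"
    by (simp add: distrib_left right_diff_distrib sum.distrib sum_subtractf)
  also have "\<dots> \<le> (\<Sum>j\<in>X. \<Sum>k\<in>X. p j * w j k * (lg (p j) - lg (q k)) * ln 2)"
    using spec_op_kernel_overlap[OF fin on on' p ker] p q w0
    by (intro sum_mono mult_lg_diff_ge) (auto simp: w_def)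
  also have "\<dots> = D * ln 2"
    by (simp add: Deq sum_distrib_right)
  finally show ?thesis .
qed

text \<open>The inequality ln x <= x - 1 at x = p / (q c). Here \<open>c\<close> will be the
  constant of an operator inequality P <= c Q: on average the linear term is then at most 1 and
  cancels the -1, so that ln c remains.\<close>

lemma mult_lg_diff_le:
  assumes "0 \<le> p" "0 \<le> q" "0 \<le> w" "q = 0 \<Longrightarrow> p * w = 0" "0 < c"
  shows "p * w * (lg p - lg q) * ln 2 \<le> p * w * (p / q / c - 1 + ln c)"
proof (cases "p = 0 \<or> w = 0")
  case True
  then show ?thesis by auto
next
  case False
  then have pos: "0 < p" "0 < q" "0 < w" using assms by fastforce+
  have "ln p - ln q = ln (p / q / c) + ln c"
    using pos assms(5) by (simp add: ln_div ln_mult)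
  also have "\<dots> \<le> p / q / c - 1 + ln c"
    using ln_le_minus_one[of "p / q / c"] pos assms(5) by simp
  finally have "p * w * (ln p - ln q) \<le> p * w * (p / q / c - 1 + ln c)"
    using pos by (intro mult_left_mono) auto
  then show ?thesis
    using pos by (simp add: lg_def log_def diff_divide_distrib[symmetric] mult.assoc)
qed

lemma op_pos_form_zero:
  assumes fin: "finite X" and M: "M \<in> opers X" and pos: "op_pos X M" and z: "form X M v = 0" and x: "x \<in> X"
  shows "op_apply X M v x = 0"
proof -
  obtain u l where on: "orthonormal X u" and l: "\<And>k. k \<in> X \<Longrightarrow> 0 \<le> l k" and eq: "M = spec_op X u l"
    using op_pos_spec_opE[OF fin M pos] by metis
  have "(\<Sum>k\<in>X. l k * overlap X (u k) v) = 0"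
    using z unfolding eq form_spec_op of_real_eq_0_iff .
  then have "\<forall>k\<in>X. l k * overlap X (u k) v = 0"
    using fin l by (simp add: sum_nonneg_eq_0_iff overlap_nonneg)
  then have "\<forall>k\<in>X. of_real (l k) * inner_on X (u k) v = 0"
    by (auto simp: overlap_def)
  then show ?thesis
    unfolding eq op_apply_spec_op[OF x] by simp
qed

lemma dominated_kernel:
  assumes fin: "finite X" and P: "P \<in> opers X" "op_pos X P"
    and dom: "\<And>w. Re (form X P w) \<le> c * Re (form X Q w)"
  shows "\<forall>w. (\<forall>x\<in>X. op_apply X Q w x = 0) \<longrightarrow> (\<forall>x\<in>X. op_apply X P w x = 0)"
proof (intro allI impI ballI)
  fix w x assume "\<forall>x\<in>X. op_apply X Q w x = 0" and x: "x \<in> X"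
  then have "form X Q w = 0" by (simp add: form_eq_inner inner_on_def)
  then have "form X P w = 0"
    using dom[of w] op_pos_Re[OF P(2), of w] op_pos_Im[OF P(2), of w] by (simp add: complex_eq_iff)
  then show "op_apply X P w x = 0" by (rule op_pos_form_zero[OF fin P _ x])
qed

text \<open>Testing the operator inequality on the vector \<open>Q\<^sup>-\<^sup>1 u\<^sub>j\<close> shows that \<open>p\<^sub>j \<langle>u\<^sub>j, Q\<^sup>-\<^sup>1 u\<^sub>j\<rangle> \<le> c\<close>.\<close>

lemma rel_entropy_le_dominated:
  assumes fin: "finite X" and P: "P \<in> states X" and Q: "Q \<in> states X" and c: "0 < c"
    and dom: "\<And>w. Re (form X P w) \<le> c * Re (form X Q w)"
  shows "\<exists>D. rel_entropy X P Q = ereal D \<and> D \<le> log 2 c"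
proof -
  obtain u p where on: "orthonormal X u" and p: "\<And>k. k \<in> X \<Longrightarrow> 0 \<le> p k" and eqP: "P = spec_op X u p"
    and p1: "(\<Sum>k\<in>X. p k) = 1" using state_spec_opE[OF fin P] by metis
  obtain v q where on': "orthonormal X v" and q: "\<And>k. k \<in> X \<Longrightarrow> 0 \<le> q k" and eqQ: "Q = spec_op X v q"
    using state_spec_opE[OF fin Q] by metis
  define w where "w = (\<lambda>j k. overlap X (u j) (v k))"
  have w0: "0 \<le> w j k" for j k by (simp add: w_def overlap_nonneg)
  have wk: "(\<Sum>k\<in>X. w j k) = 1" if "j \<in> X" for j
    using sum_overlap[OF fin on', of "u j"] orthonormal_normalized[OF on that]
    by (simp add: w_def overlap_commute)
  note ker = dominated_kernel[OF fin statesD(1,2)[OF P] dom, unfolded eqP eqQ]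
  define D where "D = (\<Sum>j\<in>X. \<Sum>k\<in>X. p j * w j k * (lg (p j) - lg (q k)))"
  have "rel_entropy X P Q = ereal D"
    unfolding eqP eqQ rel_entropy_spec_op[OF fin on on' ker] by (simp add: w_def D_def)
  moreover have "D * ln 2 \<le> ln c"
  proof -
    have inv: "p j * (\<Sum>k\<in>X. w j k / q k) \<le> c" if j: "j \<in> X" for j
    proof -
      define T where "T = (\<Sum>k\<in>X. w j k / q k)"
      \<comment> \<open>Division by 0 gives 0, so \<open>z\<close> is the inverse of Q on its
        support, applied to u_j. Both <u_j, z> and <z, Q z> equal \<open>T\<close>, and P <= c Q at
        \<open>z\<close> yields p_j T^2 <= c T.\<close>
      define z where "z = (\<lambda>x. \<Sum>k\<in>X. (inner_on X (v k) (u j) / of_real (q k)) * v k x)"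
      have T0: "0 \<le> T" using q w0 by (auto simp: T_def intro!: sum_nonneg)
      have "inner_on X (v k) z = inner_on X (v k) (u j) / of_real (q k)" if "k \<in> X" for k
      proof -
        have "inner_on X (v k) z
            = (\<Sum>i\<in>X. inner_on X (v i) (u j) / of_real (q i) * (if k = i then 1 else 0))"
          unfolding z_def inner_on_sum_right using that
          by (intro sum.cong refl) (simp only: orthonormalD[OF on'])
        then show ?thesis by (simp only: sum_mult_delta(2)[OF fin that])
      qed
      then have "overlap X (v k) z = w j k / (q k)\<^sup>2" if "k \<in> X" for k
        using that by (simp add: overlap_def w_def norm_divide power_divide norm_power
            overlap_commute[of X "u j", unfolded overlap_def])
      then have "(\<Sum>k\<in>X. q k * overlap X (v k) z) = T"
        unfolding T_def by (intro sum.cong refl) (simp add: power2_eq_square)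
      then have fQ: "Re (form X Q z) = T" by (simp add: eqQ form_spec_op)
      have "inner_on X (u j) z = (\<Sum>k\<in>X. (inner_on X (v k) (u j) / of_real (q k)) * inner_on X (u j) (v k))"
        unfolding z_def by (rule inner_on_sum_right)
      also have "\<dots> = of_real T"
        by (simp add: T_def w_def of_real_overlap mult.commute)
      finally have ov: "overlap X (u j) z = T\<^sup>2"
        by (simp add: overlap_def)
      have "p j * T\<^sup>2 \<le> (\<Sum>i\<in>X. p i * overlap X (u i) z)"
        unfolding ov[symmetric] using fin j p by (intro member_le_sum) (auto simp: overlap_nonneg)
      also have "\<dots> = Re (form X P z)"
        by (simp add: eqP form_spec_op)
      also have "\<dots> \<le> c * T" using dom[of z] by (simp add: fQ)
      finally have "(p j * T) * T \<le> c * T" by (simp add: power2_eq_square mult.assoc)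
      then have "p j * T \<le> c" if "T \<noteq> 0" using T0 that by simp
      then show ?thesis using c by (cases "T = 0") (auto simp: T_def)
    qed
    have "D * ln 2 = (\<Sum>j\<in>X. \<Sum>k\<in>X. p j * w j k * (lg (p j) - lg (q k)) * ln 2)"
      by (simp add: D_def sum_distrib_right)
    also have "\<dots> \<le> (\<Sum>j\<in>X. \<Sum>k\<in>X. p j * w j k * (p j / q k / c - 1 + ln c))"
      using spec_op_kernel_overlap[OF fin on on' p ker] p q w0 c
      by (intro sum_mono mult_lg_diff_le) (auto simp: w_def)
    also have "\<dots> = (\<Sum>j\<in>X. p j * ((p j * (\<Sum>k\<in>X. w j k / q k)) / c + (\<Sum>k\<in>X. w j k) * (ln c - 1)))"
      by (simp add: sum_distrib_left sum_distrib_right sum_divide_distrib sum.distrib[symmetric] algebra_simps)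
    also have "\<dots> \<le> (\<Sum>j\<in>X. p j * (1 + (ln c - 1)))"
      using inv p c by (intro sum_mono mult_left_mono) (auto simp: wk)
    also have "\<dots> = ln c" by (simp add: sum_distrib_right[symmetric] p1)
    finally show ?thesis .
  qed
  then have "D \<le> log 2 c" by (simp add: log_def field_simps)
  ultimately show ?thesis by blast
qed

section \<open>From relative entropy to an operator inequality\<close>

lemma form_linear:
  "form X (\<lambda>x y. a * M x y + b * N x y) v = a * form X M v + b * form X N v"
  by (simp add: form_def algebra_simps sum.distrib sum_distrib_left)

lemma form_square:
  assumes "hermitian_on X K"
  shows "form X (op_mult X K K) v = of_real (\<Sum>x\<in>X. (cmod (op_apply X K v x))\<^sup>2)"
proof -
  have "op_apply X (op_mult X K K) v x = op_apply X K (op_apply X K v) x" for x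
  proof -
    have "op_apply X (op_mult X K K) v x = (\<Sum>y\<in>X. \<Sum>z\<in>X. K x z * (K z y * v y))"
      by (simp add: op_apply_def op_mult_def sum_distrib_right mult.assoc)
    also have "\<dots> = op_apply X K (op_apply X K v) x"
      by (subst sum.swap) (simp add: op_apply_def sum_distrib_left)
    finally show ?thesis .
  qed
  then have eq: "op_apply X (op_mult X K K) v = op_apply X K (op_apply X K v)"
    by (rule ext)
  have "form X (op_mult X K K) v = inner_on X v (op_apply X K (op_apply X K v))"
    by (simp only: form_eq_inner eq)
  also have "\<dots> = inner_on X (op_apply X K v) (op_apply X K v)"
    by (rule hermitian_on_adjoint[OF assms, symmetric])
  finally show ?thesis by (simp only: inner_on_self)
qed

lemma hermitian_square_pos:
  "hermitian_on X K \<Longrightarrow> op_pos X (op_mult X K K)"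
  by (auto simp: op_pos_iff form_square complex_nonneg_Reals_iff intro!: sum_nonneg)

lemma op_trace_square:
  assumes "hermitian_on X K"
  shows "op_trace X (op_mult X K K) = of_real (\<Sum>x\<in>X. \<Sum>z\<in>X. (cmod (K x z))\<^sup>2)"
proof -
  have "op_trace X (op_mult X K K) = (\<Sum>x\<in>X. \<Sum>z\<in>X. K x z * cnj (K x z))"
    unfolding op_trace_def op_mult_def
    by (intro sum.cong refl) (simp only: hermitian_on_cnj[OF assms])
  then show ?thesis by (simp add: complex_norm_square del: of_real_power)
qed

lemma opers_eq_0: "M \<in> opers X \<Longrightarrow> x \<notin> X \<or> y \<notin> X \<Longrightarrow> M x y = 0"
  unfolding opers_def by blast

lemma opers_eqI:
  assumes "M \<in> opers X" "N \<in> opers X" "\<And>x y. x \<in> X \<Longrightarrow> y \<in> X \<Longrightarrow> M x y = N x y"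
  shows "M = N"
  using assms opers_eq_0 by (metis ext)

lemma opersI: "(\<And>x y. x \<notin> X \<or> y \<notin> X \<Longrightarrow> M x y = 0) \<Longrightarrow> M \<in> opers X"
  unfolding opers_def by blast

lemma op_mult_opers: "M \<in> opers X \<Longrightarrow> N \<in> opers X \<Longrightarrow> op_mult X M N \<in> opers X"
  by (rule opersI) (auto simp: op_mult_def opers_eq_0)

lemma hermitian_on_diff:
  "hermitian_on X M \<Longrightarrow> hermitian_on X N \<Longrightarrow> hermitian_on X (\<lambda>x y. M x y - N x y)"
  unfolding hermitian_on_def by (metis complex_cnj_diff)

lemma sqrt_diff_hermitian:
  assumes "finite X" "P \<in> states X" "Q \<in> states X"
  shows "hermitian_on X (\<lambda>x y. op_sqrt X P x y - op_sqrt X Q x y)"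
  by (intro hermitian_on_diff op_pos_hermitian op_sqrt_props(2) assms statesD(1,2)[OF assms(2)] statesD(1,2)[OF assms(3)])

text \<open>Klein's inequality, read off the Hellinger bound: the trace of (sqrt P - sqrt Q)^2 is a
  sum of squared moduli.\<close>

lemma rel_entropy_nonneg:
  assumes fin: "finite X" and P: "P \<in> states X" and Q: "Q \<in> states X"
    and D: "rel_entropy X P Q = ereal D"
  shows "0 \<le> D"
proof -
  have "0 \<le> (\<Sum>x\<in>X. \<Sum>z\<in>X. (cmod (op_sqrt X P x z - op_sqrt X Q x z))\<^sup>2)"
    by (intro sum_nonneg) auto
  also have "\<dots> \<le> D * ln 2"
    using rel_entropy_ge_hellinger[OF fin P Q D] unfolding op_trace_square[OF sqrt_diff_hermitian[OF fin P Q]]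
    by simp
  finally have "0 \<le> D * ln 2" .
  then show ?thesis by (simp add: zero_le_mult_iff)
qed

lemma rel_entropy_eq_0_imp_eq:
  assumes fin: "finite X" and P: "P \<in> states X" and Q: "Q \<in> states X"
    and D: "rel_entropy X P Q = 0"
  shows "P = Q"
proof -
  have "(\<Sum>x\<in>X. \<Sum>z\<in>X. (cmod (op_sqrt X P x z - op_sqrt X Q x z))\<^sup>2) \<le> 0"
    using rel_entropy_ge_hellinger[OF fin P Q D[unfolded zero_ereal_def]]
    unfolding op_trace_square[OF sqrt_diff_hermitian[OF fin P Q]] by simp
  moreover have "0 \<le> (\<Sum>x\<in>X. \<Sum>z\<in>X. (cmod (op_sqrt X P x z - op_sqrt X Q x z))\<^sup>2)"
    by (intro sum_nonneg) auto
  ultimately have "(\<Sum>x\<in>X. \<Sum>z\<in>X. (cmod (op_sqrt X P x z - op_sqrt X Q x z))\<^sup>2) = 0"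
    by (rule antisym)
  then have *: "op_sqrt X P x z = op_sqrt X Q x z" if "x \<in> X" "z \<in> X" for x z
    using fin that by (simp add: sum_nonneg_eq_0_iff sum_nonneg)
  have "op_sqrt X P = op_sqrt X Q"
    by (rule opers_eqI[OF op_sqrt_props(1)[OF fin statesD(1,2)[OF P]] op_sqrt_props(1)[OF fin statesD(1,2)[OF Q]] *])
  then show ?thesis
    using op_sqrt_props(3)[OF fin statesD(1,2)[OF P]] op_sqrt_props(3)[OF fin statesD(1,2)[OF Q]] by metis
qed

text \<open>Nonnegativity of (s |b| - |c|)^2 / s trades the cross term 2 |b| |c| for s |b|^2 + |c|^2
  / s.\<close>

lemma cmod_add_squared_le:
  assumes s: "0 < s"
  shows "(cmod (b + c))\<^sup>2 \<le> (1 + s) * (cmod b)\<^sup>2 + (1 + 1 / s) * (cmod c)\<^sup>2"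
proof -
  have "0 \<le> (s * cmod b - cmod c)\<^sup>2 / s" using s by simp
  also have "\<dots> = s * (cmod b)\<^sup>2 + (cmod c)\<^sup>2 / s - 2 * cmod b * cmod c"
    using s by (simp add: power2_eq_square field_simps)
  finally have "2 * cmod b * cmod c \<le> s * (cmod b)\<^sup>2 + (cmod c)\<^sup>2 / s" by simp
  moreover have "(cmod (b + c))\<^sup>2 \<le> (cmod b + cmod c)\<^sup>2"
    by (simp add: norm_triangle_ineq power_mono)
  ultimately show ?thesis by (simp add: power2_eq_square algebra_simps)
qed

text \<open>With \<open>C = (\<surd>P - \<surd>Q)\<^sup>2\<close>, this operator inequality takes the place of Pinsker's inequality: it survives
  every positive map, and the trace of \<open>C\<close> is controlled by the relative entropy.\<close>

lemma hellinger_sandwich: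
  assumes fin: "finite X" and P: "P \<in> states X" and Q: "Q \<in> states X"
    and D: "rel_entropy X P Q = ereal D"
  shows "\<exists>C\<in>opers X. op_pos X C \<and> Re (op_trace X C) \<le> D * ln 2 \<and>
    (\<forall>s>0. op_pos X (\<lambda>x y. 1 * (of_real (1 + s) * Q x y + of_real (1 + 1 / s) * C x y) + (-1) * P x y))"
proof -
  define A B where "A = op_sqrt X P" and "B = op_sqrt X Q"
  define K where "K = (\<lambda>x y. A x y - B x y)"
  note pA = op_sqrt_props[OF fin statesD(1,2)[OF P], folded A_def]
  note pB = op_sqrt_props[OF fin statesD(1,2)[OF Q], folded B_def]
  have hA: "hermitian_on X A" and hB: "hermitian_on X B"
    using op_pos_hermitian[OF fin] pA pB by auto
  have hK: "hermitian_on X K" unfolding K_def by (rule hermitian_on_diff[OF hA hB])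
  let ?C = "op_mult X K K"
  have "K \<in> opers X" using pA(1) pB(1) by (intro opersI) (simp add: K_def opers_eq_0)
  then have "?C \<in> opers X" by (intro op_mult_opers)
  moreover have "op_pos X ?C" by (rule hermitian_square_pos[OF hK])
  moreover have "Re (op_trace X ?C) \<le> D * ln 2"
    unfolding K_def A_def B_def by (rule rel_entropy_ge_hellinger[OF fin P Q D])
  \<comment> \<open>The forms of P, Q and C at \<open>v\<close> are the squared norms of
    \<open>A\<close>, \<open>B\<close> and \<open>K\<close> applied to \<open>v\<close>, and the
    first of these vectors is the sum of the other two. The factors \<open>1\<close> and
    \<open>-1\<close> keep the shape a M + b N of \<open>form_linear\<close> and, later, of
    \<open>id_tensor_linear\<close>.\<close>
  moreover have "op_pos X (\<lambda>x y. 1 * (of_real (1 + s) * Q x y + of_real (1 + 1 / s) * ?C x y) + (-1) * P x y)"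
    if s: "0 < s" for s
    unfolding op_pos_iff form_linear
  proof
    fix v
    let ?n = "\<lambda>M. \<Sum>x\<in>X. (cmod (op_apply X M v x))\<^sup>2"
    have "cmod (op_apply X A v x) ^ 2 \<le> (1 + s) * (cmod (op_apply X B v x))\<^sup>2 + (1 + 1 / s) * (cmod (op_apply X K v x))\<^sup>2"
      for x
    proof -
      have "op_apply X A v x = op_apply X B v x + op_apply X K v x"
        by (simp add: op_apply_def K_def algebra_simps sum_subtractf)
      then show ?thesis using cmod_add_squared_le[OF s] by simp
    qed
    then have "?n A \<le> (\<Sum>x\<in>X. (1 + s) * (cmod (op_apply X B v x))\<^sup>2 + (1 + 1 / s) * (cmod (op_apply X K v x))\<^sup>2)"
      by (rule sum_mono)
    also have "\<dots> = (1 + s) * ?n B + (1 + 1 / s) * ?n K"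
      by (simp only: sum.distrib sum_distrib_left)
    finally have le: "0 \<le> (1 + s) * ?n B + (1 + 1 / s) * ?n K - ?n A" by simp
    have "form X P v = of_real (?n A)" "form X Q v = of_real (?n B)"
      using form_square[OF hA, of v] form_square[OF hB, of v] pA(3) pB(3) by simp_all
    then have eq: "1 * (of_real (1 + s) * form X Q v + of_real (1 + 1 / s) * form X ?C v) + (-1) * form X P v
        = of_real ((1 + s) * ?n B + (1 + 1 / s) * ?n K - ?n A)"
      by (simp only: form_square[OF hK]) simp
    show "1 * (of_real (1 + s) * form X Q v + of_real (1 + 1 / s) * form X ?C v) + (-1) * form X P v \<in> \<real>\<^sub>\<ge>\<^sub>0"
      unfolding eq using le by (simp only: nonneg_Reals_of_real_iff)
  qed
  ultimately show ?thesis by blast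
qed

text \<open>With A = sqrt M the form is |A v|^2, and Cauchy-Schwarz applies in each component. For
  the blocks of a vector on a composite system this is the pinching inequality.\<close>

lemma form_sum_le:
  assumes fin: "finite X" and M: "M \<in> opers X" "op_pos X M"
  shows "Re (form X M (\<lambda>x. \<Sum>k\<in>K. f k x)) \<le> real (card K) * (\<Sum>k\<in>K. Re (form X M (f k)))"
proof -
  define A where "A = op_sqrt X M"
  note pA = op_sqrt_props[OF fin M, folded A_def]
  have hA: "hermitian_on X A" using op_pos_hermitian[OF fin pA(2)] .
  have F: "Re (form X M v) = (\<Sum>x\<in>X. (cmod (op_apply X A v x))\<^sup>2)" for v
    using form_square[OF hA, of v] pA(3) by simp
  have "(cmod (op_apply X A (\<lambda>x. \<Sum>k\<in>K. f k x) x))\<^sup>2 \<le> real (card K) * (\<Sum>k\<in>K. (cmod (op_apply X A (f k) x))\<^sup>2)" for x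
  proof -
    have "op_apply X A (\<lambda>x. \<Sum>k\<in>K. f k x) x = (\<Sum>k\<in>K. op_apply X A (f k) x)"
      using op_apply_sum[where c = "\<lambda>_. 1" and X = X and M = A and K = K and w = f] by (simp add: fun_eq_iff)
    then have "(cmod (op_apply X A (\<lambda>x. \<Sum>k\<in>K. f k x) x))\<^sup>2 \<le> (\<Sum>k\<in>K. cmod (op_apply X A (f k) x))\<^sup>2"
      by (simp add: norm_sum power_mono)
    also have "\<dots> \<le> (\<Sum>k\<in>K. (cmod (op_apply X A (f k) x))\<^sup>2) * real (card K)"
      by (rule sum_squared_le_sum_of_squares)
    finally show ?thesis by (simp add: mult.commute)
  qed
  then have "(\<Sum>x\<in>X. (cmod (op_apply X A (\<lambda>x. \<Sum>k\<in>K. f k x) x))\<^sup>2)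
      \<le> (\<Sum>x\<in>X. real (card K) * (\<Sum>k\<in>K. (cmod (op_apply X A (f k) x))\<^sup>2))"
    by (rule sum_mono)
  also have "\<dots> = real (card K) * (\<Sum>k\<in>K. \<Sum>x\<in>X. (cmod (op_apply X A (f k) x))\<^sup>2)"
    by (subst sum.swap) (simp add: sum_distrib_left)
  finally show ?thesis by (simp only: F)
qed

subsection \<open>Mutual information with a maximally mixed marginal\<close>

lemma marginal_snd_opers: "M \<in> opers (X \<times> Y) \<Longrightarrow> marginal_snd X M \<in> opers Y"
  by (rule opersI) (auto simp: marginal_snd_def opers_eq_0)

lemma marginal_fst_opers: "M \<in> opers (X \<times> Y) \<Longrightarrow> marginal_fst Y M \<in> opers X"
  by (rule opersI) (auto simp: marginal_fst_def opers_eq_0)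

lemma op_trace_marginal_snd: "op_trace Y (marginal_snd X M) = op_trace (X \<times> Y) M"
  unfolding op_trace_def marginal_snd_def sum.cartesian_product'
  by (subst sum.swap) simp

lemma form_cong: "(\<And>x. x \<in> X \<Longrightarrow> v x = w x) \<Longrightarrow> form X M v = form X M w"
  by (simp add: form_def)

lemma form_block_fst:
  assumes fin: "finite X" "finite Y" and r: "r \<in> X"
  shows "form (X \<times> Y) M (\<lambda>(x, y). if x = r then \<phi> y else 0)
    = form Y (\<lambda>y y'. M (r, y) (r, y')) \<phi>"
proof -
  have "form (X \<times> Y) M (\<lambda>(x, y). if x = r then \<phi> y else 0)
      = form ({r} \<times> Y) M (\<lambda>(x, y). if x = r then \<phi> y else 0)"
    using r fin by (intro form_support) (auto split: if_splits)
  also have "\<dots> = form Y (\<lambda>y y'. M (r, y) (r, y')) \<phi>"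
    by (simp add: form_def sum.cartesian_product')
  finally show ?thesis .
qed

lemma form_block_snd:
  assumes fin: "finite X" "finite Y" and s: "s \<in> Y"
  shows "form (X \<times> Y) M (\<lambda>(x, y). if y = s then \<phi> x else 0)
    = form X (\<lambda>x x'. M (x, s) (x', s)) \<phi>"
proof -
  have "form (X \<times> Y) M (\<lambda>(x, y). if y = s then \<phi> x else 0)
      = form (X \<times> {s}) M (\<lambda>(x, y). if y = s then \<phi> x else 0)"
    using s fin by (intro form_support) (auto split: if_splits)
  also have "\<dots> = form X (\<lambda>x x'. M (x, s) (x', s)) \<phi>"
    by (simp add: form_def sum.cartesian_product')
  finally show ?thesis .
qed

lemma form_sum_op: "form X (\<lambda>x y. \<Sum>k\<in>K. M k x y) v = (\<Sum>k\<in>K. form X (M k) v)"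
proof -
  have "form X (\<lambda>x y. \<Sum>k\<in>K. M k x y) v = (\<Sum>x\<in>X. \<Sum>k\<in>K. \<Sum>y\<in>X. cnj (v x) * M k x y * v y)"
    unfolding form_def sum_distrib_left sum_distrib_right
    by (intro sum.cong refl sum.swap)
  also have "\<dots> = (\<Sum>k\<in>K. form X (M k) v)"
    unfolding form_def by (rule sum.swap)
  finally show ?thesis .
qed

lemma form_marginal_snd:
  assumes "finite X" "finite Y"
  shows "form Y (marginal_snd X M) \<phi> = (\<Sum>r\<in>X. form (X \<times> Y) M (\<lambda>(x, y). if x = r then \<phi> y else 0))"
  unfolding marginal_snd_def form_sum_op
  by (intro sum.cong refl) (simp add: form_block_fst[OF assms])

lemma form_marginal_fst:
  assumes "finite X" "finite Y"
  shows "form X (marginal_fst Y M) \<phi> = (\<Sum>s\<in>Y. form (X \<times> Y) M (\<lambda>(x, y). if y = s then \<phi> x else 0))"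
  unfolding marginal_fst_def form_sum_op
  by (intro sum.cong refl) (simp add: form_block_snd[OF assms])

lemma op_pos_marginal_snd:
  assumes "finite X" "finite Y" "op_pos (X \<times> Y) M"
  shows "op_pos Y (marginal_snd X M)"
  unfolding op_pos_iff form_marginal_snd[OF assms(1,2)] using assms(3)
  by (auto simp: op_pos_iff complex_nonneg_Reals_iff intro!: sum_nonneg sum.neutral)

lemma marginal_snd_state:
  assumes "finite X" "finite Y" "M \<in> states (X \<times> Y)"
  shows "marginal_snd X M \<in> states Y"
  using assms by (auto simp: states_def marginal_snd_opers op_pos_marginal_snd op_trace_marginal_snd)

text \<open>The operator inequality M <= |X| (1 \<otimes> M_Y): \<open>\<psi>\<close> is cut into
  its blocks at fixed \<open>r\<close>, and the form on one block is among the nonnegative terms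
  that make up the form of the marginal.\<close>

lemma form_le_marginal_snd:
  assumes fin: "finite X" "finite Y" and M: "M \<in> opers (X \<times> Y)" "op_pos (X \<times> Y) M"
  shows "Re (form (X \<times> Y) M \<psi>) \<le> real (card X) * (\<Sum>r\<in>X. Re (form Y (marginal_snd X M) (\<lambda>y. \<psi> (r, y))))"
proof -
  let ?f = "\<lambda>r. \<lambda>(x, y). if x = r then \<psi> (r, y) else 0"
  have "form (X \<times> Y) M \<psi> = form (X \<times> Y) M (\<lambda>p. \<Sum>r\<in>X. ?f r p)"
    using fin by (intro form_cong) auto
  then have "Re (form (X \<times> Y) M \<psi>) \<le> real (card X) * (\<Sum>r\<in>X. Re (form (X \<times> Y) M (?f r)))"
    using form_sum_le[OF _ M, of ?f X] fin by simp
  also have "\<dots> \<le> real (card X) * (\<Sum>r\<in>X. Re (form Y (marginal_snd X M) (\<lambda>y. \<psi> (r, y))))"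
  proof (intro mult_left_mono sum_mono)
    fix r assume r: "r \<in> X"
    have "Re (form (X \<times> Y) M (\<lambda>(x, y). if x = r then \<psi> (r, y) else 0))
      \<le> (\<Sum>k\<in>X. Re (form (X \<times> Y) M (\<lambda>(x, y). if x = k then \<psi> (r, y) else 0)))"
      using fin r op_pos_Re[OF M(2)]
      by (intro member_le_sum[of r X "\<lambda>k. Re (form (X \<times> Y) M (\<lambda>(x, y). if x = k then \<psi> (r, y) else 0))"]) auto
    then show "Re (form (X \<times> Y) M (?f r)) \<le> Re (form Y (marginal_snd X M) (\<lambda>y. \<psi> (r, y)))"
      by (simp add: form_marginal_snd[OF fin])
  qed simp
  finally show ?thesis .
qed

lemma form_le_marginal_fst:
  assumes fin: "finite X" "finite Y" and M: "M \<in> opers (X \<times> Y)" "op_pos (X \<times> Y) M"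
  shows "Re (form (X \<times> Y) M \<psi>) \<le> real (card Y) * (\<Sum>s\<in>Y. Re (form X (marginal_fst Y M) (\<lambda>x. \<psi> (x, s))))"
proof -
  let ?f = "\<lambda>s. \<lambda>(x, y). if y = s then \<psi> (x, s) else 0"
  have "form (X \<times> Y) M \<psi> = form (X \<times> Y) M (\<lambda>p. \<Sum>s\<in>Y. ?f s p)"
    using fin by (intro form_cong) auto
  then have "Re (form (X \<times> Y) M \<psi>) \<le> real (card Y) * (\<Sum>s\<in>Y. Re (form (X \<times> Y) M (?f s)))"
    using form_sum_le[OF _ M, of ?f Y] fin by simp
  also have "\<dots> \<le> real (card Y) * (\<Sum>s\<in>Y. Re (form X (marginal_fst Y M) (\<lambda>x. \<psi> (x, s))))"
  proof (intro mult_left_mono sum_mono)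
    fix s assume s: "s \<in> Y"
    have "Re (form (X \<times> Y) M (\<lambda>(x, y). if y = s then \<psi> (x, s) else 0))
      \<le> (\<Sum>k\<in>Y. Re (form (X \<times> Y) M (\<lambda>(x, y). if y = k then \<psi> (x, s) else 0)))"
      using fin s op_pos_Re[OF M(2)]
      by (intro member_le_sum[of s Y "\<lambda>k. Re (form (X \<times> Y) M (\<lambda>(x, y). if y = k then \<psi> (x, s) else 0))"]) auto
    then show "Re (form (X \<times> Y) M (?f s)) \<le> Re (form X (marginal_fst Y M) (\<lambda>x. \<psi> (x, s)))"
      by (simp add: form_marginal_fst[OF fin])
  qed simp
  finally show ?thesis .
qed

section \<open>The maximally mixed state, and bounds on the mutual information\<close>

definition max_mixed :: "'a set \<Rightarrow> 'a oper" where
  "max_mixed X = (\<lambda>x y. if x = y \<and> x \<in> X then 1 / of_nat (card X) else 0)"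

lemma form_max_mixed:
  assumes "finite X"
  shows "form X (max_mixed X) v = of_real ((\<Sum>x\<in>X. (cmod (v x))\<^sup>2) / real (card X))"
proof -
  have "form X (max_mixed X) v = (\<Sum>x\<in>X. cnj (v x) * v x / of_nat (card X))"
    unfolding form_def
  proof (intro sum.cong refl)
    fix x assume x: "x \<in> X"
    have "(\<Sum>y\<in>X. cnj (v x) * max_mixed X x y * v y)
        = (\<Sum>y\<in>X. (cnj (v x) * v y / of_nat (card X)) * (if x = y then 1 else 0))"
      using x by (intro sum.cong refl) (simp add: max_mixed_def)
    also have "\<dots> = cnj (v x) * v x / of_nat (card X)"
      by (rule sum_mult_delta(2)[OF assms x])
    finally show "(\<Sum>y\<in>X. cnj (v x) * max_mixed X x y * v y) = cnj (v x) * v x / of_nat (card X)" .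
  qed
  also have "\<dots> = of_real ((\<Sum>x\<in>X. (cmod (v x))\<^sup>2) / real (card X))"
    by (simp add: sum_divide_distrib complex_norm_square mult.commute del: of_real_power)
  finally show ?thesis .
qed

lemma form_max_mixed_tensor:
  assumes fin: "finite X"
  shows "form (X \<times> Y) (op_tensor (max_mixed X) \<rho>) \<psi> = (\<Sum>r\<in>X. form Y \<rho> (\<lambda>y. \<psi> (r, y))) / of_nat (card X)"
proof -
  have "form (X \<times> Y) (op_tensor (max_mixed X) \<rho>) \<psi>
    = (\<Sum>r\<in>X. \<Sum>y\<in>Y. \<Sum>r'\<in>X. \<Sum>y'\<in>Y. cnj (\<psi> (r, y)) * (max_mixed X r r' * \<rho> y y') * \<psi> (r', y'))"
    by (simp add: form_def sum.cartesian_product' op_tensor_def)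
  also have "\<dots> = (\<Sum>r\<in>X. \<Sum>y\<in>Y. \<Sum>r'\<in>X. (\<Sum>y'\<in>Y. cnj (\<psi> (r, y)) * \<rho> y y' * \<psi> (r', y')) / of_nat (card X)
      * (if r = r' then 1 else 0))"
    by (intro sum.cong refl) (auto simp: max_mixed_def sum_divide_distrib)
  also have "\<dots> = (\<Sum>r\<in>X. form Y \<rho> (\<lambda>y. \<psi> (r, y))) / of_nat (card X)"
    using fin by (simp add: form_def sum_divide_distrib cong: sum.cong)
  finally show ?thesis .
qed

lemma max_mixed_tensor_state:
  assumes "finite X" "X \<noteq> {}" "finite Y" "\<rho> \<in> states Y"
  shows "op_tensor (max_mixed X) \<rho> \<in> states (X \<times> Y)"
  unfolding states_def
proof (intro CollectI conjI)
  show "op_tensor (max_mixed X) \<rho> \<in> opers (X \<times> Y)"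
    using statesD(1)[OF assms(4)] unfolding opers_def
    by (auto simp: op_tensor_def max_mixed_def split: if_splits)
  show "op_pos (X \<times> Y) (op_tensor (max_mixed X) \<rho>)"
    unfolding op_pos_iff form_max_mixed_tensor[OF assms(1)]
    using statesD(2)[OF assms(4)]
    by (auto simp: op_pos_iff complex_nonneg_Reals_iff intro!: divide_nonneg_nonneg sum_nonneg)
  have "op_trace (X \<times> Y) (op_tensor (max_mixed X) \<rho>)
      = (\<Sum>x\<in>X. \<Sum>y\<in>Y. \<rho> y y / of_nat (card X))"
    by (simp add: op_trace_def sum.cartesian_product' op_tensor_def max_mixed_def)
  also have "\<dots> = op_trace Y \<rho>"
    using assms(1,2) by (simp add: op_trace_def sum_divide_distrib[symmetric])
  finally show "op_trace (X \<times> Y) (op_tensor (max_mixed X) \<rho>) = 1"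
    using statesD(3)[OF assms(4)] by simp
qed

text \<open>One factor |R| comes from P <= |R| (1 \<otimes> P_Y), another from writing 1 as |R|
  times the maximally mixed state. Hence P <= |R|^2 Q, which explains the 2 before the
  logarithm.\<close>

lemma mutual_info_max_mixed_le_fst:
  assumes fin: "finite R" "R \<noteq> {}" "finite Y" and P: "P \<in> states (R \<times> Y)"
    and marg: "marginal_fst Y P = max_mixed R"
  shows "\<exists>D. mutual_info R Y P = ereal D \<and> D \<le> 2 * log 2 (real (card R))"
proof -
  let ?n = "real (card R)"
  let ?Q = "op_tensor (max_mixed R) (marginal_snd R P)"
  have n: "0 < ?n" using fin by (simp add: card_gt_0_iff)
  have Q: "?Q \<in> states (R \<times> Y)"
    using max_mixed_tensor_state[OF fin] marginal_snd_state[OF fin(1,3) P] by blast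
  have "Re (form (R \<times> Y) P \<psi>) \<le> ?n\<^sup>2 * Re (form (R \<times> Y) ?Q \<psi>)" for \<psi>
    using form_le_marginal_snd[OF fin(1,3) statesD(1,2)[OF P], of \<psi>] n
    by (simp add: form_max_mixed_tensor[OF fin(1)] power2_eq_square)
  then have "\<exists>D. rel_entropy (R \<times> Y) P ?Q = ereal D \<and> D \<le> log 2 (?n\<^sup>2)"
    using fin P Q n by (intro rel_entropy_le_dominated) auto
  then show ?thesis
    using n by (auto simp: mutual_info_def marg log_nat_power)
qed

text \<open>Again ln x <= x - 1, now at x = 1 / (n s y); the leftover terms 1 / n - s y sum to
  0.\<close>

lemma entropy_le:
  assumes fin: "finite Y" "Y \<noteq> {}" and s: "\<And>y. y \<in> Y \<Longrightarrow> 0 \<le> s y" "(\<Sum>y\<in>Y. s y) = 1"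
  shows "- (\<Sum>y\<in>Y. s y * lg (s y)) \<le> log 2 (real (card Y))"
proof -
  let ?n = "real (card Y)"
  have n: "0 < ?n" using fin by (simp add: card_gt_0_iff)
  have "- (s y * lg (s y)) * ln 2 \<le> s y * ln ?n + (1 / ?n - s y)" if y: "y \<in> Y" for y
  proof (cases "s y = 0")
    case True
    then show ?thesis using n by simp
  next
    case False
    then have pos: "0 < s y" using s(1)[OF y] by simp
    have "- ln (s y) = ln (1 / (?n * s y)) + ln ?n"
      using n pos by (simp add: ln_div ln_mult)
    also have "\<dots> \<le> 1 / (?n * s y) - 1 + ln ?n"
      using ln_le_minus_one[of "1 / (?n * s y)"] n pos by simp
    finally have "s y * (- ln (s y)) \<le> s y * (1 / (?n * s y) - 1 + ln ?n)"
      using pos by (intro mult_left_mono) auto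
    moreover have "s y * (1 / (?n * s y)) = 1 / ?n"
      using pos by simp
    ultimately show ?thesis using pos by (simp add: lg_def log_def algebra_simps)
  qed
  then have "(\<Sum>y\<in>Y. - (s y * lg (s y)) * ln 2) \<le> (\<Sum>y\<in>Y. s y * ln ?n + (1 / ?n - s y))"
    by (rule sum_mono)
  also have "\<dots> = ln ?n"
    using n s(2) by (simp add: sum.distrib sum_subtractf sum_distrib_right[symmetric])
  finally have "- (\<Sum>y\<in>Y. s y * lg (s y)) * ln 2 \<le> ln ?n"
    by (simp add: sum_distrib_right sum_negf)
  then show ?thesis by (simp add: log_def field_simps)
qed

text \<open>In terms of entropies the mutual information is log n + H(Y) - H(RY). Every eigenvalue
  of P is at most m / n, because P <= m (P_R \<otimes> 1) with P_R maximally mixed; so H(RY) >= log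
  n - log m. Together with H(Y) <= log m, the terms log n cancel and 2 log m remains.\<close>

lemma mutual_info_max_mixed_le_snd:
  fixes R :: "'a set" and Y :: "'b set"
  assumes fin: "finite R" "R \<noteq> {}" "finite Y" and P: "P \<in> states (R \<times> Y)"
    and marg: "marginal_fst Y P = max_mixed R" and D: "mutual_info R Y P = ereal D"
  shows "D \<le> 2 * log 2 (real (card Y))"
proof -
  let ?X = "R \<times> Y" and ?n = "real (card R)" and ?m = "real (card Y)"
  define \<rho> where "\<rho> = marginal_snd R P"
  define Q where "Q = op_tensor (max_mixed R) \<rho>"
  have n: "0 < ?n" using fin by (simp add: card_gt_0_iff)
  have finX: "finite ?X" using fin by simp
  have \<rho>: "\<rho> \<in> states Y"
    unfolding \<rho>_def by (rule marginal_snd_state[OF fin(1,3) P])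
  have "Y \<noteq> {}" using statesD(3)[OF \<rho>] by (auto simp: op_trace_def)
  then have m: "0 < ?m" using fin by (simp add: card_gt_0_iff)
  have Q: "Q \<in> states ?X"
    unfolding Q_def by (rule max_mixed_tensor_state[OF fin \<rho>])
  obtain u p where on: "orthonormal ?X u" and p: "\<And>k. k \<in> ?X \<Longrightarrow> 0 \<le> p k" and eqP: "P = spec_op ?X u p"
    and p1: "(\<Sum>k\<in>?X. p k) = 1" using state_spec_opE[OF finX P] by metis
  obtain f s where onf: "orthonormal Y f" and s: "\<And>k. k \<in> Y \<Longrightarrow> 0 \<le> s k" and eqs: "\<rho> = spec_op Y f s"
    and s1: "(\<Sum>k\<in>Y. s k) = 1" using state_spec_opE[OF fin(3) \<rho>] by metis
  \<comment> \<open>The product vectors e_r \<otimes> f_b, an eigenbasis of \<open>Q\<close> with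
    eigenvalues s_b / n.\<close>
  define v where "v = (\<lambda>(r::'a, b). \<lambda>(x, y). if x = r then f b y else 0)"
  define q where "q = (\<lambda>(r::'a, b). s b / ?n)"
  have "inner_on ?X (v (r, b)) (v (r', b')) = (if (r, b) = (r', b') then 1 else 0)"
    if "r \<in> R" "b \<in> Y" "r' \<in> R" "b' \<in> Y" for r b r' b'
  proof -
    have "inner_on ?X (v (r, b)) (v (r', b'))
        = (\<Sum>x\<in>R. \<Sum>y\<in>Y. cnj (if x = r then f b y else 0) * (if x = r' then f b' y else 0))"
      by (simp add: inner_on_def sum.cartesian_product' v_def)
    also have "\<dots> = (\<Sum>x\<in>R. (if r = r' then inner_on Y (f b) (f b') else 0) * (if x = r then 1 else 0))"
      by (intro sum.cong refl) (auto simp: inner_on_def)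
    also have "\<dots> = (if r = r' then inner_on Y (f b) (f b') else 0)"
      by (rule sum_mult_delta(1)[OF fin(1) that(1)])
    also have "\<dots> = (if (r, b) = (r', b') then 1 else 0)"
      using that by (simp add: orthonormalD[OF onf])
    finally show ?thesis .
  qed
  then have onv: "orthonormal ?X v"
    by (auto simp: orthonormal_def)
  have "Q (x, y) (x', y') = (\<Sum>k\<in>?X. complex_of_real (q k) * v k (x, y) * cnj (v k (x', y')))"
    if "x \<in> R" "y \<in> Y" "x' \<in> R" "y' \<in> Y" for x y x' y'
  proof -
    have "(\<Sum>k\<in>?X. complex_of_real (q k) * v k (x, y) * cnj (v k (x', y')))
        = (\<Sum>r\<in>R. \<Sum>b\<in>Y. of_real (s b / ?n) * (if x = r then f b y else 0) * cnj (if x' = r then f b y' else 0))"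
      by (simp add: sum.cartesian_product' v_def q_def)
    also have "\<dots> = (\<Sum>r\<in>R. (if x = x' then \<rho> y y' / of_nat (card R) else 0) * (if x = r then 1 else 0))"
      using that
      by (intro sum.cong refl) (auto simp: eqs spec_op_def sum_divide_distrib)
    also have "\<dots> = (if x = x' then \<rho> y y' / of_nat (card R) else 0)"
      by (rule sum_mult_delta(2)[OF fin(1) that(1)])
    also have "\<dots> = Q (x, y) (x', y')"
      using that by (simp add: Q_def op_tensor_def max_mixed_def)
    finally show ?thesis by simp
  qed
  then have "eigendecomposition ?X Q v q"
    using onv by (auto simp: eigendecomposition_iff)
  then have eqQ: "Q = spec_op ?X v q"
    by (rule eigendecomposition_imp_spec_op[OF statesD(1)[OF Q]])
  have rel: "rel_entropy ?X P Q = ereal D"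
    using D by (simp add: mutual_info_def marg Q_def \<rho>_def)
  note ker = rel_entropy_finite_imp_kernel[OF rel, unfolded eqP eqQ]
  define w where "w = (\<lambda>j k. overlap ?X (u j) (v k))"
  have w0: "0 \<le> w j k" for j k by (simp add: w_def overlap_nonneg)
  have wk: "(\<Sum>k\<in>?X. w j k) = 1" if "j \<in> ?X" for j
    using sum_overlap[OF finX onv, of "u j"] orthonormal_normalized[OF on that]
    by (simp add: w_def overlap_commute)
  have Deq: "D = (\<Sum>j\<in>?X. \<Sum>k\<in>?X. p j * w j k * (lg (p j) - lg (q k)))"
    using rel unfolding eqP eqQ rel_entropy_spec_op[OF finX on onv ker] by (simp add: w_def)
  define L where "L = log 2 (?m / ?n)"
  \<comment> \<open>The factor \<open>p j\<close> stays because \<open>lg 0\<close> is 0, which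
    exceeds \<open>L\<close> when m < n.\<close>
  have pL: "p j * lg (p j) \<le> p j * L" if j: "j \<in> ?X" for j
  proof (cases "p j = 0")
    case False
    then have pos: "0 < p j" using p[OF j] by simp
    have "p j = Re (form ?X P (u j))"
      by (simp add: eqP spec_op_eigenvector[OF finX on j])
    also have "\<dots> \<le> ?m * (\<Sum>y\<in>Y. Re (form R (marginal_fst Y P) (\<lambda>x. u j (x, y))))"
      by (rule form_le_marginal_fst[OF fin(1,3) statesD(1,2)[OF P]])
    also have "(\<Sum>y\<in>Y. Re (form R (marginal_fst Y P) (\<lambda>x. u j (x, y))))
        = (\<Sum>y\<in>Y. \<Sum>x\<in>R. (cmod (u j (x, y)))\<^sup>2) / ?n"
      by (simp only: marg form_max_mixed[OF fin(1)] Re_complex_of_real sum_divide_distrib)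
    also have "(\<Sum>y\<in>Y. \<Sum>x\<in>R. (cmod (u j (x, y)))\<^sup>2) = (\<Sum>z\<in>?X. (cmod (u j z))\<^sup>2)"
      unfolding sum.cartesian_product' by (rule sum.swap)
    also have "\<dots> = 1" by (rule orthonormal_normalized[OF on j])
    finally have "p j \<le> ?m / ?n" by simp
    then have "lg (p j) \<le> L" using pos by (simp add: lg_def L_def)
    then show ?thesis using pos by (simp add: mult_left_mono)
  qed simp
  have "D \<le> (\<Sum>j\<in>?X. \<Sum>k\<in>?X. w j k * (p j * L) - p j * w j k * lg (q k))"
    unfolding Deq
  proof (intro sum_mono)
    fix j k assume jk: "j \<in> ?X" "k \<in> ?X"
    show "p j * w j k * (lg (p j) - lg (q k)) \<le> w j k * (p j * L) - p j * w j k * lg (q k)"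
      using mult_left_mono[OF pL[OF jk(1)] w0[of j k]] by (simp add: algebra_simps)
  qed
  also have "\<dots> = (\<Sum>j\<in>?X. (\<Sum>k\<in>?X. w j k) * (p j * L)) - (\<Sum>k\<in>?X. (\<Sum>j\<in>?X. p j * w j k) * lg (q k))"
    unfolding sum_subtractf sum_distrib_right
    by (intro arg_cong2[where f = "(-)"] refl sum.swap)
  also have "(\<Sum>j\<in>?X. (\<Sum>k\<in>?X. w j k) * (p j * L)) = L"
    using p1 by (simp add: wk sum_distrib_right[symmetric])
  also have "(\<Sum>k\<in>?X. (\<Sum>j\<in>?X. p j * w j k) * lg (q k)) = (\<Sum>k\<in>?X. Re (form ?X P (v k)) * lg (q k))"
    by (simp add: eqP form_spec_op w_def)
  also have "\<dots> = (\<Sum>b\<in>Y. (\<Sum>r\<in>R. Re (form ?X P (v (r, b)))) * lg (s b / ?n))"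
    unfolding sum.cartesian_product' sum_distrib_right by (subst sum.swap) (simp add: q_def)
  also have "\<dots> = (\<Sum>b\<in>Y. s b * lg (s b / ?n))"
  proof (intro sum.cong refl arg_cong2[where f = times])
    fix b assume b: "b \<in> Y"
    have "(\<Sum>r\<in>R. Re (form ?X P (v (r, b)))) = Re (form Y \<rho> (f b))"
      unfolding \<rho>_def form_marginal_snd[OF fin(1,3)] by (simp add: v_def)
    then show "(\<Sum>r\<in>R. Re (form ?X P (v (r, b)))) = s b"
      by (simp add: eqs spec_op_eigenvector[OF fin(3) onf b])
  qed
  also have "\<dots> = (\<Sum>b\<in>Y. s b * lg (s b) - s b * log 2 ?n)"
  proof (intro sum.cong refl)
    fix b assume b: "b \<in> Y"
    show "s b * lg (s b / ?n) = s b * lg (s b) - s b * log 2 ?n"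
      using s[OF b] n by (cases "s b = 0") (auto simp: lg_def log_divide algebra_simps)
  qed
  also have "\<dots> = (\<Sum>b\<in>Y. s b * lg (s b)) - log 2 ?n"
    by (simp add: sum_subtractf sum_distrib_right[symmetric] s1)
  finally have "D \<le> L + log 2 ?n - (\<Sum>b\<in>Y. s b * lg (s b))" by simp
  moreover have "L = log 2 ?m - log 2 ?n"
    using n m by (simp add: L_def log_divide)
  ultimately show ?thesis
    using entropy_le[OF fin(3) \<open>Y \<noteq> {}\<close> s s1] by simp
qed

subsection \<open>Channels\<close>

lemma zero_opers: "(\<lambda>x y. 0) \<in> opers X"
  by (simp add: opers_def)

lemma linear_opers: "M \<in> opers X \<Longrightarrow> N \<in> opers X \<Longrightarrow> (\<lambda>x y. a * M x y + b * N x y) \<in> opers X"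
  by (rule opersI) (auto simp: opers_eq_0)

lemma sum_opers:
  assumes "\<And>k. k \<in> K \<Longrightarrow> M k \<in> opers X"
  shows "(\<lambda>x y. \<Sum>k\<in>K. c k * M k x y) \<in> opers X"
proof (rule opersI)
  fix x y assume "x \<notin> X \<or> y \<notin> X"
  then have "M k x y = 0" if "k \<in> K" for k
    by (rule opers_eq_0[OF assms[OF that]])
  then show "(\<Sum>k\<in>K. c k * M k x y) = 0" by simp
qed

lemma channel_opers: "T \<in> channels X Y \<Longrightarrow> M \<in> opers X \<Longrightarrow> T M \<in> opers Y"
  by (simp add: channels_def)

lemma channel_linear: "T \<in> channels X Y \<Longrightarrow> M \<in> opers X \<Longrightarrow> N \<in> opers X \<Longrightarrow>
    T (\<lambda>x y. a * M x y + b * N x y) = (\<lambda>x y. a * T M x y + b * T N x y)"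
  by (simp add: channels_def)

lemma channel_pos: "T \<in> channels X Y \<Longrightarrow> M \<in> opers ({..<r} \<times> X) \<Longrightarrow> op_pos ({..<r} \<times> X) M \<Longrightarrow>
    op_pos ({..<r::nat} \<times> Y) (id_tensor T M)"
  by (simp add: channels_def)

lemma channel_trace: "T \<in> channels X Y \<Longrightarrow> M \<in> opers X \<Longrightarrow> op_trace Y (T M) = op_trace X M"
  by (simp add: channels_def)

lemma channel_zero: "T \<in> channels X Y \<Longrightarrow> T (\<lambda>x y. 0) = (\<lambda>x y. 0)"
  using channel_linear[OF _ zero_opers zero_opers, of T X Y 0 0] by simp

lemma channel_scale: "T \<in> channels X Y \<Longrightarrow> M \<in> opers X \<Longrightarrow> T (\<lambda>x y. a * M x y) = (\<lambda>x y. a * T M x y)"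
  using channel_linear[OF _ _ zero_opers, of T X Y M a 0] by simp

lemma channel_sum:
  assumes T: "T \<in> channels X Y" and "finite K" "\<And>k. k \<in> K \<Longrightarrow> M k \<in> opers X"
  shows "T (\<lambda>x y. \<Sum>k\<in>K. c k * M k x y) = (\<lambda>x y. \<Sum>k\<in>K. c k * T (M k) x y)"
  using assms(2,3)
proof (induction K rule: finite_induct)
  case empty
  then show ?case by (simp add: channel_zero[OF T])
next
  case (insert k K)
  then have "T (\<lambda>x y. \<Sum>k\<in>insert k K. c k * M k x y)
      = T (\<lambda>x y. c k * M k x y + 1 * (\<Sum>k\<in>K. c k * M k x y))"
    by simp
  also have "\<dots> = (\<lambda>x y. c k * T (M k) x y + 1 * T (\<lambda>x y. \<Sum>k\<in>K. c k * M k x y) x y)"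
    using insert.prems by (intro channel_linear[OF T] sum_opers) auto
  also have "\<dots> = (\<lambda>x y. \<Sum>k\<in>insert k K. c k * T (M k) x y)"
    using insert by simp
  finally show ?case .
qed

lemma id_tensor_comp: "id_tensor (T' \<circ> T) M = id_tensor T' (id_tensor T M)"
  by (simp add: id_tensor_def fun_eq_iff)

lemma id_tensor_id: "id_tensor id M = M"
  by (simp add: id_tensor_def fun_eq_iff)

lemma block_opers: "M \<in> opers (R \<times> X) \<Longrightarrow> (\<lambda>x x'. M (r, x) (r', x')) \<in> opers X"
  by (rule opersI) (auto simp: opers_eq_0)

lemma block_zero: "M \<in> opers (R \<times> X) \<Longrightarrow> r \<notin> R \<or> r' \<notin> R \<Longrightarrow> (\<lambda>x x'. M (r, x) (r', x')) = (\<lambda>x x'. 0)"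
  by (intro ext) (auto simp: opers_eq_0)

lemma id_tensor_opers:
  assumes T: "T \<in> channels X Y" and M: "M \<in> opers (R \<times> X)"
  shows "id_tensor T M \<in> opers (R \<times> Y)"
proof (rule opersI)
  fix p p' assume *: "p \<notin> R \<times> Y \<or> p' \<notin> R \<times> Y"
  obtain r y r' y' where p: "p = (r, y)" "p' = (r', y')" by (cases p, cases p')
  show "id_tensor T M p p' = 0"
  proof (cases "r \<in> R \<and> r' \<in> R")
    case True
    then have "y \<notin> Y \<or> y' \<notin> Y" using * p by auto
    then show ?thesis
      using opers_eq_0[OF channel_opers[OF T block_opers[OF M]]] by (simp add: p id_tensor_def)
  next
    case False
    then have "(\<lambda>x x'. M (r, x) (r', x')) = (\<lambda>x x'. 0)" using block_zero[OF M] by blast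
    then show ?thesis by (simp add: p id_tensor_def channel_zero[OF T])
  qed
qed

lemma marginal_fst_id_tensor:
  assumes "T \<in> channels X Y" "M \<in> opers (R \<times> X)"
  shows "marginal_fst Y (id_tensor T M) = marginal_fst X M"
  using channel_trace[OF assms(1) block_opers[OF assms(2)]]
  by (simp add: marginal_fst_def id_tensor_def op_trace_def fun_eq_iff)

lemma op_trace_marginal_fst: "op_trace X (marginal_fst Y M) = op_trace (X \<times> Y) M"
  by (simp add: op_trace_def marginal_fst_def sum.cartesian_product')

lemma id_tensor_trace:
  assumes "T \<in> channels X Y" "M \<in> opers (R \<times> X)"
  shows "op_trace (R \<times> Y) (id_tensor T M) = op_trace (R \<times> X) M"
  using marginal_fst_id_tensor[OF assms] by (metis op_trace_marginal_fst)

lemma id_tensor_state: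
  assumes "T \<in> channels X Y" "M \<in> states ({..<r::nat} \<times> X)"
  shows "id_tensor T M \<in> states ({..<r} \<times> Y)"
  using assms by (auto simp: states_def id_tensor_opers channel_pos id_tensor_trace)

lemma marginal_snd_id_tensor:
  assumes "T \<in> channels X Y" "M \<in> opers (R \<times> X)" "finite R"
  shows "marginal_snd R (id_tensor T M) = T (marginal_snd R M)"
  using channel_sum[OF assms(1,3), of "\<lambda>r x x'. M (r, x) (r, x')" "\<lambda>_. 1"] block_opers[OF assms(2)]
  by (simp add: marginal_snd_def id_tensor_def)

lemma id_tensor_op_tensor:
  assumes "T \<in> channels X Y" "\<beta> \<in> opers X"
  shows "id_tensor T (op_tensor \<alpha> \<beta>) = op_tensor \<alpha> (T \<beta>)"
  by (simp add: id_tensor_def op_tensor_def fun_eq_iff channel_scale[OF assms])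

lemma channels_comp:
  assumes T: "T \<in> channels X Y" and T': "T' \<in> channels Y Z"
  shows "T' \<circ> T \<in> channels X Z"
  unfolding channels_def mem_Collect_eq
proof (intro conjI ballI allI impI)
  fix M assume M: "M \<in> opers X"
  show "(T' \<circ> T) M \<in> opers Z" using channel_opers[OF T' channel_opers[OF T M]] by simp
  show "op_trace Z ((T' \<circ> T) M) = op_trace X M"
    using channel_trace[OF T' channel_opers[OF T M]] channel_trace[OF T M] by simp
  fix N a b assume "N \<in> opers X"
  then show "(T' \<circ> T) (\<lambda>x y. a * M x y + b * N x y) = (\<lambda>x y. a * (T' \<circ> T) M x y + b * (T' \<circ> T) N x y)"
    using channel_linear[OF T M] channel_linear[OF T' channel_opers[OF T M] channel_opers[OF T]] by simp
next
  fix r M assume "M \<in> opers ({..<r::nat} \<times> X)" "op_pos ({..<r} \<times> X) M"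
  then show "op_pos ({..<r} \<times> Z) (id_tensor (T' \<circ> T) M)"
    unfolding id_tensor_comp using channel_pos[OF T'] channel_pos[OF T] id_tensor_opers[OF T] by blast
qed

lemma id_channel: "id \<in> channels X X"
  by (simp add: channels_def id_tensor_id)

lemma rel_entropy_refl: "rel_entropy X P P = 0"
  by (simp add: rel_entropy_def op_trace_def op_mult_def)

text \<open>Values known to be finite and nonnegative pass through \<open>e2ennreal\<close>
  unchanged.\<close>

lemma mutual_info_max_mixed:
  assumes fin: "finite R" "R \<noteq> {}" "finite Y" and P: "P \<in> states (R \<times> Y)"
    and marg: "marginal_fst Y P = max_mixed R"
  obtains D where "mutual_info R Y P = ereal D" "0 \<le> D"
    "D \<le> 2 * log 2 (real (card R))" "D \<le> 2 * log 2 (real (card Y))"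
proof -
  obtain D where D: "mutual_info R Y P = ereal D" "D \<le> 2 * log 2 (real (card R))"
    using mutual_info_max_mixed_le_fst[OF assms] by blast
  have "0 \<le> D"
    using D(1) fin marginal_snd_state[OF fin(1,3) P]
    by (intro rel_entropy_nonneg[OF _ P max_mixed_tensor_state[OF fin]]) (auto simp: mutual_info_def marg)
  with D mutual_info_max_mixed_le_snd[OF assms D(1)] show thesis using that by blast
qed

text \<open>If the initial mutual information vanishes, then the state is a product state and remains one;
  the supremum defining \<open>eta_MI\<close> says nothing about this case.\<close>

lemma mutual_info_channel_le:
  assumes T: "T \<in> channels X Y" and fin: "finite X" "finite Y" and c: "0 < c"
    and P: "P \<in> states ({..<c::nat} \<times> X)" and marg: "marginal_fst X P = max_mixed {..<c}"
  shows "e2ennreal (mutual_info {..<c} Y (id_tensor T P)) \<le> eta_MI X Y T * e2ennreal (mutual_info {..<c} X P)"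
proof -
  let ?R = "{..<c}" and ?P' = "id_tensor T P"
  have ne: "?R \<noteq> {}" using c by auto
  have P': "?P' \<in> states (?R \<times> Y)" by (rule id_tensor_state[OF T P])
  have marg': "marginal_fst Y ?P' = max_mixed ?R"
    using marginal_fst_id_tensor[OF T statesD(1)[OF P]] marg by simp
  obtain D where D: "mutual_info ?R X P = ereal D" "0 \<le> D"
    using mutual_info_max_mixed[OF _ ne fin(1) P marg] by auto
  obtain D' where D': "mutual_info ?R Y ?P' = ereal D'" "0 \<le> D'"
    using mutual_info_max_mixed[OF _ ne fin(2) P' marg'] by auto
  show ?thesis
  proof (cases "D = 0")
    case True
    let ?\<rho> = "marginal_snd ?R P"
    have \<rho>: "?\<rho> \<in> states X" by (rule marginal_snd_state[OF _ fin(1) P]) simp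
    have "rel_entropy (?R \<times> X) P (op_tensor (max_mixed ?R) ?\<rho>) = 0"
      using D(1) True by (simp add: mutual_info_def marg)
    then have "P = op_tensor (max_mixed ?R) ?\<rho>"
      using fin by (intro rel_entropy_eq_0_imp_eq[OF _ P max_mixed_tensor_state[OF _ ne _ \<rho>]]) auto
    then have "?P' = op_tensor (max_mixed ?R) (T ?\<rho>)"
      using id_tensor_op_tensor[OF T statesD(1)[OF \<rho>]] by metis
    also have "T ?\<rho> = marginal_snd ?R ?P'"
      using marginal_snd_id_tensor[OF T statesD(1)[OF P]] by simp
    finally have eq: "?P' = op_tensor (max_mixed ?R) (marginal_snd ?R ?P')" .
    have "mutual_info ?R Y ?P' = rel_entropy (?R \<times> Y) ?P' ?P'"
      unfolding mutual_info_def marg' by (simp only: eq[symmetric])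
    then show ?thesis by (simp add: rel_entropy_refl e2ennreal_neg)
  next
    case False
    then have pos: "0 < D" using D(2) by simp
    have "e2ennreal (mutual_info ?R Y ?P' / mutual_info ?R X P) \<le> eta_MI X Y T"
      unfolding eta_MI_def using c P pos D(1) by (intro Sup_upper) force
    then have "ennreal (D' / D) \<le> eta_MI X Y T"
      using pos by (simp add: D D')
    then have "ennreal (D' / D) * ennreal D \<le> eta_MI X Y T * ennreal D"
      by (rule mult_right_mono) simp
    moreover have "ennreal (D' / D) * ennreal D = ennreal D'"
      using pos D'(2) by (simp add: ennreal_mult[symmetric])
    ultimately show ?thesis by (simp add: D D')
  qed
qed

section \<open>Matrix units and Kraus operators\<close>

lemma op_unit_opers: "x \<in> X \<Longrightarrow> x' \<in> X \<Longrightarrow> op_unit x x' \<in> opers X"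
  by (auto simp: op_unit_def opers_def split: if_splits)

lemma opers_expand:
  assumes fin: "finite X" and M: "M \<in> opers X"
  shows "M = (\<lambda>a a'. \<Sum>p\<in>X \<times> X. M (fst p) (snd p) * op_unit (fst p) (snd p) a a')"
proof (rule opers_eqI[OF M])
  show "(\<lambda>a a'. \<Sum>p\<in>X \<times> X. M (fst p) (snd p) * op_unit (fst p) (snd p) a a') \<in> opers X"
    by (rule sum_opers) (auto intro: op_unit_opers)
  fix a a' assume a: "a \<in> X" "a' \<in> X"
  have "(\<Sum>p\<in>X \<times> X. M (fst p) (snd p) * op_unit (fst p) (snd p) a a')
      = (\<Sum>p\<in>X \<times> X. M (fst p) (snd p) * (if p = (a, a') then 1 else 0))"
    by (intro sum.cong refl) (auto simp: op_unit_def)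
  also have "\<dots> = M (fst (a, a')) (snd (a, a'))"
    using fin a by (intro sum_mult_delta(1)) auto
  finally show "M a a' = (\<Sum>p\<in>X \<times> X. M (fst p) (snd p) * op_unit (fst p) (snd p) a a')" by simp
qed

lemma channel_expand:
  assumes T: "T \<in> channels X Y" and fin: "finite X" and M: "M \<in> opers X"
  shows "T M y y' = (\<Sum>x\<in>X. \<Sum>x'\<in>X. M x x' * T (op_unit x x') y y')"
proof -
  have "T M = T (\<lambda>a a'. \<Sum>p\<in>X \<times> X. M (fst p) (snd p) * op_unit (fst p) (snd p) a a')"
    using opers_expand[OF fin M] by (rule arg_cong)
  also have "\<dots> = (\<lambda>a a'. \<Sum>p\<in>X \<times> X. M (fst p) (snd p) * T (op_unit (fst p) (snd p)) a a')"
    using fin by (intro channel_sum[OF T]) (auto intro: op_unit_opers)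
  finally show ?thesis
    by (simp add: sum.cartesian_product')
qed

text \<open>\<open>J x x' y y'\<close> is the entry at y, y' of the image of the matrix unit at x,
  x': the Choi matrix with its indices regrouped. The Kraus index set has a type of its own, so that
  tuples can serve as indices for tensor products and partial traces.\<close>

definition kraus_on :: "'x set \<Rightarrow> 'y set \<Rightarrow> ('x \<Rightarrow> 'x \<Rightarrow> 'y \<Rightarrow> 'y \<Rightarrow> complex) \<Rightarrow> 'k set \<Rightarrow>
    ('k \<Rightarrow> 'y \<Rightarrow> 'x \<Rightarrow> complex) \<Rightarrow> bool" where
  "kraus_on X Y J I K \<longleftrightarrow> (\<forall>x\<in>X. \<forall>x'\<in>X. \<forall>y\<in>Y. \<forall>y'\<in>Y. J x x' y y' = (\<Sum>k\<in>I. K k y x * cnj (K k y' x')))"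

text \<open>The Kraus operators are the scaled eigenvectors of the Choi matrix.\<close>

lemma channel_kraus:
  fixes T :: "nat oper \<Rightarrow> 'b oper"
  assumes T: "T \<in> channels {..<n} Y" and fin: "finite Y"
  shows "\<exists>K :: nat \<times> 'b \<Rightarrow> 'b \<Rightarrow> nat \<Rightarrow> complex. kraus_on {..<n} Y (\<lambda>x x'. T (op_unit x x')) ({..<n} \<times> Y) K"
proof -
  let ?X = "{..<n} \<times> Y"
  \<comment> \<open>The unnormalised maximally entangled operator. Complete positivity in
    \<open>channels\<close> is tested against references \<open>{..<r}\<close>, so the input has to
    be of the form \<open>{..<n}\<close> for its copy to act as the reference.\<close>
  define \<Omega> :: "(nat \<times> nat) oper" where
    "\<Omega> = (\<lambda>(r, x) (r', x'). if r = x \<and> r' = x' \<and> r < n \<and> r' < n then 1 else 0)"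
  have \<Omega>: "\<Omega> \<in> opers ({..<n} \<times> {..<n})"
    unfolding opers_def by (auto simp: \<Omega>_def split: if_splits)
  have "op_pos ({..<n} \<times> {..<n}) \<Omega>"
    unfolding op_pos_iff
  proof
    fix v :: "nat \<times> nat \<Rightarrow> complex"
    define h :: "nat \<times> nat \<Rightarrow> complex" where "h = (\<lambda>(r, x). v (r, x) * (if r = x then 1 else 0))"
    have h: "(\<Sum>p\<in>{..<n} \<times> {..<n}. h p) = (\<Sum>r<n. v (r, r))"
      unfolding sum.cartesian_product' h_def prod.case by (intro sum.cong refl sum_mult_delta(2)) auto
    have "form ({..<n} \<times> {..<n}) \<Omega> v
        = (\<Sum>p\<in>{..<n} \<times> {..<n}. \<Sum>p'\<in>{..<n} \<times> {..<n}. cnj (h p) * h p')"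
      unfolding form_def by (intro sum.cong refl) (auto simp: \<Omega>_def h_def)
    also have "\<dots> = cnj (\<Sum>p\<in>{..<n} \<times> {..<n}. h p) * (\<Sum>p\<in>{..<n} \<times> {..<n}. h p)"
      by (simp only: sum_product cnj_sum)
    also have "\<dots> = cnj (\<Sum>r<n. v (r, r)) * (\<Sum>r<n. v (r, r))"
      by (simp only: h)
    also have "\<dots> = of_real ((cmod (\<Sum>r<n. v (r, r)))\<^sup>2)"
      by (simp add: complex_norm_square mult.commute del: of_real_power cnj_sum)
    finally show "form ({..<n} \<times> {..<n}) \<Omega> v \<in> \<real>\<^sub>\<ge>\<^sub>0"
      by (simp only: nonneg_Reals_of_real_iff zero_le_power2)
  qed
  then have "op_pos ?X (id_tensor T \<Omega>)" "id_tensor T \<Omega> \<in> opers ?X"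
    using channel_pos[OF T \<Omega>] id_tensor_opers[OF T \<Omega>] by auto
  then obtain u l where l: "\<And>k. k \<in> ?X \<Longrightarrow> 0 \<le> l k" and eq: "id_tensor T \<Omega> = spec_op ?X u l"
    using op_pos_spec_opE[of ?X "id_tensor T \<Omega>"] fin by (metis finite_SigmaI finite_lessThan)
  have "T (op_unit x x') y y' = (\<Sum>k\<in>?X. of_real (sqrt (l k)) * u k (x, y) * cnj (of_real (sqrt (l k)) * u k (x', y')))"
    if "x < n" "x' < n" "y \<in> Y" "y' \<in> Y" for x x' y y'
  proof -
    have "op_unit x x' = (\<lambda>a a'. \<Omega> (x, a) (x', a'))"
      using that by (auto simp: op_unit_def \<Omega>_def fun_eq_iff)
    then have "T (op_unit x x') y y' = id_tensor T \<Omega> (x, y) (x', y')"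
      by (simp add: id_tensor_def)
    also have "\<dots> = (\<Sum>k\<in>?X. of_real (l k) * u k (x, y) * cnj (u k (x', y')))"
      using that by (simp add: eq spec_op_def)
    also have "\<dots> = (\<Sum>k\<in>?X. of_real (sqrt (l k) * sqrt (l k)) * u k (x, y) * cnj (u k (x', y')))"
      by (intro sum.cong refl) (simp only: real_sqrt_mult_self abs_of_nonneg l)
    also have "\<dots> = (\<Sum>k\<in>?X. of_real (sqrt (l k)) * u k (x, y) * cnj (of_real (sqrt (l k)) * u k (x', y')))"
      unfolding of_real_mult complex_cnj_mult complex_cnj_complex_of_real
      by (intro sum.cong refl) (simp only: mult_ac)
    finally show ?thesis .
  qed
  then have "kraus_on {..<n} Y (\<lambda>x x'. T (op_unit x x')) ?X (\<lambda>k y x. of_real (sqrt (l k)) * u k (x, y))"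
    by (simp add: kraus_on_def)
  then show ?thesis by blast
qed

text \<open>The form of the output at \<open>v\<close> is the sum over \<open>k\<close> of the forms
  of the input at the vectors obtained by applying the adjoint of the k-th Kraus operator to the
  second factor of \<open>v\<close>. Complete positivity can be read off.\<close>

lemma kraus_form:
  assumes fin: "finite X" "finite Y" and kraus: "kraus_on X Y J I K"
    and T: "\<And>M y y'. M \<in> opers X \<Longrightarrow> y \<in> Y \<Longrightarrow> y' \<in> Y \<Longrightarrow> T M y y' = (\<Sum>x\<in>X. \<Sum>x'\<in>X. M x x' * J x x' y y')"
    and M: "M \<in> opers (R \<times> X)"
  shows "form (R \<times> Y) (id_tensor T M) v
    = (\<Sum>k\<in>I. form (R \<times> X) M (\<lambda>(r, x). \<Sum>y\<in>Y. cnj (K k y x) * v (r, y)))"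
proof -
  define g where "g k r x = (\<Sum>y\<in>Y. cnj (K k y x) * v (r, y))" for k r x
  have cg: "cnj (g k r x) = (\<Sum>y\<in>Y. K k y x * cnj (v (r, y)))" for k r x
    by (simp add: g_def)
  have gmg: "cnj (g k r x) * m * g k r' x'
      = (\<Sum>y\<in>Y. \<Sum>y'\<in>Y. (K k y x * cnj (v (r, y))) * m * (cnj (K k y' x') * v (r', y')))" for k r x m r' x'
    unfolding cg unfolding g_def sum_distrib_right[of _ _ m] by (rule sum_product)
  have "form (R \<times> Y) (id_tensor T M) v
    = (\<Sum>r\<in>R. \<Sum>y\<in>Y. \<Sum>r'\<in>R. \<Sum>y'\<in>Y. cnj (v (r, y)) * T (\<lambda>x x'. M (r, x) (r', x')) y y' * v (r', y'))"
    by (simp add: form_def sum.cartesian_product' id_tensor_def)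
  also have "\<dots> = (\<Sum>r\<in>R. \<Sum>r'\<in>R. \<Sum>y\<in>Y. \<Sum>y'\<in>Y. cnj (v (r, y)) * T (\<lambda>x x'. M (r, x) (r', x')) y y' * v (r', y'))"
    by (intro sum.cong refl sum.swap)
  also have "\<dots> = (\<Sum>r\<in>R. \<Sum>r'\<in>R. \<Sum>k\<in>I. \<Sum>x\<in>X. \<Sum>x'\<in>X. cnj (g k r x) * M (r, x) (r', x') * g k r' x')"
  proof (intro sum.cong refl)
    fix r r'
    let ?B = "\<lambda>x x'. M (r, x) (r', x')"
    have "(\<Sum>y\<in>Y. \<Sum>y'\<in>Y. cnj (v (r, y)) * T ?B y y' * v (r', y'))
      = (\<Sum>y\<in>Y. \<Sum>y'\<in>Y. cnj (v (r, y)) * (\<Sum>x\<in>X. \<Sum>x'\<in>X. ?B x x' * (\<Sum>k\<in>I. K k y x * cnj (K k y' x'))) * v (r', y'))"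
      using kraus T[OF block_opers[OF M]] by (intro sum.cong refl) (simp add: kraus_on_def)
    also have "\<dots> = (\<Sum>y\<in>Y. \<Sum>y'\<in>Y. \<Sum>x\<in>X. \<Sum>x'\<in>X. \<Sum>k\<in>I.
        (K k y x * cnj (v (r, y))) * ?B x x' * (cnj (K k y' x') * v (r', y')))"
      unfolding sum_distrib_left sum_distrib_right by (intro sum.cong refl) (simp only: mult_ac)
    also have "\<dots> = (\<Sum>(y, y', x, x', k)\<in>Y \<times> Y \<times> X \<times> X \<times> I.
        (K k y x * cnj (v (r, y))) * ?B x x' * (cnj (K k y' x') * v (r', y')))"
      by (simp only: sum.cartesian_product)
    also have "\<dots> = (\<Sum>(k, x, x', y, y')\<in>I \<times> X \<times> X \<times> Y \<times> Y.
        (K k y x * cnj (v (r, y))) * ?B x x' * (cnj (K k y' x') * v (r', y')))"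
      by (rule sum.reindex_bij_witness[of _ "\<lambda>(k, x, x', y, y'). (y, y', x, x', k)"
            "\<lambda>(y, y', x, x', k). (k, x, x', y, y')"]) auto
    also have "\<dots> = (\<Sum>k\<in>I. \<Sum>x\<in>X. \<Sum>x'\<in>X. \<Sum>y\<in>Y. \<Sum>y'\<in>Y.
        (K k y x * cnj (v (r, y))) * ?B x x' * (cnj (K k y' x') * v (r', y')))"
      by (simp only: sum.cartesian_product)
    also have "\<dots> = (\<Sum>k\<in>I. \<Sum>x\<in>X. \<Sum>x'\<in>X. cnj (g k r x) * ?B x x' * g k r' x')"
      by (simp only: gmg)
    finally show "(\<Sum>y\<in>Y. \<Sum>y'\<in>Y. cnj (v (r, y)) * T ?B y y' * v (r', y'))
      = (\<Sum>k\<in>I. \<Sum>x\<in>X. \<Sum>x'\<in>X. cnj (g k r x) * ?B x x' * g k r' x')" .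
  qed
  also have "\<dots> = (\<Sum>(r, r', k, x, x')\<in>R \<times> R \<times> I \<times> X \<times> X. cnj (g k r x) * M (r, x) (r', x') * g k r' x')"
    by (simp only: sum.cartesian_product)
  also have "\<dots> = (\<Sum>(k, r, x, r', x')\<in>I \<times> R \<times> X \<times> R \<times> X. cnj (g k r x) * M (r, x) (r', x') * g k r' x')"
    by (rule sum.reindex_bij_witness[of _ "\<lambda>(k, r, x, r', x'). (r, r', k, x, x')"
            "\<lambda>(r, r', k, x, x'). (k, r, x, r', x')"]) auto
  also have "\<dots> = (\<Sum>k\<in>I. \<Sum>r\<in>R. \<Sum>x\<in>X. \<Sum>r'\<in>R. \<Sum>x'\<in>X. cnj (g k r x) * M (r, x) (r', x') * g k r' x')"
    by (simp only: sum.cartesian_product)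
  also have "\<dots> = (\<Sum>k\<in>I. form (R \<times> X) M (\<lambda>(r, x). g k r x))"
    by (simp add: form_def sum.cartesian_product')
  finally show ?thesis by (simp only: g_def)
qed

text \<open>The converse of the Kraus decomposition, with trace preservation expressed on matrix
  units. Tensor products, partial traces and a constant channel are all recognised as channels
  through it.\<close>

lemma kraus_channel:
  assumes fin: "finite X" "finite Y" and kraus: "kraus_on X Y J I K"
    and tp: "\<And>x x'. x \<in> X \<Longrightarrow> x' \<in> X \<Longrightarrow> (\<Sum>y\<in>Y. J x x' y y) = (if x = x' then 1 else 0)"
    and T: "\<And>M y y'. M \<in> opers X \<Longrightarrow> y \<in> Y \<Longrightarrow> y' \<in> Y \<Longrightarrow> T M y y' = (\<Sum>x\<in>X. \<Sum>x'\<in>X. M x x' * J x x' y y')"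
    and T0: "\<And>M. T M \<in> opers Y"
  shows "T \<in> channels X Y"
  unfolding channels_def mem_Collect_eq
proof (intro conjI ballI allI impI)
  fix M assume M: "M \<in> opers X"
  show "T M \<in> opers Y" by (rule T0)
  have "op_trace Y (T M) = (\<Sum>y\<in>Y. \<Sum>x\<in>X. \<Sum>x'\<in>X. M x x' * J x x' y y)"
    by (simp add: op_trace_def T[OF M])
  also have "\<dots> = (\<Sum>x\<in>X. \<Sum>y\<in>Y. \<Sum>x'\<in>X. M x x' * J x x' y y)"
    by (rule sum.swap)
  also have "\<dots> = (\<Sum>x\<in>X. \<Sum>x'\<in>X. M x x' * (\<Sum>y\<in>Y. J x x' y y))"
    unfolding sum_distrib_left by (intro sum.cong refl sum.swap)
  also have "\<dots> = op_trace X M"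
    using fin by (simp add: tp op_trace_def cong: sum.cong)
  finally show "op_trace Y (T M) = op_trace X M" .
  fix N a b assume N: "N \<in> opers X"
  show "T (\<lambda>x y. a * M x y + b * N x y) = (\<lambda>x y. a * T M x y + b * T N x y)"
  proof (rule opers_eqI[OF T0 linear_opers[OF T0 T0]])
    fix y y' assume y: "y \<in> Y" "y' \<in> Y"
    show "T (\<lambda>x y. a * M x y + b * N x y) y y' = a * T M y y' + b * T N y y'"
      by (simp add: T[OF linear_opers[OF M N] y] T[OF M y] T[OF N y] sum_distrib_left sum.distrib algebra_simps)
  qed
next
  fix r M assume M: "M \<in> opers ({..<r::nat} \<times> X)" "op_pos ({..<r} \<times> X) M"
  show "op_pos ({..<r} \<times> Y) (id_tensor T M)"
    unfolding op_pos_iff using M(2)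
    by (auto simp: kraus_form[OF fin kraus T M(1)] op_pos_iff complex_nonneg_Reals_iff
        intro!: sum_nonneg sum.neutral)
qed

section \<open>Tensor products of channels\<close>

lemma prod_if_eq:
  assumes "finite S" "x \<in> PiE S X" "x' \<in> PiE S X'"
  shows "(\<Prod>j\<in>S. if x j = x' j then 1 else 0) = (if x = x' then 1 else (0::complex))"
proof (cases "x = x'")
  case False
  then obtain j where "j \<in> S" "x j \<noteq> x' j"
    using extensionalityI[of x S x'] assms(2,3) by (auto simp: PiE_def)
  then have "\<exists>j\<in>S. (if x j = x' j then 1 else (0::complex)) = 0" by auto
  then have "(\<Prod>j\<in>S. if x j = x' j then 1 else (0::complex)) = 0"
    by (rule prod_zero[OF assms(1)])
  with False show ?thesis by simp
qed simp

lemma tensor_channel_opers: "tensor_channel S X Y T M \<in> opers (PiE S Y)"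
  by (rule opersI) (auto simp: tensor_channel_def)

text \<open>The Kraus operators are the products of those of the factors, indexed by tuples
  \<open>\<kappa>\<close>. Exchanging products of sums with sums over tuples gives the Kraus form as
  well as the trace condition, whose factors are Kronecker deltas.\<close>

lemma tensor_channel_channel:
  fixes n :: "'j \<Rightarrow> nat"
  assumes S: "finite S" and Y: "\<And>j. j \<in> S \<Longrightarrow> finite (Y j)"
    and T: "\<And>j. j \<in> S \<Longrightarrow> T j \<in> channels {..<n j} (Y j)"
  shows "tensor_channel S (\<lambda>j. {..<n j}) Y T \<in> channels (PiE S (\<lambda>j. {..<n j})) (PiE S Y)"
proof -
  let ?X = "\<lambda>j. {..<n j}"
  obtain K where K: "\<And>j. j \<in> S \<Longrightarrow> kraus_on (?X j) (Y j) (\<lambda>x x'. T j (op_unit x x')) (?X j \<times> Y j) (K j)"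
    using channel_kraus[OF T Y] by metis
  define J where "J = (\<lambda>x x' y y'. \<Prod>j\<in>S. T j (op_unit (x j) (x' j)) (y j) (y' j))"
  have kraus: "kraus_on (PiE S ?X) (PiE S Y) J (PiE S (\<lambda>j. ?X j \<times> Y j)) (\<lambda>\<kappa> y x. \<Prod>j\<in>S. K j (\<kappa> j) (y j) (x j))"
    unfolding kraus_on_def
  proof (intro ballI)
    fix x x' y y' assume *: "x \<in> PiE S ?X" "x' \<in> PiE S ?X" "y \<in> PiE S Y" "y' \<in> PiE S Y"
    have "J x x' y y' = (\<Prod>j\<in>S. \<Sum>k\<in>?X j \<times> Y j. K j k (y j) (x j) * cnj (K j k (y' j) (x' j)))"
      unfolding J_def
    proof (intro prod.cong refl)
      fix j assume j: "j \<in> S"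
      then have "x j \<in> ?X j" "x' j \<in> ?X j" "y j \<in> Y j" "y' j \<in> Y j" using * by auto
      then show "T j (op_unit (x j) (x' j)) (y j) (y' j)
          = (\<Sum>k\<in>?X j \<times> Y j. K j k (y j) (x j) * cnj (K j k (y' j) (x' j)))"
        using K[OF j] unfolding kraus_on_def by blast
    qed
    also have "\<dots> = (\<Sum>\<kappa>\<in>PiE S (\<lambda>j. ?X j \<times> Y j). \<Prod>j\<in>S. K j (\<kappa> j) (y j) (x j) * cnj (K j (\<kappa> j) (y' j) (x' j)))"
      using S Y by (intro prod_sum_PiE) auto
    also have "\<dots> = (\<Sum>\<kappa>\<in>PiE S (\<lambda>j. ?X j \<times> Y j).
        (\<Prod>j\<in>S. K j (\<kappa> j) (y j) (x j)) * cnj (\<Prod>j\<in>S. K j (\<kappa> j) (y' j) (x' j)))"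
      by (simp only: prod.distrib cnj_prod)
    finally show "J x x' y y' = \<dots>" .
  qed
  show ?thesis
  proof (rule kraus_channel[OF _ _ kraus])
    show "finite (PiE S ?X)" "finite (PiE S Y)"
      using S Y by (auto intro: finite_PiE)
    fix x x' assume *: "x \<in> PiE S ?X" "x' \<in> PiE S ?X"
    have "(\<Sum>y\<in>PiE S Y. J x x' y y) = (\<Prod>j\<in>S. \<Sum>y\<in>Y j. T j (op_unit (x j) (x' j)) y y)"
      unfolding J_def using S Y by (intro prod_sum_PiE[symmetric]) auto
    also have "\<dots> = (\<Prod>j\<in>S. if x j = x' j then 1 else 0)"
    proof (intro prod.cong refl)
      fix j assume j: "j \<in> S"
      then have x: "x j \<in> ?X j" "x' j \<in> ?X j" using * by auto
      have "(\<Sum>y\<in>Y j. T j (op_unit (x j) (x' j)) y y) = op_trace (?X j) (op_unit (x j) (x' j))"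
        using channel_trace[OF T[OF j] op_unit_opers[OF x]] by (simp add: op_trace_def)
      also have "\<dots> = (\<Sum>a\<in>?X j. (if a = x' j then 1 else 0) * (if a = x j then 1 else 0))"
        unfolding op_trace_def op_unit_def by (intro sum.cong refl) auto
      also have "\<dots> = (if x j = x' j then 1 else 0)"
        using x by (intro sum_mult_delta(1)) auto
      finally show "(\<Sum>y\<in>Y j. T j (op_unit (x j) (x' j)) y y) = (if x j = x' j then 1 else 0)" .
    qed
    also have "\<dots> = (if x = x' then 1 else 0)"
      by (rule prod_if_eq[OF S *])
    finally show "(\<Sum>y\<in>PiE S Y. J x x' y y) = (if x = x' then 1 else 0)" .
  next
    fix M y y' assume "y \<in> PiE S Y" "y' \<in> PiE S Y"
    then show "tensor_channel S ?X Y T M y y' = (\<Sum>x\<in>PiE S ?X. \<Sum>x'\<in>PiE S ?X. M x x' * J x x' y y')"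
      by (simp add: tensor_channel_def J_def)
  qed (rule tensor_channel_opers)
qed

text \<open>In each factor \<open>channel_expand\<close> inserts the matrix units of the middle
  system; the product of these double sums over \<open>j\<close> is a double sum over tuples in
  \<open>PiE S Y\<close>.\<close>

lemma tensor_channel_comp:
  assumes S: "finite S" and X: "\<And>j. j \<in> S \<Longrightarrow> finite (X j)" and Y: "\<And>j. j \<in> S \<Longrightarrow> finite (Y j)"
    and T: "\<And>j. j \<in> S \<Longrightarrow> T j \<in> channels (X j) (Y j)" and T': "\<And>j. j \<in> S \<Longrightarrow> T' j \<in> channels (Y j) (Z j)"
  shows "tensor_channel S Y Z T' (tensor_channel S X Y T M) = tensor_channel S X Z (\<lambda>j. T' j \<circ> T j) M"
proof (rule opers_eqI[OF tensor_channel_opers tensor_channel_opers])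
  fix z z' assume z: "z \<in> PiE S Z" "z' \<in> PiE S Z"
  let ?J = "\<lambda>x x' y y'. \<Prod>j\<in>S. T j (op_unit (x j) (x' j)) (y j) (y' j)"
  let ?J' = "\<lambda>y y'. \<Prod>j\<in>S. T' j (op_unit (y j) (y' j)) (z j) (z' j)"
  have comp: "(\<Prod>j\<in>S. (T' j \<circ> T j) (op_unit (x j) (x' j)) (z j) (z' j))
      = (\<Sum>y\<in>PiE S Y. \<Sum>y'\<in>PiE S Y. ?J x x' y y' * ?J' y y')"
    if x: "x \<in> PiE S X" "x' \<in> PiE S X" for x x'
  proof -
    have "(\<Prod>j\<in>S. (T' j \<circ> T j) (op_unit (x j) (x' j)) (z j) (z' j))
      = (\<Prod>j\<in>S. \<Sum>a\<in>Y j. \<Sum>a'\<in>Y j. T j (op_unit (x j) (x' j)) a a' * T' j (op_unit a a') (z j) (z' j))"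
    proof (intro prod.cong refl)
      fix j assume j: "j \<in> S"
      then have "x j \<in> X j" "x' j \<in> X j" using x by auto
      then show "(T' j \<circ> T j) (op_unit (x j) (x' j)) (z j) (z' j)
        = (\<Sum>a\<in>Y j. \<Sum>a'\<in>Y j. T j (op_unit (x j) (x' j)) a a' * T' j (op_unit a a') (z j) (z' j))"
        unfolding o_apply by (intro channel_expand[OF T'[OF j] Y[OF j]] channel_opers[OF T[OF j]] op_unit_opers)
    qed
    also have "\<dots> = (\<Sum>y\<in>PiE S Y. \<Prod>j\<in>S. \<Sum>a'\<in>Y j. T j (op_unit (x j) (x' j)) (y j) a' * T' j (op_unit (y j) a') (z j) (z' j))"
      using S Y by (intro prod_sum_PiE) auto
    also have "\<dots> = (\<Sum>y\<in>PiE S Y. \<Sum>y'\<in>PiE S Y. \<Prod>j\<in>S.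
        T j (op_unit (x j) (x' j)) (y j) (y' j) * T' j (op_unit (y j) (y' j)) (z j) (z' j))"
      using S Y by (intro sum.cong refl prod_sum_PiE) auto
    finally show ?thesis by (simp only: prod.distrib)
  qed
  have "tensor_channel S Y Z T' (tensor_channel S X Y T M) z z'
    = (\<Sum>y\<in>PiE S Y. \<Sum>y'\<in>PiE S Y. (\<Sum>x\<in>PiE S X. \<Sum>x'\<in>PiE S X. M x x' * ?J x x' y y') * ?J' y y')"
    using z by (simp add: tensor_channel_def)
  also have "\<dots> = (\<Sum>(y, y', x, x')\<in>PiE S Y \<times> PiE S Y \<times> PiE S X \<times> PiE S X. M x x' * ?J x x' y y' * ?J' y y')"
    unfolding sum_distrib_right by (simp only: sum.cartesian_product)
  also have "\<dots> = (\<Sum>(x, x', y, y')\<in>PiE S X \<times> PiE S X \<times> PiE S Y \<times> PiE S Y. M x x' * ?J x x' y y' * ?J' y y')"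
    by (rule sum.reindex_bij_witness[of _ "\<lambda>(x, x', y, y'). (y, y', x, x')" "\<lambda>(y, y', x, x'). (x, x', y, y')"]) auto
  also have "\<dots> = (\<Sum>x\<in>PiE S X. \<Sum>x'\<in>PiE S X. M x x' * (\<Sum>y\<in>PiE S Y. \<Sum>y'\<in>PiE S Y. ?J x x' y y' * ?J' y y'))"
    unfolding sum_distrib_left by (simp only: sum.cartesian_product mult.assoc)
  also have "\<dots> = tensor_channel S X Z (\<lambda>j. T' j \<circ> T j) M z z'"
    using z by (simp add: tensor_channel_def comp[symmetric])
  finally show "tensor_channel S Y Z T' (tensor_channel S X Y T M) z z'
    = tensor_channel S X Z (\<lambda>j. T' j \<circ> T j) M z z'" .
qed

lemma tensor_channel_id:
  assumes S: "finite S" and X: "\<And>j. j \<in> S \<Longrightarrow> finite (X j)" and M: "M \<in> opers (PiE S X)"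
  shows "tensor_channel S X X (\<lambda>j. id) M = M"
proof (rule opers_eqI[OF tensor_channel_opers M])
  fix y y' assume y: "y \<in> PiE S X" "y' \<in> PiE S X"
  have fin: "finite (PiE S X)" using S X by (rule finite_PiE)
  have "tensor_channel S X X (\<lambda>j. id) M y y'
    = (\<Sum>x\<in>PiE S X. \<Sum>x'\<in>PiE S X. (M x x' * (if y = x then 1 else 0)) * (if y' = x' then 1 else 0))"
    unfolding tensor_channel_def if_P[OF conjI[OF y]]
  proof (intro sum.cong refl)
    fix x x' assume x: "x \<in> PiE S X" "x' \<in> PiE S X"
    have "(\<Prod>j\<in>S. id (op_unit (x j) (x' j)) (y j) (y' j))
      = (\<Prod>j\<in>S. (if y j = x j then 1 else 0) * (if y' j = x' j then 1 else 0))"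
      by (intro prod.cong refl) (simp add: op_unit_def)
    then show "M x x' * (\<Prod>j\<in>S. id (op_unit (x j) (x' j)) (y j) (y' j))
      = (M x x' * (if y = x then 1 else 0)) * (if y' = x' then 1 else 0)"
      by (simp only: prod.distrib prod_if_eq[OF S y(1) x(1)] prod_if_eq[OF S y(2) x(2)] mult.assoc)
  qed
  also have "\<dots> = (\<Sum>x\<in>PiE S X. M x y' * (if y = x then 1 else 0))"
    by (intro sum.cong refl sum_mult_delta(2)[OF fin y(2)])
  also have "\<dots> = M y y'"
    by (rule sum_mult_delta(2)[OF fin y(1)])
  finally show "tensor_channel S X X (\<lambda>j. id) M y y' = M y y'" .
qed

section \<open>Partial traces\<close>

lemma sum_PiE_split:
  assumes SJ: "S \<subseteq> J"
  shows "(\<Sum>x\<in>PiE J X. f x) = (\<Sum>y\<in>PiE S X. \<Sum>z\<in>PiE (J - S) X. f (override_on z y S))"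
proof -
  have "(\<Sum>x\<in>PiE J X. f x) = (\<Sum>(y, z)\<in>PiE S X \<times> PiE (J - S) X. f (override_on z y S))"
  \<comment> \<open>A tuple on \<open>J\<close> is cut into its restrictions to \<open>S\<close> and
    \<open>J - S\<close>; \<open>override_on z y S\<close> glues them, with \<open>y\<close> on
    \<open>S\<close> and \<open>z\<close> elsewhere, as in \<open>trace_out\<close>.\<close>
  proof (rule sum.reindex_bij_witness[of _ "\<lambda>(y, z). override_on z y S" "\<lambda>x. (restrict x S, restrict x (J - S))"])
    fix x assume x: "x \<in> PiE J X"
    show eq: "(case (restrict x S, restrict x (J - S)) of (y, z) \<Rightarrow> override_on z y S) = x"
      using x SJ by (auto simp: override_on_def fun_eq_iff PiE_def extensional_def)
    show "(restrict x S, restrict x (J - S)) \<in> PiE S X \<times> PiE (J - S) X"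
      using x SJ by auto
    show "(case (restrict x S, restrict x (J - S)) of (y, z) \<Rightarrow> f (override_on z y S)) = f x"
      using eq by simp
  next
    fix p assume "p \<in> PiE S X \<times> PiE (J - S) X"
    then obtain y z where p: "p = (y, z)" "y \<in> PiE S X" "z \<in> PiE (J - S) X" by auto
    have "restrict (override_on z y S) S = y" "restrict (override_on z y S) (J - S) = z"
      using p by (auto simp: override_on_def fun_eq_iff PiE_def extensional_def restrict_def)
    then show "(restrict (case p of (y, z) \<Rightarrow> override_on z y S) S, restrict (case p of (y, z) \<Rightarrow> override_on z y S) (J - S)) = p"
      by (simp add: p)
    show "(case p of (y, z) \<Rightarrow> override_on z y S) \<in> PiE J X"
      using p SJ by (auto simp: override_on_def PiE_def extensional_def Pi_def)
  qed
  then show ?thesis by (simp only: sum.cartesian_product)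
qed

lemma override_on_PiE:
  "S \<subseteq> J \<Longrightarrow> y \<in> PiE S X \<Longrightarrow> z \<in> PiE (J - S) X \<Longrightarrow> override_on z y S \<in> PiE J X"
  by (auto simp: override_on_def PiE_def extensional_def Pi_def)

lemma trace_out_opers: "trace_out J S Y M \<in> opers (PiE S Y)"
  by (rule opersI) (auto simp: trace_out_def)

text \<open>The Kraus operators are 1 \<otimes> <z|, one for each basis tuple \<open>z\<close> of
  the discarded systems. Summing over \<open>y\<close> and \<open>z\<close> amounts to summing over
  all tuples on \<open>J\<close>, which gives trace preservation.\<close>

lemma trace_out_channel:
  assumes SJ: "S \<subseteq> J" and J: "finite J" and X: "\<And>j. j \<in> J \<Longrightarrow> finite (X j)"
  shows "trace_out J S X \<in> channels (PiE J X) (PiE S X)"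
proof -
  define K :: "('a \<Rightarrow> 'b) \<Rightarrow> ('a \<Rightarrow> 'b) \<Rightarrow> ('a \<Rightarrow> 'b) \<Rightarrow> complex"
    where "K = (\<lambda>z y x. if x = override_on z y S then 1 else 0)"
  define G where "G = (\<lambda>x x' y y'. \<Sum>z\<in>PiE (J - S) X. K z y x * cnj (K z y' x'))"
  have kraus: "kraus_on (PiE J X) (PiE S X) G (PiE (J - S) X) K"
    by (simp add: kraus_on_def G_def)
  have finJ: "finite (PiE J X)" using J X by (rule finite_PiE)
  show ?thesis
  proof (rule kraus_channel[OF finJ _ kraus])
    show "finite (PiE S X)" using SJ J X by (auto intro!: finite_PiE dest: finite_subset)
    fix x x' assume x: "x \<in> PiE J X" "x' \<in> PiE J X"
    have "(\<Sum>y\<in>PiE S X. G x x' y y)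
      = (\<Sum>y\<in>PiE S X. \<Sum>z\<in>PiE (J - S) X. (if x' = override_on z y S then 1 else 0) * (if x = override_on z y S then 1 else 0))"
      unfolding G_def K_def by (intro sum.cong refl) auto
    also have "\<dots> = (\<Sum>a\<in>PiE J X. (if x' = a then 1 else 0) * (if x = a then 1 else 0))"
      by (rule sum_PiE_split[OF SJ, symmetric])
    also have "\<dots> = (if x' = x then 1 else 0)"
      by (rule sum_mult_delta(2)[OF finJ x(1)])
    finally show "(\<Sum>y\<in>PiE S X. G x x' y y) = (if x = x' then 1 else 0)" by auto
  next
    fix M y y' assume y: "y \<in> PiE S X" "y' \<in> PiE S X"
    have "(\<Sum>x\<in>PiE J X. \<Sum>x'\<in>PiE J X. M x x' * G x x' y y')
      = (\<Sum>x\<in>PiE J X. \<Sum>x'\<in>PiE J X. \<Sum>z\<in>PiE (J - S) X. M x x' * (if x = override_on z y S then 1 else 0) * (if x' = override_on z y' S then 1 else 0))"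
      unfolding G_def K_def sum_distrib_left by (intro sum.cong refl) auto
    also have "\<dots> = (\<Sum>x\<in>PiE J X. \<Sum>z\<in>PiE (J - S) X. \<Sum>x'\<in>PiE J X. M x x' * (if x = override_on z y S then 1 else 0) * (if x' = override_on z y' S then 1 else 0))"
      by (intro sum.cong refl sum.swap)
    also have "\<dots> = (\<Sum>x\<in>PiE J X. \<Sum>z\<in>PiE (J - S) X. M x (override_on z y' S) * (if x = override_on z y S then 1 else 0))"
      by (intro sum.cong refl sum_mult_delta(1)[OF finJ] override_on_PiE[OF SJ y(2)])
    also have "\<dots> = (\<Sum>z\<in>PiE (J - S) X. \<Sum>x\<in>PiE J X. M x (override_on z y' S) * (if x = override_on z y S then 1 else 0))"
      by (rule sum.swap)
    also have "\<dots> = (\<Sum>z\<in>PiE (J - S) X. M (override_on z y S) (override_on z y' S))"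
      by (intro sum.cong refl sum_mult_delta(1)[OF finJ] override_on_PiE[OF SJ y(1)])
    finally show "trace_out J S X M y y' = (\<Sum>x\<in>PiE J X. \<Sum>x'\<in>PiE J X. M x x' * G x x' y y')"
      using y by (simp add: trace_out_def)
  qed (rule trace_out_opers)
qed

text \<open>Noise on discarded systems is invisible. The product over \<open>J\<close> splits into a
  part on \<open>S\<close> and a part on \<open>J - S\<close>; summed over the diagonal of the
  outputs, the latter is a product of traces of matrix units, that is, a Kronecker delta of the
  inputs.\<close>

lemma trace_out_tensor_channel:
  assumes SJ: "S \<subseteq> J" and J: "finite J" and X: "\<And>j. j \<in> J \<Longrightarrow> finite (X j)" and Y: "\<And>j. j \<in> J \<Longrightarrow> finite (Y j)"
    and T: "\<And>j. j \<in> J \<Longrightarrow> T j \<in> channels (X j) (Y j)"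
  shows "trace_out J S Y (tensor_channel J X Y T M) = tensor_channel S X Y T (trace_out J S X M)"
proof (rule opers_eqI[OF trace_out_opers tensor_channel_opers])
  fix y y' assume y: "y \<in> PiE S Y" "y' \<in> PiE S Y"
  let ?R = "J - S"
  have fS: "finite S" "finite ?R" using SJ J by (auto dest: finite_subset)
  have finR: "finite (PiE ?R X)" using J X by (intro finite_PiE) auto
  define A where "A x x' = (\<Prod>j\<in>S. T j (op_unit (x j) (x' j)) (y j) (y' j))" for x x'
  define C where "C x x' = (\<Sum>z\<in>PiE ?R Y. \<Prod>j\<in>?R. T j (op_unit (x j) (x' j)) (z j) (z j))" for x x'
  have A: "A (override_on c a S) (override_on c' a' S) = A a a'" for a a' c c'
    unfolding A_def by (intro prod.cong refl) (simp add: override_on_def)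
  have C: "C (override_on c a S) (override_on c' a' S) = (if c = c' then 1 else 0)"
    if c: "c \<in> PiE ?R X" "c' \<in> PiE ?R X" for a a' c c'
  proof -
    have "C (override_on c a S) (override_on c' a' S) = C c c'"
      unfolding C_def by (intro sum.cong prod.cong refl) (simp add: override_on_def)
    also have "\<dots> = (\<Prod>j\<in>?R. \<Sum>b\<in>Y j. T j (op_unit (c j) (c' j)) b b)"
      unfolding C_def using fS Y by (intro prod_sum_PiE[symmetric]) auto
    also have "\<dots> = (\<Prod>j\<in>?R. if c j = c' j then 1 else 0)"
    proof (intro prod.cong refl)
      fix j assume j: "j \<in> ?R"
      then have cj: "c j \<in> X j" "c' j \<in> X j" and jJ: "j \<in> J" using c by auto
      have "(\<Sum>b\<in>Y j. T j (op_unit (c j) (c' j)) b b) = op_trace (X j) (op_unit (c j) (c' j))"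
        using channel_trace[OF T[OF jJ] op_unit_opers[OF cj]] by (simp add: op_trace_def)
      also have "\<dots> = (\<Sum>a\<in>X j. (if a = c' j then 1 else 0) * (if a = c j then 1 else 0))"
        unfolding op_trace_def op_unit_def by (intro sum.cong refl) auto
      also have "\<dots> = (if c j = c' j then 1 else 0)"
        using X[OF jJ] cj by (intro sum_mult_delta(1)) auto
      finally show "(\<Sum>b\<in>Y j. T j (op_unit (c j) (c' j)) b b) = (if c j = c' j then 1 else 0)" .
    qed
    also have "\<dots> = (if c = c' then 1 else 0)" by (rule prod_if_eq[OF fS(2) c])
    finally show ?thesis .
  qed
  have split: "(\<Prod>j\<in>J. T j (op_unit (x j) (x' j)) (override_on z y S j) (override_on z y' S j))
      = A x x' * (\<Prod>j\<in>?R. T j (op_unit (x j) (x' j)) (z j) (z j))" for x x' z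
  proof -
    have "(\<Prod>j\<in>J. T j (op_unit (x j) (x' j)) (override_on z y S j) (override_on z y' S j))
      = (\<Prod>j\<in>?R. T j (op_unit (x j) (x' j)) (override_on z y S j) (override_on z y' S j))
      * (\<Prod>j\<in>S. T j (op_unit (x j) (x' j)) (override_on z y S j) (override_on z y' S j))"
      by (rule prod.subset_diff[OF SJ J])
    also have "\<dots> = (\<Prod>j\<in>?R. T j (op_unit (x j) (x' j)) (z j) (z j)) * A x x'"
      unfolding A_def by (intro arg_cong2[where f = times] prod.cong refl) (simp_all add: override_on_def)
    finally show ?thesis by (simp only: mult.commute)
  qed
  have "trace_out J S Y (tensor_channel J X Y T M) y y'
    = (\<Sum>z\<in>PiE ?R Y. \<Sum>x\<in>PiE J X. \<Sum>x'\<in>PiE J X. M x x' * (A x x' * (\<Prod>j\<in>?R. T j (op_unit (x j) (x' j)) (z j) (z j))))"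
    unfolding trace_out_def if_P[OF conjI[OF y]]
    using y by (intro sum.cong refl) (simp add: tensor_channel_def override_on_PiE[OF SJ] split)
  also have "\<dots> = (\<Sum>x\<in>PiE J X. \<Sum>z\<in>PiE ?R Y. \<Sum>x'\<in>PiE J X. M x x' * (A x x' * (\<Prod>j\<in>?R. T j (op_unit (x j) (x' j)) (z j) (z j))))"
    by (rule sum.swap)
  also have "\<dots> = (\<Sum>x\<in>PiE J X. \<Sum>x'\<in>PiE J X. M x x' * (A x x' * C x x'))"
    unfolding C_def sum_distrib_left by (intro sum.cong refl sum.swap)
  also have "\<dots> = (\<Sum>a\<in>PiE S X. \<Sum>c\<in>PiE ?R X. \<Sum>a'\<in>PiE S X. \<Sum>c'\<in>PiE ?R X.
      (M (override_on c a S) (override_on c' a' S) * A a a') * (if c = c' then 1 else 0))"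
    unfolding sum_PiE_split[OF SJ]
    by (intro sum.cong refl) (simp only: A C mult.assoc)
  also have "\<dots> = (\<Sum>a\<in>PiE S X. \<Sum>c\<in>PiE ?R X. \<Sum>a'\<in>PiE S X. M (override_on c a S) (override_on c a' S) * A a a')"
    by (intro sum.cong refl sum_mult_delta(2)[OF finR])
  also have "\<dots> = (\<Sum>a\<in>PiE S X. \<Sum>a'\<in>PiE S X. \<Sum>c\<in>PiE ?R X. M (override_on c a S) (override_on c a' S) * A a a')"
    by (intro sum.cong refl sum.swap)
  also have "\<dots> = tensor_channel S X Y T (trace_out J S X M) y y'"
    using y by (simp add: tensor_channel_def trace_out_def A_def sum_distrib_right)
  finally show "trace_out J S Y (tensor_channel J X Y T M) y y' = tensor_channel S X Y T (trace_out J S X M) y y'" .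
qed

subsection \<open>Fidelity with the maximally entangled state\<close>

definition pure_state :: "('a \<Rightarrow> complex) \<Rightarrow> 'a oper" where
  "pure_state \<phi> = (\<lambda>x y. \<phi> x * cnj (\<phi> y))"

lemma op_mult_assoc: "op_mult X (op_mult X A B) C = op_mult X A (op_mult X B C)"
proof (intro ext)
  fix x y
  have "op_mult X (op_mult X A B) C x y = (\<Sum>z\<in>X. \<Sum>w\<in>X. A x w * (B w z * C z y))"
    by (simp add: op_mult_def sum_distrib_right mult.assoc)
  also have "\<dots> = op_mult X A (op_mult X B C) x y"
    by (subst sum.swap) (simp add: op_mult_def sum_distrib_left)
  finally show "op_mult X (op_mult X A B) C x y = op_mult X A (op_mult X B C) x y" .
qed

lemma form_pure_state: "form X (pure_state \<phi>) v = of_real (overlap X \<phi> v)"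
proof -
  have "form X (pure_state \<phi>) v = (\<Sum>x\<in>X. \<Sum>y\<in>X. (cnj (v x) * \<phi> x) * (cnj (\<phi> y) * v y))"
    unfolding form_def pure_state_def by (intro sum.cong refl) (simp only: mult_ac)
  also have "\<dots> = inner_on X v \<phi> * inner_on X \<phi> v"
    by (simp only: inner_on_def sum_product)
  finally show ?thesis by (simp add: of_real_overlap mult.commute)
qed

lemma op_trace_pure_state: "op_trace X (pure_state \<phi>) = inner_on X \<phi> \<phi>"
  by (simp add: op_trace_def pure_state_def inner_on_def mult.commute)

lemma pure_state_state:
  assumes "inner_on X \<phi> \<phi> = 1" "\<And>x. x \<notin> X \<Longrightarrow> \<phi> x = 0"
  shows "pure_state \<phi> \<in> states X"
  unfolding states_def
proof (intro CollectI conjI)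
  show "pure_state \<phi> \<in> opers X"
    using assms(2) by (intro opersI) (auto simp: pure_state_def)
  show "op_pos X (pure_state \<phi>)"
    unfolding op_pos_iff form_pure_state by (simp only: nonneg_Reals_of_real_iff overlap_nonneg simp_thms)
qed (simp add: op_trace_pure_state assms(1))

lemma op_mult_pure_state:
  "op_mult X (pure_state \<phi>) (op_mult X M (pure_state \<phi>)) = (\<lambda>x y. form X M \<phi> * pure_state \<phi> x y)"
proof (intro ext)
  fix x y
  have "op_mult X (pure_state \<phi>) (op_mult X M (pure_state \<phi>)) x y
      = (\<Sum>z\<in>X. \<Sum>w\<in>X. cnj (\<phi> z) * M z w * \<phi> w * pure_state \<phi> x y)"
    unfolding op_mult_def sum_distrib_left pure_state_def
    by (intro sum.cong refl) (simp only: mult_ac)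
  then show "op_mult X (pure_state \<phi>) (op_mult X M (pure_state \<phi>)) x y = form X M \<phi> * pure_state \<phi> x y"
    by (simp only: form_def sum_distrib_right)
qed

lemma pure_state_idem:
  assumes "inner_on X \<phi> \<phi> = 1"
  shows "op_mult X (pure_state \<phi>) (pure_state \<phi>) = pure_state \<phi>"
proof (intro ext)
  fix x y
  have "op_mult X (pure_state \<phi>) (pure_state \<phi>) x y = (\<Sum>z\<in>X. cnj (\<phi> z) * \<phi> z * pure_state \<phi> x y)"
    unfolding op_mult_def pure_state_def by (intro sum.cong refl) (simp only: mult_ac)
  also have "\<dots> = inner_on X \<phi> \<phi> * pure_state \<phi> x y"
    by (simp only: inner_on_def sum_distrib_right)
  finally show "op_mult X (pure_state \<phi>) (pure_state \<phi>) x y = pure_state \<phi> x y"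
    by (simp add: assms)
qed

lemma op_adjoint_eq:
  assumes "M \<in> opers X" "hermitian_on X M"
  shows "op_adjoint M = M"
proof (intro ext)
  fix x y
  show "op_adjoint M x y = M x y"
  proof (cases "x \<in> X \<and> y \<in> X")
    case True
    then show ?thesis by (simp add: op_adjoint_def hermitian_on_cnj[OF assms(2)])
  next
    case False
    then have "M x y = 0" "M y x = 0" using opers_eq_0[OF assms(1)] by blast+
    then show ?thesis by (simp add: op_adjoint_def)
  qed
qed

lemma op_adjoint_mult: "op_adjoint (op_mult X A B) = op_mult X (op_adjoint B) (op_adjoint A)"
  by (simp add: op_adjoint_def op_mult_def mult.commute)

text \<open>The projection \<Phi> is its own square root, so the trace norm concerns the root of
  \<Phi> \<tau> \<Phi> = p \<Phi>, where p is the form of \<tau> at \<open>\<phi>\<close>. This root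
  is sqrt p \<Phi>, of trace sqrt p, and the square in \<open>fidelity\<close> returns p.\<close>

lemma fidelity_pure_state:
  assumes fin: "finite X" and \<tau>: "\<tau> \<in> states X"
    and \<phi>: "inner_on X \<phi> \<phi> = 1" "\<And>x. x \<notin> X \<Longrightarrow> \<phi> x = 0"
  shows "fidelity X \<tau> (pure_state \<phi>) = Re (form X \<tau> \<phi>)"
proof -
  let ?\<Phi> = "pure_state \<phi>"
  define s where "s = op_sqrt X \<tau>"
  note s = op_sqrt_props[OF fin statesD(1,2)[OF \<tau>], folded s_def]
  note \<Phi> = pure_state_state[OF \<phi>]
  have herm: "op_adjoint s = s" "op_adjoint ?\<Phi> = ?\<Phi>"
    using op_adjoint_eq[OF s(1) op_pos_hermitian[OF fin s(2)]]
      op_adjoint_eq[OF statesD(1)[OF \<Phi>] op_pos_hermitian[OF fin statesD(2)[OF \<Phi>]]] by auto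
  have sqrt\<Phi>: "op_sqrt X ?\<Phi> = ?\<Phi>"
    by (rule op_sqrt_unique[OF fin statesD(1,2)[OF \<Phi>] pure_state_idem[OF \<phi>(1)]])
  define p where "p = Re (form X \<tau> \<phi>)"
  have p0: "0 \<le> p" using op_pos_Re[OF statesD(2)[OF \<tau>]] by (simp add: p_def)
  have p: "form X \<tau> \<phi> = of_real p"
    using op_pos_Im[OF statesD(2)[OF \<tau>], of \<phi>] by (simp add: p_def complex_eq_iff)
  have "op_mult X (op_adjoint (op_mult X s ?\<Phi>)) (op_mult X s ?\<Phi>)
      = op_mult X ?\<Phi> (op_mult X (op_mult X s s) ?\<Phi>)"
    by (simp only: op_adjoint_mult herm op_mult_assoc)
  also have "\<dots> = (\<lambda>x y. of_real p * ?\<Phi> x y)"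
    by (simp only: s(3) op_mult_pure_state p)
  finally have MM: "op_mult X (op_adjoint (op_mult X s ?\<Phi>)) (op_mult X s ?\<Phi>) = (\<lambda>x y. of_real p * ?\<Phi> x y)" .
  let ?K = "\<lambda>x y. of_real (sqrt p) * ?\<Phi> x y"
  have "op_sqrt X (\<lambda>x y. of_real p * ?\<Phi> x y) = ?K"
  proof (rule op_sqrt_unique[OF fin])
    show "?K \<in> opers X"
      using statesD(1)[OF \<Phi>] by (intro opersI) (simp add: opers_eq_0)
    have "form X ?K v = of_real (sqrt p * overlap X \<phi> v)" for v
      using form_linear[of X "of_real (sqrt p)" ?\<Phi> 0 ?\<Phi> v] by (simp add: form_pure_state)
    then show "op_pos X ?K"
      using p0 overlap_nonneg[of X \<phi>] by (simp add: op_pos_iff del: of_real_mult)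
    have "op_mult X ?K ?K x y = of_real (sqrt p * sqrt p) * op_mult X ?\<Phi> ?\<Phi> x y" for x y
      unfolding op_mult_def sum_distrib_left by (intro sum.cong refl) (simp only: of_real_mult mult_ac)
    then show "op_mult X ?K ?K = (\<lambda>x y. of_real p * ?\<Phi> x y)"
      using p0 by (simp add: pure_state_idem[OF \<phi>(1)] fun_eq_iff del: of_real_mult)
  qed
  then have "trace_norm X (op_mult X s ?\<Phi>) = Re (op_trace X ?K)"
    by (simp only: trace_norm_def MM)
  also have "op_trace X ?K = of_real (sqrt p)"
    using op_trace_pure_state[of X \<phi>] by (simp add: op_trace_def sum_distrib_left[symmetric] \<phi>(1))
  finally have "trace_norm X (op_mult X s ?\<Phi>) = sqrt p" by simp
  then show ?thesis
    using p0 by (simp add: fidelity_def sqrt\<Phi> s_def[symmetric] p_def)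
qed

text \<open>In an eigenbasis the form weights the nonnegative eigenvalues by overlaps with a unit
  vector, each at most 1.\<close>

lemma form_le_trace:
  assumes fin: "finite X" and M: "M \<in> opers X" "op_pos X M" and \<phi>: "inner_on X \<phi> \<phi> = 1"
  shows "Re (form X M \<phi>) \<le> Re (op_trace X M)"
proof -
  obtain u l where on: "orthonormal X u" and l: "\<And>k. k \<in> X \<Longrightarrow> 0 \<le> l k" and eq: "M = spec_op X u l"
    using op_pos_spec_opE[OF fin M] by metis
  have "complex_of_real (\<Sum>x\<in>X. (cmod (\<phi> x))\<^sup>2) = of_real 1"
    using \<phi> by (simp only: inner_on_self of_real_1)
  then have "(\<Sum>k\<in>X. overlap X (u k) \<phi>) = 1"
    unfolding sum_overlap[OF fin on] of_real_eq_iff .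
  then have "overlap X (u k) \<phi> \<le> 1" if "k \<in> X" for k
    using member_le_sum[of k X "\<lambda>k. overlap X (u k) \<phi>"] that fin overlap_nonneg by fastforce
  then have "(\<Sum>k\<in>X. l k * overlap X (u k) \<phi>) \<le> (\<Sum>k\<in>X. l k)"
    using l by (intro sum_mono) (simp add: mult_left_le)
  then show ?thesis by (simp add: eq form_spec_op op_trace_spec_op[OF fin on])
qed

section \<open>The maximally entangled state\<close>

definition max_entangled :: "'a set \<Rightarrow> 'a \<times> 'a \<Rightarrow> complex" where
  "max_entangled A = (\<lambda>(r, x). if r = x \<and> r \<in> A then of_real (1 / sqrt (real (card A))) else 0)"

lemma max_entangled_outside: "p \<notin> A \<times> A \<Longrightarrow> max_entangled A p = 0"
  by (cases p) (auto simp: max_entangled_def)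

lemma sum_max_entangled:
  assumes fin: "finite A" and r: "r \<in> A"
  shows "(\<Sum>x\<in>A. max_entangled A (r, x) * f x) = of_real (1 / sqrt (real (card A))) * f r"
proof -
  have "(\<Sum>x\<in>A. max_entangled A (r, x) * f x)
      = (\<Sum>x\<in>A. (of_real (1 / sqrt (real (card A))) * f x) * (if r = x then 1 else 0))"
    using r by (intro sum.cong refl) (simp add: max_entangled_def)
  also have "\<dots> = of_real (1 / sqrt (real (card A))) * f r"
    by (rule sum_mult_delta(2)[OF fin r])
  finally show ?thesis .
qed

lemma marginal_fst_max_entangled:
  assumes fin: "finite A"
  shows "marginal_fst A (pure_state (max_entangled A)) = max_mixed A"
proof (rule opers_eqI)
  show "marginal_fst A (pure_state (max_entangled A)) \<in> opers A"
    by (rule marginal_fst_opers, unfold opers_def)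
      (auto simp: pure_state_def max_entangled_def split: if_splits)
  show "max_mixed A \<in> opers A"
    unfolding opers_def by (auto simp: max_mixed_def split: if_splits)
  fix r r' assume r: "r \<in> A" "r' \<in> A"
  have "marginal_fst A (pure_state (max_entangled A)) r r'
      = of_real (1 / sqrt (real (card A))) * cnj (max_entangled A (r', r))"
    unfolding marginal_fst_def pure_state_def by (rule sum_max_entangled[OF fin r(1)])
  also have "\<dots> = max_mixed A r r'"
  proof (cases "r = r'")
    case True
    have "complex_of_real (1 / sqrt (real (card A))) * cnj (of_real (1 / sqrt (real (card A))))
      = of_real ((1 / sqrt (real (card A))) * (1 / sqrt (real (card A))))"
      by (simp only: complex_cnj_complex_of_real of_real_mult)
    also have "(1 / sqrt (real (card A))) * (1 / sqrt (real (card A))) = 1 / real (card A)" by simp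
    finally show ?thesis using r True by (simp add: max_entangled_def max_mixed_def)
  next
    case False
    then show ?thesis by (simp add: max_entangled_def max_mixed_def)
  qed
  finally show "marginal_fst A (pure_state (max_entangled A)) r r' = max_mixed A r r'" .
qed

lemma max_entangled_normalized:
  assumes fin: "finite A" "A \<noteq> {}"
  shows "inner_on (A \<times> A) (max_entangled A) (max_entangled A) = 1"
proof -
  have "inner_on (A \<times> A) (max_entangled A) (max_entangled A) = op_trace A (max_mixed A)"
    unfolding op_trace_pure_state[symmetric] op_trace_marginal_fst[symmetric]
      marginal_fst_max_entangled[OF fin(1)] ..
  also have "\<dots> = 1"
    using fin by (simp add: op_trace_def max_mixed_def)
  finally show ?thesis .
qed

lemma max_entangled_state:
  "finite A \<Longrightarrow> A \<noteq> {} \<Longrightarrow> pure_state (max_entangled A) \<in> states (A \<times> A)"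
  by (intro pure_state_state max_entangled_normalized max_entangled_outside)

text \<open>The block at \<open>r\<close> contributes \<sigma> r r / d and the mixed factor another
  1 / d, so only the trace of \<sigma> counts. This is the value for a decoder whose input is
  uncorrelated with the reference.\<close>

lemma form_product_max_entangled:
  assumes fin: "finite A" and tr: "op_trace A \<sigma> = 1"
  shows "form (A \<times> A) (op_tensor (max_mixed A) \<sigma>) (max_entangled A) = of_real (1 / (real (card A))\<^sup>2)"
proof -
  have "form A \<sigma> (\<lambda>y. max_entangled A (r, y)) = \<sigma> r r / of_nat (card A)" if r: "r \<in> A" for r
  proof -
    have "form A \<sigma> (\<lambda>y. max_entangled A (r, y)) = form {r} \<sigma> (\<lambda>y. max_entangled A (r, y))"
      using r by (intro form_support[OF fin]) (auto simp: max_entangled_def)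
    also have "\<dots> = of_real ((1 / sqrt (real (card A))) * (1 / sqrt (real (card A)))) * \<sigma> r r"
      using r by (simp add: form_def max_entangled_def) (simp flip: of_real_mult)
    also have "(1 / sqrt (real (card A))) * (1 / sqrt (real (card A))) = 1 / real (card A)" by simp
    finally show ?thesis by simp
  qed
  then have "form (A \<times> A) (op_tensor (max_mixed A) \<sigma>) (max_entangled A)
      = (\<Sum>r\<in>A. \<sigma> r r / of_nat (card A)) / of_nat (card A)"
    by (simp only: form_max_mixed_tensor[OF fin] cong: sum.cong)
  also have "\<dots> = of_real (1 / (real (card A))\<^sup>2)"
    using tr by (simp add: op_trace_def sum_divide_distrib[symmetric] power2_eq_square)
  finally show ?thesis .
qed

lemma id_tensor_linear:
  assumes T: "T \<in> channels X Y" and M: "M \<in> opers (R \<times> X)" and N: "N \<in> opers (R \<times> X)"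
  shows "id_tensor T (\<lambda>p q. a * M p q + b * N p q) = (\<lambda>p q. a * id_tensor T M p q + b * id_tensor T N p q)"
  by (auto simp: id_tensor_def fun_eq_iff channel_linear[OF T block_opers[OF M] block_opers[OF N]])

text \<open>For s = \<delta>, an error operator of trace at most \<delta>^2 contributes at most (1 +
  1 / \<delta>) \<delta>^2 = \<delta>^2 + \<delta>, while the factor 1 + \<delta> on the product
  state costs \<delta> / d^2.\<close>

lemma decoded_fidelity_le:
  fixes d :: nat
  defines "A \<equiv> {..<d}"
  assumes d: "2 \<le> d" and Y: "finite Y" and P: "P \<in> states (A \<times> Y)" and marg: "marginal_fst Y P = max_mixed A"
    and I: "mutual_info A Y P = ereal I" "I * ln 2 \<le> \<delta>\<^sup>2" and \<delta>: "0 < \<delta>" "\<delta> < 1 / 2"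
    and D: "D \<in> channels Y A"
  shows "fidelity (A \<times> A) (id_tensor D P) (pure_state (max_entangled A)) \<le> 1 / (real d)\<^sup>2 + 2 * \<delta>"
proof -
  have "0 \<in> A" using d by (simp add: A_def)
  then have A: "finite A" "A \<noteq> {}" "card A = d" by (auto simp: A_def)
  let ?\<phi> = "max_entangled A" and ?\<rho> = "marginal_snd A P"
  let ?Q = "op_tensor (max_mixed A) ?\<rho>"
  let ?F = "\<lambda>M. form (A \<times> A) (id_tensor D M) ?\<phi>"
  have \<rho>: "?\<rho> \<in> states Y" by (rule marginal_snd_state[OF A(1) Y P])
  have Q: "?Q \<in> states (A \<times> Y)" by (rule max_mixed_tensor_state[OF A(1,2) Y \<rho>])
  have rel: "rel_entropy (A \<times> Y) P ?Q = ereal I" using I(1) by (simp add: mutual_info_def marg)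
  obtain C where C: "C \<in> opers (A \<times> Y)" "op_pos (A \<times> Y) C" "Re (op_trace (A \<times> Y) C) \<le> I * ln 2"
    and pos: "\<And>s. 0 < s \<Longrightarrow> op_pos (A \<times> Y)
      (\<lambda>x y. 1 * (of_real (1 + s) * ?Q x y + of_real (1 + 1 / s) * C x y) + (-1) * P x y)"
    using hellinger_sandwich[OF _ P Q rel] A(1) Y by blast
  have norm: "inner_on (A \<times> A) ?\<phi> ?\<phi> = 1" by (rule max_entangled_normalized[OF A(1,2)])
  note QC = linear_opers[OF statesD(1)[OF Q] C(1), of "of_real (1 + \<delta>)" "of_real (1 + 1 / \<delta>)"]
  \<comment> \<open>Complete positivity of the decoder, with \<open>{..<d}\<close> as reference,
    carries the operator inequality over to the decoded states.\<close>
  have "0 \<le> Re (?F (\<lambda>x y. 1 * (of_real (1 + \<delta>) * ?Q x y + of_real (1 + 1 / \<delta>) * C x y) + (-1) * P x y))"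
    by (intro op_pos_Re channel_pos[OF D, of _ d, folded A_def] linear_opers[OF QC statesD(1)[OF P]] pos[OF \<delta>(1)])
  also have "?F (\<lambda>x y. 1 * (of_real (1 + \<delta>) * ?Q x y + of_real (1 + 1 / \<delta>) * C x y) + (-1) * P x y)
      = 1 * (of_real (1 + \<delta>) * ?F ?Q + of_real (1 + 1 / \<delta>) * ?F C) + (-1) * ?F P"
    by (simp only: id_tensor_linear[OF D QC statesD(1)[OF P]]
        id_tensor_linear[OF D statesD(1)[OF Q] C(1)] form_linear)
  finally have le: "Re (?F P) \<le> (1 + \<delta>) * Re (?F ?Q) + (1 + 1 / \<delta>) * Re (?F C)" by simp
  have "Re (?F ?Q) = 1 / (real d)\<^sup>2"
    using form_product_max_entangled[OF A(1), of "D ?\<rho>"] channel_trace[OF D statesD(1)[OF \<rho>]] statesD(3)[OF \<rho>]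
    by (simp add: id_tensor_op_tensor[OF D statesD(1)[OF \<rho>]] A(3) del: of_real_divide of_real_power)
  with le have "Re (?F P) \<le> 1 / (real d)\<^sup>2 + \<delta> * (1 / (real d)\<^sup>2) + (1 + 1 / \<delta>) * Re (?F C)"
    by (simp only: distrib_right mult_1)
  moreover have "(1 + 1 / \<delta>) * Re (?F C) \<le> (1 + 1 / \<delta>) * \<delta>\<^sup>2"
  proof -
    have "Re (?F C) \<le> Re (op_trace (A \<times> A) (id_tensor D C))"
      using A(1) C(1,2) by (intro form_le_trace[OF _ _ _ norm] id_tensor_opers[OF D]
          channel_pos[OF D, of _ d, folded A_def]) auto
    also have "\<dots> \<le> \<delta>\<^sup>2"
      using C(3) I(2) by (simp add: id_tensor_trace[OF D C(1)])
    finally show ?thesis using \<delta> by (intro mult_left_mono) auto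
  qed
  moreover have "(1 + 1 / \<delta>) * \<delta>\<^sup>2 = \<delta>\<^sup>2 + \<delta>"
    using \<delta> by (simp add: field_simps power2_eq_square)
  \<comment> \<open>Here d >= 2 and \<delta> < 1 / 2 enter: the left side is at most (1 / 4 + 1 / 2)
    \<delta>.\<close>
  moreover have "\<delta> * (1 / (real d)\<^sup>2) + \<delta>\<^sup>2 \<le> \<delta>"
  proof -
    have "2\<^sup>2 \<le> (real d)\<^sup>2" using d by (intro power_mono) auto
    then have "1 / (real d)\<^sup>2 \<le> 1 / 4" using d by (intro divide_left_mono) auto
    then have "\<delta> * (1 / (real d)\<^sup>2 + \<delta>) \<le> \<delta> * 1" using \<delta> by (intro mult_left_mono) auto
    then show ?thesis by (simp add: power2_eq_square algebra_simps)
  qed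
  ultimately have "Re (?F P) \<le> 1 / (real d)\<^sup>2 + 2 * \<delta>" by linarith
  moreover have "fidelity (A \<times> A) (id_tensor D P) (pure_state ?\<phi>) = Re (?F P)"
    using A(1) id_tensor_state[OF D, of P d, folded A_def, OF P]
    by (intro fidelity_pure_state norm max_entangled_outside) auto
  ultimately show ?thesis by simp
qed

subsection \<open>The sharing bound\<close>

text \<open>Maps that agree on \<open>opers X\<close> may still differ as functions, so compositions
  of channels are compared through their action on operators of the right support.\<close>

lemma id_tensor_cong:
  assumes "\<And>M. M \<in> opers X \<Longrightarrow> T M = T' M" "P \<in> opers (R \<times> X)"
  shows "id_tensor T P = id_tensor T' P"
  using assms(1)[OF block_opers[OF assms(2)]] by (auto simp: id_tensor_def fun_eq_iff)

text \<open>The infimum is over reals, so a lower bound must be exhibited; 0 serves because the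
  fidelity is a square.\<close>

lemma channel_fidelity_le:
  assumes "0 < r" "M \<in> states ({..<r::nat} \<times> X)"
  shows "channel_fidelity X Y T T' \<le> fidelity ({..<r} \<times> Y) (id_tensor T M) (id_tensor T' M)"
  unfolding channel_fidelity_def
proof (rule cInf_lower)
  show "bdd_below {fidelity ({..<r} \<times> Y) (id_tensor T M) (id_tensor T' M) |(r::nat) M. r > 0 \<and> M \<in> states ({..<r} \<times> X)}"
    by (rule bdd_belowI[of _ 0]) (auto simp: fidelity_def)
qed (use assms in blast)

text \<open>Bounding a supremum of reals over the decoders presupposes that a decoder exists. The
  witness discards its input and prepares the basis state \<open>a\<close>; its Kraus operators are
  |a><k|.\<close>

lemma channels_nonempty:
  fixes X :: "'a set" and Y :: "'b set"
  assumes fin: "finite X" "finite Y" and a: "a \<in> Y"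
  shows "channels X Y \<noteq> {}"
proof -
  define J :: "'a \<Rightarrow> 'a \<Rightarrow> 'b \<Rightarrow> 'b \<Rightarrow> complex"
    where "J = (\<lambda>x x' y y'. if x = x' \<and> y = a \<and> y' = a then 1 else 0)"
  define T where "T = (\<lambda>M y y'. if y \<in> Y \<and> y' \<in> Y then \<Sum>x\<in>X. \<Sum>x'\<in>X. M x x' * J x x' y y' else 0)"
  define K :: "'a \<Rightarrow> 'b \<Rightarrow> 'a \<Rightarrow> complex" where "K = (\<lambda>k y x. if x = k \<and> y = a then 1 else 0)"
  have "kraus_on X Y J X K"
    unfolding kraus_on_def
  proof (intro ballI)
    fix x x' y y' assume x: "x \<in> X" "x' \<in> X"
    have "(\<Sum>k\<in>X. K k y x * cnj (K k y' x'))
      = (\<Sum>k\<in>X. (if y = a \<and> y' = a \<and> x' = k then 1 else 0) * (if x = k then 1 else 0))"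
      unfolding K_def by (intro sum.cong refl) auto
    also have "\<dots> = (if y = a \<and> y' = a \<and> x' = x then 1 else 0)"
      by (rule sum_mult_delta(2)[OF fin(1) x(1)])
    finally show "J x x' y y' = (\<Sum>k\<in>X. K k y x * cnj (K k y' x'))"
      by (auto simp: J_def)
  qed
  then have "T \<in> channels X Y"
  proof (rule kraus_channel[OF fin])
    fix x x'
    have "(\<Sum>y\<in>Y. J x x' y y) = (\<Sum>y\<in>Y. (if x = x' then 1 else 0) * (if y = a then 1 else 0))"
      unfolding J_def by (intro sum.cong refl) auto
    also have "\<dots> = (if x = x' then 1 else 0)"
      by (rule sum_mult_delta(1)[OF fin(2) a])
    finally show "(\<Sum>y\<in>Y. J x x' y y) = (if x = x' then 1 else 0)" .
  next
    fix M show "T M \<in> opers Y" by (rule opersI) (auto simp: T_def)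
  qed (simp add: T_def)
  then show ?thesis by blast
qed

lemma iterate_channel:
  assumes "\<And>i. T (Suc i) \<in> channels (X i) (X (Suc i))"
  shows "iterate T n \<in> channels (X 0) (X n)"
proof (induction n)
  case 0
  show ?case unfolding iterate.simps by (rule id_channel)
next
  case (Suc n)
  show ?case unfolding iterate.simps by (rule channels_comp[OF Suc.IH assms])
qed

text \<open>Exchanges composition per user, as in the noise model, with composition per time step,
  as in the product of the \<open>eta_MI\<close>. The index \<open>i - 1\<close> occurs because
  \<open>iterate\<close> starts with the map number 1. At n = 0 the left side cuts its argument to
  \<open>PiE S (B 0)\<close>, hence the restriction to \<open>opers\<close>.\<close>

lemma tensor_channel_iterate:
  assumes S: "finite S" and B: "\<And>i j. j \<in> S \<Longrightarrow> finite (B i j)"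
    and N: "\<And>i j. j \<in> S \<Longrightarrow> N (Suc i) j \<in> channels (B i j) (B (Suc i) j)"
    and M: "M \<in> opers (PiE S (B 0))"
  shows "tensor_channel S (B 0) (B n) (\<lambda>j. iterate (\<lambda>i. N i j) n) M
    = iterate (\<lambda>i. tensor_channel S (B (i - 1)) (B i) (N i)) n M"
proof (induction n)
  case 0
  have "tensor_channel S (B 0) (B 0) (\<lambda>j. id) M = M"
    by (intro tensor_channel_id S B M)
  then show ?case unfolding iterate.simps by (rule trans[OF _ id_apply[symmetric]])
next
  case (Suc n)
  have "iterate (\<lambda>i. N i j) n \<in> channels (B 0 j) (B n j)" if "j \<in> S" for j
    using iterate_channel[of "\<lambda>i. N i j" "\<lambda>i. B i j" n] N[OF that] by blast
  then have "tensor_channel S (B n) (B (Suc n)) (N (Suc n)) (tensor_channel S (B 0) (B n) (\<lambda>j. iterate (\<lambda>i. N i j) n) M)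
      = tensor_channel S (B 0) (B (Suc n)) (\<lambda>j. N (Suc n) j \<circ> iterate (\<lambda>i. N i j) n) M"
    using B N by (intro tensor_channel_comp[OF S]) auto
  then show ?case unfolding iterate.simps o_apply Suc.IH diff_Suc_1 by (rule sym)
qed

text \<open>The steps after \<open>k\<close> are composed with the decoder one at a time, so a bound
  on all decoders after \<open>k\<close> steps holds for every later \<open>n\<close> too.\<close>

lemma decoder_absorbs_channels:
  assumes T: "\<And>i. T (Suc i) \<in> channels (X i) (X (Suc i))" and "k \<le> n" "D \<in> channels (X n) A"
  shows "\<exists>D'\<in>channels (X k) A. D \<circ> iterate T n = D' \<circ> iterate T k"
  using assms(2,3)
proof (induction n arbitrary: D rule: dec_induct)
  case base
  then show ?case by blast
next
  case (step n)
  have "D \<circ> T (Suc n) \<in> channels (X n) A"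
    by (rule channels_comp[OF T step.prems])
  then show ?case using step.IH[of "D \<circ> T (Suc n)"] by (simp only: iterate.simps o_assoc)
qed

lemma mutual_info_iterate_le:
  assumes T: "\<And>i. T (Suc i) \<in> channels (X i) (X (Suc i))" and fin: "\<And>i. finite (X i)" and c: "0 < c"
    and P: "P \<in> states ({..<c::nat} \<times> X 0)" and marg: "marginal_fst (X 0) P = max_mixed {..<c}"
  shows "e2ennreal (mutual_info {..<c} (X k) (id_tensor (iterate T k) P))
    \<le> (\<Prod>i=1..k. eta_MI (X (i - 1)) (X i) (T i)) * e2ennreal (mutual_info {..<c} (X 0) P)"
proof (induction k)
  case 0
  show ?case unfolding iterate.simps id_tensor_id by simp
next
  case (Suc k)
  let ?P = "id_tensor (iterate T k) P"
  note it = iterate_channel[of T X k, OF T]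
  have "e2ennreal (mutual_info {..<c} (X (Suc k)) (id_tensor (T (Suc k)) ?P))
      \<le> eta_MI (X k) (X (Suc k)) (T (Suc k)) * e2ennreal (mutual_info {..<c} (X k) ?P)"
    using marginal_fst_id_tensor[OF it statesD(1)[OF P]] marg
    by (intro mutual_info_channel_le[OF T fin fin c] id_tensor_state[OF it P]) simp
  also have "\<dots> \<le> eta_MI (X k) (X (Suc k)) (T (Suc k)) *
      ((\<Prod>i=1..k. eta_MI (X (i - 1)) (X i) (T i)) * e2ennreal (mutual_info {..<c} (X 0) P))"
    by (intro mult_left_mono Suc.IH) simp
  also have "\<dots> = (\<Prod>i=1..Suc k. eta_MI (X (i - 1)) (X i) (T i)) * e2ennreal (mutual_info {..<c} (X 0) P)"
    by (simp add: mult_ac)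
  finally show ?case by (simp only: iterate.simps id_tensor_comp)
qed

text \<open>The initial mutual information is at most 2 log q, whether q is the dimension of the
  input or an upper bound for that of the reference. The 2 log q cancels against the denominator of
  the assumed bound, which leaves \<delta>^2 / ln 2.\<close>

lemma mutual_info_iterate_bound:
  assumes T: "\<And>i. T (Suc i) \<in> channels (X i) (X (Suc i))" and fin: "\<And>i. finite (X i)" and c: "0 < c"
    and P: "P \<in> states ({..<c::nat} \<times> X 0)" and marg: "marginal_fst (X 0) P = max_mixed {..<c}"
    and q: "1 \<le> q" "q = real (card (X 0)) \<or> real c \<le> q"
    and eta: "(\<Prod>i=1..k. eta_MI (X (i - 1)) (X i) (T i)) \<le> ennreal (\<delta>\<^sup>2 / (2 * ln 2 * log 2 q))"
  shows "\<exists>I. mutual_info {..<c} (X k) (id_tensor (iterate T k) P) = ereal I \<and> I * ln 2 \<le> \<delta>\<^sup>2"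
proof -
  note it = iterate_channel[of T X k, OF T]
  have ne: "{..<c} \<noteq> {}" using c by auto
  obtain I0 where I0: "mutual_info {..<c} (X 0) P = ereal I0" "0 \<le> I0"
    "I0 \<le> 2 * log 2 (real (card {..<c}))" "I0 \<le> 2 * log 2 (real (card (X 0)))"
    by (rule mutual_info_max_mixed[OF finite_lessThan ne fin P marg])
  obtain I where I: "mutual_info {..<c} (X k) (id_tensor (iterate T k) P) = ereal I" "0 \<le> I"
    by (rule mutual_info_max_mixed[OF finite_lessThan ne fin id_tensor_state[OF it P]])
      (use marginal_fst_id_tensor[OF it statesD(1)[OF P]] marg in simp)
  let ?L = "log 2 q"
  have L0: "0 \<le> ?L" using q(1) by simp
  have "log 2 (real c) \<le> ?L" if "real c \<le> q" using that c by simp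
  then have IL: "I0 \<le> 2 * ?L" using I0(3,4) q(2) by auto
  have "ennreal I \<le> (\<Prod>i=1..k. eta_MI (X (i - 1)) (X i) (T i)) * ennreal I0"
    using mutual_info_iterate_le[of T X c P k, OF T fin c P marg] by (simp add: I(1) I0(1))
  also have "\<dots> \<le> ennreal (\<delta>\<^sup>2 / (2 * ln 2 * ?L)) * ennreal (2 * ?L)"
    using IL by (intro mult_mono eta ennreal_leI) auto
  also have "\<dots> = ennreal (\<delta>\<^sup>2 / (2 * ln 2 * ?L) * (2 * ?L))"
    using L0 by (intro ennreal_mult[symmetric]) auto
  finally have "I \<le> \<delta>\<^sup>2 / (2 * ln 2 * ?L) * (2 * ?L)"
    using L0 by (subst (asm) ennreal_le_iff) auto
  \<comment> \<open>For q = 1 the denominator vanishes and the quotient is 0 by convention, so the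
    product is 0.\<close>
  also have "\<dots> \<le> \<delta>\<^sup>2 / ln 2"
    by (cases "?L = 0") auto
  finally have "I * ln 2 \<le> \<delta>\<^sup>2" by (simp add: field_simps)
  with I(1) show ?thesis by blast
qed

theorem mainTheorem20:
  fixes m t d :: nat
    and b :: "nat \<Rightarrow> nat \<Rightarrow> nat"
    and B :: "nat \<Rightarrow> nat \<Rightarrow> nat set"
    and N :: "nat \<Rightarrow> nat \<Rightarrow> nat oper \<Rightarrow> nat oper"
    and \<delta> \<epsilon> :: real
  assumes dims: "\<And>i j. j \<in> {1..m} \<Longrightarrow> 0 < b i j"
    and B_def: "\<And>i j. B i j = {..<b i j}"
    and channel: "\<And>i j. j \<in> {1..m} \<Longrightarrow> N (Suc i) j \<in> channels (B i j) (B (Suc i) j)"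
    and \<delta>: "0 < \<delta>" "\<delta> < (real d - 1) / (2 * real d)"
    and \<epsilon>: "0 < \<epsilon>" "\<epsilon> < (real d - 1) / (2 * real d) - \<delta>"
  shows "\<forall>n::nat.
    enat n > Inf {enat k | k. k \<ge> 1 \<and> (\<exists>S\<in>user_sets t m.
        (\<Prod>i=1..k. eta_MI (PiE S (B (i - 1))) (PiE S (B i))
            (tensor_channel S (B (i - 1)) (B i) (N i)))
        \<le> ennreal (\<delta>\<^sup>2 / (2 * ln 2 * log 2 (real (min
            (card (PiE S (B 0)))
            (card ({..<d} \<times> PiE ({1..m} - S) (B 0))))))))}
    \<longrightarrow> \<not> (\<exists>E \<in> channels {..<d} (PiE {1..m} (B 0)).
          recoverable t m {..<d} (B n)
            (tensor_channel {1..m} (B 0) (B n) (\<lambda>j. iterate (\<lambda>i. N i j) n)) \<epsilon> E)"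
proof (intro allI impI notI)
  fix n
  assume "enat n > Inf {enat k | k. k \<ge> 1 \<and> (\<exists>S\<in>user_sets t m.
        (\<Prod>i=1..k. eta_MI (PiE S (B (i - 1))) (PiE S (B i))
            (tensor_channel S (B (i - 1)) (B i) (N i)))
        \<le> ennreal (\<delta>\<^sup>2 / (2 * ln 2 * log 2 (real (min
            (card (PiE S (B 0)))
            (card ({..<d} \<times> PiE ({1..m} - S) (B 0))))))))}"
  \<comment> \<open>If no \<open>k\<close> is admissible, the infimum is infinity and the premise
    fails; otherwise some admissible \<open>k\<close> lies below \<open>n\<close>.\<close>
  then obtain k S where k: "k < n" and S: "S \<in> user_sets t m"
    and eta: "(\<Prod>i=1..k. eta_MI (PiE S (B (i - 1))) (PiE S (B i)) (tensor_channel S (B (i - 1)) (B i) (N i)))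
        \<le> ennreal (\<delta>\<^sup>2 / (2 * ln 2 * log 2 (real (min
            (card (PiE S (B 0))) (card ({..<d} \<times> PiE ({1..m} - S) (B 0)))))))"
    unfolding Inf_less_iff by auto
  assume "\<exists>E \<in> channels {..<d} (PiE {1..m} (B 0)).
          recoverable t m {..<d} (B n)
            (tensor_channel {1..m} (B 0) (B n) (\<lambda>j. iterate (\<lambda>i. N i j) n)) \<epsilon> E"
  then obtain E where E: "E \<in> channels {..<d} (PiE {1..m} (B 0))"
    and rec: "recoverable t m {..<d} (B n)
            (tensor_channel {1..m} (B 0) (B n) (\<lambda>j. iterate (\<lambda>i. N i j) n)) \<epsilon> E"
    by blast
  let ?A = "{..<d}" and ?J = "{1..m}"
  let ?N = "tensor_channel ?J (B 0) (B n) (\<lambda>j. iterate (\<lambda>i. N i j) n)"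
  let ?\<Phi> = "pure_state (max_entangled ?A)"
  define T where "T = (\<lambda>i. tensor_channel S (B (i - 1)) (B i) (N i))"
  define X where "X = (\<lambda>i. PiE S (B i))"
  have "0 < (real d - 1) / (2 * real d)" using \<delta> by linarith
  \<comment> \<open>The interval for \<delta> is empty at d = 1, and also at d = 0, where the
    quotient is 0 by convention.\<close>
  then have d: "2 \<le> d" by (cases "d = 0"; cases "d = 1") (auto simp: zero_less_divide_iff)
  then have "(real d - 1) / (2 * real d) < 1 / 2" by (simp add: field_simps)
  with \<delta>(2) have \<delta>2: "\<delta> < 1 / 2" by linarith
  have SJ: "S \<subseteq> ?J" using S by (auto simp: user_sets_def)
  then have Sm: "j \<in> ?J" if "j \<in> S" for j using that by blast
  have fS: "finite S" using SJ by (rule finite_subset) simp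
  have Bfin: "finite (B i j)" for i j by (simp add: B_def)
  have finX: "finite (X i)" for i
    unfolding X_def using fS Bfin by (rule finite_PiE)
  have T: "T (Suc i) \<in> channels (X i) (X (Suc i))" for i
  proof -
    \<comment> \<open>The systems are initial segments of the naturals, as the Kraus decomposition
      of the single channels demands.\<close>
    have "B i = (\<lambda>j. {..<b i j})" by (rule ext) (rule B_def)
    then have "tensor_channel S (B i) (B (Suc i)) (N (Suc i)) \<in> channels (PiE S (B i)) (PiE S (B (Suc i)))"
      using channel[OF Sm, of _ i] by (simp only:) (intro tensor_channel_channel fS Bfin)
    then show ?thesis by (simp add: T_def X_def)
  qed
  \<comment> \<open>The encoder followed by discarding the users outside \<open>S\<close>. Their
    noise is invisible to the decoder, so the discarding may precede the noise.\<close>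
  define F where "F = trace_out ?J S (B 0) \<circ> E"
  have F: "F \<in> channels ?A (X 0)"
    unfolding F_def X_def by (rule channels_comp[OF E trace_out_channel[OF SJ _ Bfin]]) simp
  have A: "?A \<noteq> {}" using d by (auto simp: lessThan_empty_iff)
  have \<Phi>: "?\<Phi> \<in> states (?A \<times> ?A)" using A by (intro max_entangled_state) auto
  let ?P = "id_tensor F ?\<Phi>"
  have P: "?P \<in> states (?A \<times> X 0)" by (rule id_tensor_state[OF F \<Phi>])
  have margP: "marginal_fst (X 0) ?P = max_mixed ?A"
    using marginal_fst_id_tensor[OF F statesD(1)[OF \<Phi>]] by (simp add: marginal_fst_max_entangled)
  have card_pos: "0 < card (PiE R (B 0))" if "R \<subseteq> ?J" for R
    using that dims by (subst card_PiE) (auto simp: B_def finite_subset intro!: prod_pos)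
  \<comment> \<open>The second entry of the minimum is at least \<open>d\<close>, the dimension of
    the reference; so whichever entry is the smaller one, \<open>q\<close> meets the assumptions of
    \<open>mutual_info_iterate_bound\<close>.\<close>
  define q where "q = real (min (card (X 0)) (card (?A \<times> PiE (?J - S) (B 0))))"
  have cR: "real d \<le> real (card (?A \<times> PiE (?J - S) (B 0)))"
  proof -
    have "real d * 1 \<le> real d * real (card (PiE (?J - S) (B 0)))"
      using card_pos[of "?J - S"] by (intro mult_left_mono) auto
    then show ?thesis by (simp add: card_cartesian_product)
  qed
  have q: "1 \<le> q" "q = real (card (X 0)) \<or> real d \<le> q"
    using card_pos[OF SJ] cR d by (auto simp: q_def X_def min_def)
  obtain I where I: "mutual_info ?A (X k) (id_tensor (iterate T k) ?P) = ereal I" "I * ln 2 \<le> \<delta>\<^sup>2"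
    using mutual_info_iterate_bound[of T X d ?P q k \<delta>, OF T finX _ P margP q] eta d
    by (auto simp: T_def X_def q_def)
  note it = iterate_channel[of T X k, OF T]
  have decoder: "channel_fidelity ?A ?A (D \<circ> trace_out ?J S (B n) \<circ> ?N \<circ> E) id \<le> 1 / (real d)\<^sup>2 + 2 * \<delta>"
    if D: "D \<in> channels (X n) ?A" for D
  proof -
    obtain D' where D': "D' \<in> channels (X k) ?A" "D \<circ> iterate T n = D' \<circ> iterate T k"
      using decoder_absorbs_channels[of T X k n D, OF T _ D] k by auto
    have "(D \<circ> trace_out ?J S (B n) \<circ> ?N \<circ> E) M = (D' \<circ> (iterate T k \<circ> F)) M" if M: "M \<in> opers ?A" for M
    proof -
      have itj: "iterate (\<lambda>i. N i j) n \<in> channels (B 0 j) (B n j)" if "j \<in> ?J" for j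
        using iterate_channel[of "\<lambda>i. N i j" "\<lambda>i. B i j" n] channel[OF that] by blast
      have "trace_out ?J S (B n) (?N (E M)) = tensor_channel S (B 0) (B n) (\<lambda>j. iterate (\<lambda>i. N i j) n) (F M)"
        unfolding F_def o_apply using itj Bfin by (intro trace_out_tensor_channel[OF SJ]) auto
      also have "\<dots> = iterate T n (F M)"
        unfolding T_def
      proof (rule tensor_channel_iterate[OF fS Bfin])
        fix i j assume "j \<in> S"
        then show "N (Suc i) j \<in> channels (B i j) (B (Suc i) j)" by (intro channel Sm)
      qed (use channel_opers[OF F M] in \<open>simp add: X_def\<close>)
      finally show ?thesis using fun_cong[OF D'(2), of "F M"] by simp
    qed
    then have eq: "id_tensor (D \<circ> trace_out ?J S (B n) \<circ> ?N \<circ> E) ?\<Phi> = id_tensor D' (id_tensor (iterate T k) ?P)"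
      unfolding id_tensor_comp[symmetric] by (rule id_tensor_cong[OF _ statesD(1)[OF \<Phi>]])
    have "channel_fidelity ?A ?A (D \<circ> trace_out ?J S (B n) \<circ> ?N \<circ> E) id
        \<le> fidelity (?A \<times> ?A) (id_tensor D' (id_tensor (iterate T k) ?P)) ?\<Phi>"
      using channel_fidelity_le[OF _ \<Phi>, of ?A "D \<circ> trace_out ?J S (B n) \<circ> ?N \<circ> E" id] d
      by (simp only: eq id_tensor_id)
    also have "\<dots> \<le> 1 / (real d)\<^sup>2 + 2 * \<delta>"
      using marginal_fst_id_tensor[OF it statesD(1)[OF P]] margP
      by (intro decoded_fidelity_le[OF d finX id_tensor_state[OF it P] _ I \<delta>(1) \<delta>2 D'(1)]) simp
    finally show ?thesis .
  qed
  have "1 - \<epsilon> \<le> (MIN S\<in>user_sets t m. SUP D\<in>channels (PiE S (B n)) ?A.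
       channel_fidelity ?A ?A (D \<circ> trace_out ?J S (B n) \<circ> ?N \<circ> E) id)"
    using rec by (simp only: recoverable_def)
  also have "\<dots> \<le> (SUP D\<in>channels (X n) ?A. channel_fidelity ?A ?A (D \<circ> trace_out ?J S (B n) \<circ> ?N \<circ> E) id)"
  proof -
    have "finite (user_sets t m)"
      by (rule finite_subset[of _ "Pow ?J"]) (auto simp: user_sets_def)
    then show ?thesis unfolding X_def using S by (intro Min_le) auto
  qed
  also have "\<dots> \<le> 1 / (real d)\<^sup>2 + 2 * \<delta>"
    using channels_nonempty[OF finX, of ?A 0 n] d by (intro cSUP_least decoder) auto
  finally have le: "1 - \<epsilon> \<le> 1 / (real d)\<^sup>2 + 2 * \<delta>" .
  \<comment> \<open>In terms of x = 1 / d, adding \<delta> < (1 - x) / 2 and \<delta> + \<epsilon> <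
    (1 - x) / 2 gives 2 \<delta> + \<epsilon> < 1 - x, whereas \<open>le\<close> says that 1 - x^2
    <= 2 \<delta> + \<epsilon>. Hence x < x^2, which is impossible for 0 < x < 1.\<close>
  define x where "x = 1 / real d"
  have x: "0 < x" "x < 1" using d by (auto simp: x_def)
  have eqs: "(real d - 1) / (2 * real d) = (1 - x) / 2" "1 / (real d)\<^sup>2 = x\<^sup>2"
    using d by (simp_all add: x_def field_simps)
  have "x < x\<^sup>2"
    using \<delta>(2) \<epsilon>(2) le unfolding eqs by (simp add: field_simps)
  with x show False by (simp add: power2_eq_square)
qed

end
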